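(* Let $\Omega\subset\mathbb{R}^n$ be a bounded domain with $C^{1,\varepsilon}$ boundary, let $1<p<\infty$ and $p>n$. Then for every $m>0$ there exists $x_m\in\partial\Omega$ such that $$\lambda(m,\Omega)=\ell_1(\mu_m,\Omega)=\inf_{\mu\in\mathcal D(m)}\ell_1(\mu,\Omega),$$ where $\mu_m=m\,\delta_{x_m}\in\mathcal D(m)$ is the Dirac measure of total mass $m$ concentrated at $x_m$.
   Context: $\mathcal H^{n-1}$ is the $(n-1)$-dimensional Hausdorff measure. For $m>0$ put $$\Sigma_m(\partial\Omega)=\Big\{\sigma\in L^1(\partial\Omega):\ \sigma\ge0,\ \int_{\partial\Omega}\sigma\,d\mathcal H^{n-1}=m\Big\},$$ and for $\sigma\in\Sigma_m(\partial\Omega)$ $$\ell_1(\sigma,\Omega)=\inf_{u\in W^{1,p}(\Omega),\,u\neq0}\frac{\int_\Omega|\nabla u|^p\,dx+\int_{\partial\Omega}\sigma|u|^p\,d\mathcal H^{n-1}}{\int_\Omega|u|^p\,dx},\qquad \lambda(m,\Omega)=\inf_{\sigma\in\Sigma_m(\partial\Omega)}\ell_1(\sigma,\Omega).$$ Since $p>n$, every $u\in W^{1,p}(\Omega)$ is identified with its representative that is continuous on $\overline\Omega$. Let $\mathcal M(m)$ be the set of (nonnegative) Radon measures $\mu$ on $\partial\Omega$ with $\mu(\partial\Omega)=m$, and for $\mu\in\mathcal M(m)$ define $$\ell_1(\mu,\Omega)=\inf_{u\in W^{1,p}(\Omega),\,u\ne0}\frac{\int_\Omega|\nabla u|^p\,dx+\int_{\partial\Omega}|u|^p\,d\mu}{\int_\Omega|u|^p\,dx}.$$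 $\mathcal D(m)\subset\mathcal M(m)$ is the set of Dirac measures of mass $m$ concentrated at a boundary point, i.e. those $\mu\in\mathcal M(m)$ for which there is $x\in\partial\Omega$ with $\int_{\partial\Omega}|u|^p\,d\mu=m|u(x)|^p$ for all $u\in W^{1,p}(\Omega)$. *)

theory Defs
  imports "HOL-Probability.Probability"
begin

section \<open>Hausdorff measure\<close>

text \<open>
  The normalisation \<open>unit_ball_vol k * (diam / 2) ^ k\<close> is the usual one. The empty set needs a
  separate clause because of \<open>0 ^ 0 = 1\<close>, and covering sets have to be bounded because
  \<^const>\<open>diameter\<close> is a junk value on unbounded sets.
\<close>

definition hausdorff_gauge :: "nat \<Rightarrow> 'a::metric_space set \<Rightarrow> ennreal" where
  "hausdorff_gauge k C =
     (if C = {} then 0 else ennreal (unit_ball_vol (real k) * (diameter C / 2) ^ k))"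

definition hausdorff_covers :: "real \<Rightarrow> 'a::metric_space set \<Rightarrow> (nat \<Rightarrow> 'a set) set" where
  "hausdorff_covers \<delta> A = {C. A \<subseteq> (\<Union>i. C i) \<and> (\<forall>i. bounded (C i) \<and> diameter (C i) \<le> \<delta>)}"

definition hausdorff_pre :: "nat \<Rightarrow> real \<Rightarrow> 'a::metric_space set \<Rightarrow> ennreal" where
  "hausdorff_pre k \<delta> A = (INF C\<in>hausdorff_covers \<delta> A. \<Sum>i. hausdorff_gauge k (C i))"

definition hausdorff_outer :: "nat \<Rightarrow> 'a::metric_space set \<Rightarrow> ennreal" where
  "hausdorff_outer k A = (SUP \<delta>\<in>{0<..}. hausdorff_pre k \<delta> A)"

definition hausdorff_measure :: "nat \<Rightarrow> 'a::metric_space measure" where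
  "hausdorff_measure k = measure_of UNIV (sets borel) (hausdorff_outer k)"

text \<open>
  \<^const>\<open>measure_of\<close> yields the zero measure if its argument is not countably additive; the following
  lemmas, up to \<open>emeasure_hausdorff_measure\<close>, show that this does not happen.
\<close>

lemma hausdorff_pre_empty:
  assumes "0 < \<delta>"
  shows "hausdorff_pre k \<delta> ({} :: 'a::metric_space set) = 0"
proof -
  have "(\<lambda>_. {} :: 'a set) \<in> hausdorff_covers \<delta> {}"
    using assms by (simp add: hausdorff_covers_def)
  then have "hausdorff_pre k \<delta> ({} :: 'a set) \<le> (\<Sum>i::nat. hausdorff_gauge k ({} :: 'a set))"
    unfolding hausdorff_pre_def by (rule INF_lower)
  then show ?thesis by (simp add: hausdorff_gauge_def)
qed

lemma hausdorff_pre_mono: "A \<subseteq> B \<Longrightarrow> hausdorff_pre k \<delta> A \<le> hausdorff_pre k \<delta> B"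
  unfolding hausdorff_pre_def by (rule INF_superset_mono) (auto simp: hausdorff_covers_def)

lemma hausdorff_pre_antimono: "\<delta> \<le> \<delta>' \<Longrightarrow> hausdorff_pre k \<delta>' A \<le> hausdorff_pre k \<delta> A"
  unfolding hausdorff_pre_def
  by (rule INF_superset_mono) (auto simp: hausdorff_covers_def intro: order_trans)

lemma hausdorff_pre_countable_subadditive:
  fixes A :: "nat \<Rightarrow> 'a::metric_space set"
  shows "hausdorff_pre k \<delta> (\<Union>i. A i) \<le> (\<Sum>i. hausdorff_pre k \<delta> (A i))"
proof (rule ennreal_le_epsilon)
  fix e :: real
  assume e: "0 < e" and fin: "(\<Sum>i. hausdorff_pre k \<delta> (A i)) < top"
  have lt: "hausdorff_pre k \<delta> (A n) < hausdorff_pre k \<delta> (A n) + e * (1/2) ^ Suc n" for n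
    using e fin by (auto simp add: less_top dest!: ennreal_suminf_lessD)
  have "\<exists>C. C \<in> hausdorff_covers \<delta> (A n) \<and>
      (\<Sum>i. hausdorff_gauge k (C i)) < hausdorff_pre k \<delta> (A n) + e * (1/2) ^ Suc n" for n
    using lt[of n] unfolding hausdorff_pre_def[of k \<delta> "A n"] INF_less_iff by blast
  then obtain B where B: "\<And>n. B n \<in> hausdorff_covers \<delta> (A n)"
    and Bless: "\<And>n. (\<Sum>i. hausdorff_gauge k (B n i))
                  < hausdorff_pre k \<delta> (A n) + e * (1/2) ^ Suc n"
    by metis
  have Ble: "(\<Sum>i. hausdorff_gauge k (B n i)) \<le> hausdorff_pre k \<delta> (A n) + e * (1/2) ^ Suc n" for n
    using Bless[of n] by (rule less_imp_le)
  define C where "C = case_prod B \<circ> prod_decode"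
  have sub: "A n \<subseteq> (\<Union>i. B n i)" for n
    using B[of n] by (simp add: hausdorff_covers_def)
  have "(\<Union>i. A i) \<subseteq> (\<Union>i. C i)"
    using sub by (auto simp: C_def subset_eq) (metis prod.case prod_encode_inverse)
  moreover have "bounded (C i) \<and> diameter (C i) \<le> \<delta>" for i
    using B by (auto simp: C_def hausdorff_covers_def split: prod.split)
  ultimately have "C \<in> hausdorff_covers \<delta> (\<Union>i. A i)"
    by (simp add: hausdorff_covers_def)
  then have "hausdorff_pre k \<delta> (\<Union>i. A i) \<le> (\<Sum>i. hausdorff_gauge k (C i))"
    unfolding hausdorff_pre_def by (rule INF_lower)
  also have "\<dots> = (\<Sum>i. (hausdorff_gauge k \<circ> case_prod B) (prod_decode i))"
    by (simp add: C_def)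
  also have "\<dots> = (\<Sum>n. \<Sum>i. hausdorff_gauge k (B n i))"
    by (rule suminf_ennreal_2dimen) simp
  also have "\<dots> \<le> (\<Sum>n. hausdorff_pre k \<delta> (A n) + e * (1/2) ^ Suc n)"
    by (intro suminf_le allI Ble) auto
  also have "\<dots> = (\<Sum>n. hausdorff_pre k \<delta> (A n)) + (\<Sum>n. ennreal e * ennreal ((1/2) ^ Suc n))"
    using e by (subst suminf_add[symmetric])
               (auto simp del: ennreal_suminf_cmult simp add: ennreal_mult[symmetric])
  also have "\<dots> = (\<Sum>n. hausdorff_pre k \<delta> (A n)) + e"
    unfolding ennreal_suminf_cmult
    by (subst suminf_ennreal_eq[OF zero_le_power power_half_series]) auto
  finally show "hausdorff_pre k \<delta> (\<Union>i. A i) \<le> (\<Sum>i. hausdorff_pre k \<delta> (A i)) + e" .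
qed

lemma hausdorff_outer_empty: "hausdorff_outer k {} = 0"
  by (simp add: hausdorff_outer_def hausdorff_pre_empty cong: SUP_cong_simp)

lemma hausdorff_outer_mono: "A \<subseteq> B \<Longrightarrow> hausdorff_outer k A \<le> hausdorff_outer k B"
  unfolding hausdorff_outer_def by (rule SUP_mono) (auto intro: hausdorff_pre_mono)

lemma hausdorff_pre_le_outer: "0 < \<delta> \<Longrightarrow> hausdorff_pre k \<delta> A \<le> hausdorff_outer k A"
  unfolding hausdorff_outer_def by (rule SUP_upper) simp

lemma hausdorff_outer_countable_subadditive:
  "hausdorff_outer k (\<Union>i::nat. A i) \<le> (\<Sum>i. hausdorff_outer k (A i))"
proof -
  have "hausdorff_pre k \<delta> (\<Union>i. A i) \<le> (\<Sum>i. hausdorff_outer k (A i))" if "0 < \<delta>" for \<delta>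
    by (rule order_trans[OF hausdorff_pre_countable_subadditive])
       (use that in \<open>auto intro!: suminf_le hausdorff_pre_le_outer\<close>)
  then show ?thesis
    unfolding hausdorff_outer_def[of k "\<Union>i. A i"] by (intro SUP_least) auto
qed

lemma hausdorff_outer_measure_space: "outer_measure_space UNIV (hausdorff_outer k)"
  by (auto simp: outer_measure_space_def positive_def increasing_def countably_subadditive_def
        hausdorff_outer_empty intro: hausdorff_outer_mono hausdorff_outer_countable_subadditive)

lemma hausdorff_outer_subadditive:
  "hausdorff_outer k (A \<union> B) \<le> hausdorff_outer k A + hausdorff_outer k B"
proof -
  have "hausdorff_outer k (\<Union>i. if i = 0 then A else if i = Suc 0 then B else {})
      \<le> (\<Sum>i. hausdorff_outer k (if i = 0 then A else if i = Suc 0 then B else {}))"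
    by (rule hausdorff_outer_countable_subadditive)
  also have "\<dots> = (\<Sum>i\<in>{0, Suc 0}. hausdorff_outer k (if i = 0 then A else if i = Suc 0 then B else {}))"
    by (rule suminf_finite) (auto simp: hausdorff_outer_empty)
  also have "(\<Union>i. if i = 0 then A else if i = Suc 0 then B else {}) = A \<union> B"
    by (auto split: if_splits)
  finally show ?thesis by simp
qed

lemma hausdorff_pre_separated:
  assumes d: "0 < \<delta>" "\<delta> < d" and sep: "\<And>x y. x \<in> A \<Longrightarrow> y \<in> B \<Longrightarrow> d \<le> dist x y"
  shows "hausdorff_pre k \<delta> A + hausdorff_pre k \<delta> B \<le> hausdorff_pre k \<delta> (A \<union> B)"
  unfolding hausdorff_pre_def[of k \<delta> "A \<union> B"]
proof (rule INF_greatest)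
  fix C assume C: "C \<in> hausdorff_covers \<delta> (A \<union> B)"
  define CA where "CA i = (if C i \<inter> A \<noteq> {} then C i else {})" for i
  define CB where "CB i = (if C i \<inter> A \<noteq> {} then {} else C i)" for i
  have bd: "bounded (C i)" "diameter (C i) \<le> \<delta>" for i
    using C by (auto simp: hausdorff_covers_def)
  have cov: "A \<union> B \<subseteq> (\<Union>i. C i)"
    using C by (simp add: hausdorff_covers_def)
  have "C i \<inter> A = {}" if "y \<in> C i" "y \<in> B" for i y
  proof (rule ccontr)
    assume "C i \<inter> A \<noteq> {}"
    then obtain x where x: "x \<in> C i" "x \<in> A" by blast
    have "dist x y \<le> diameter (C i)"
      by (rule diameter_bounded_bound[OF bd(1) x(1) that(1)])
    then show False
      using sep[OF x(2) that(2)] bd(2)[of i] d by linarith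
  qed
  then have "B \<subseteq> (\<Union>i. CB i)"
    using cov by (fastforce simp: CB_def)
  then have "CB \<in> hausdorff_covers \<delta> B"
    using bd d by (auto simp: hausdorff_covers_def CB_def)
  moreover have "A \<subseteq> (\<Union>i. CA i)"
    using cov by (fastforce simp: CA_def)
  then have "CA \<in> hausdorff_covers \<delta> A"
    using bd d by (auto simp: hausdorff_covers_def CA_def)
  ultimately have "hausdorff_pre k \<delta> A + hausdorff_pre k \<delta> B
      \<le> (\<Sum>i. hausdorff_gauge k (CA i)) + (\<Sum>i. hausdorff_gauge k (CB i))"
    unfolding hausdorff_pre_def by (intro add_mono INF_lower)
  also have "\<dots> = (\<Sum>i. hausdorff_gauge k (CA i) + hausdorff_gauge k (CB i))"
    by (rule suminf_add) auto
  also have "\<dots> = (\<Sum>i. hausdorff_gauge k (C i))"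
    by (rule arg_cong[where f = suminf]) (auto simp: CA_def CB_def hausdorff_gauge_def)
  finally show "hausdorff_pre k \<delta> A + hausdorff_pre k \<delta> B \<le> (\<Sum>i. hausdorff_gauge k (C i))" .
qed

lemma hausdorff_outer_separated:
  assumes d: "0 < d" and sep: "\<And>x y. x \<in> A \<Longrightarrow> y \<in> B \<Longrightarrow> d \<le> dist x y"
  shows "hausdorff_outer k A + hausdorff_outer k B \<le> hausdorff_outer k (A \<union> B)"
proof -
  have "hausdorff_outer k A + hausdorff_outer k B
      = (SUP \<delta>\<in>{0<..}. hausdorff_pre k \<delta> A + hausdorff_pre k \<delta> B)"
    unfolding hausdorff_outer_def
  proof (rule SUP_add_directed_ennreal[symmetric])
    fix i j :: real assume "i \<in> {0<..}" "j \<in> {0<..}"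
    then show "\<exists>l\<in>{0<..}. hausdorff_pre k i A + hausdorff_pre k j B
        \<le> hausdorff_pre k l A + hausdorff_pre k l B"
      by (intro bexI[of _ "min i j"] add_mono hausdorff_pre_antimono) auto
  qed
  also have "\<dots> \<le> hausdorff_outer k (A \<union> B)"
  proof (rule SUP_least)
    fix \<delta> :: real assume "\<delta> \<in> {0<..}"
    then have pos: "0 < min \<delta> (d / 2)" "min \<delta> (d / 2) < d"
      using d by auto
    have "hausdorff_pre k \<delta> A + hausdorff_pre k \<delta> B
        \<le> hausdorff_pre k (min \<delta> (d / 2)) A + hausdorff_pre k (min \<delta> (d / 2)) B"
      by (intro add_mono hausdorff_pre_antimono) auto
    also have "\<dots> \<le> hausdorff_pre k (min \<delta> (d / 2)) (A \<union> B)"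
      by (rule hausdorff_pre_separated[OF pos sep])
    also have "\<dots> \<le> hausdorff_outer k (A \<union> B)"
      by (rule hausdorff_pre_le_outer[OF pos(1)])
    finally show "hausdorff_pre k \<delta> A + hausdorff_pre k \<delta> B \<le> hausdorff_outer k (A \<union> B)" .
  qed
  finally show ?thesis .
qed

lemma hausdorff_outer_separated_sum:
  fixes R :: "nat \<Rightarrow> 'a::metric_space set"
  assumes sep: "\<And>i j. i < j \<Longrightarrow> \<exists>d>0. \<forall>x\<in>R i. \<forall>y\<in>R j. d \<le> dist x y"
  shows "(\<Sum>i<N. hausdorff_outer k (R i)) \<le> hausdorff_outer k (\<Union>i<N. R i)"
proof (induction N)
  case 0
  then show ?case by simp
next
  case (Suc N)
  obtain D where D: "\<And>i. i < N \<Longrightarrow> 0 < D i \<and> (\<forall>x\<in>R i. \<forall>y\<in>R N. D i \<le> dist x y)"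
    using sep[of _ N] by metis
  define d where "d = Min (insert 1 (D ` {..<N}))"
  have d: "0 < d"
    using D by (auto simp: d_def)
  have dle: "d \<le> D i" if "i < N" for i
    unfolding d_def by (rule Min_le) (use that in auto)
  have "d \<le> dist x y" if "x \<in> (\<Union>i<N. R i)" "y \<in> R N" for x y
    using that D dle by (meson UN_E lessThan_iff order_trans)
  then have S: "hausdorff_outer k (\<Union>i<N. R i) + hausdorff_outer k (R N)
      \<le> hausdorff_outer k ((\<Union>i<N. R i) \<union> R N)"
    by (rule hausdorff_outer_separated[OF d])
  have "(\<Union>i<Suc N. R i) = (\<Union>i<N. R i) \<union> R N"
    by (auto simp: less_Suc_eq)
  then show ?case
    using Suc S by (simp, metis add_right_mono order_trans)
qed

lemma closed_hausdorff_measurable: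
  fixes F :: "'a::metric_space set"
  assumes F: "closed F"
  shows "hausdorff_outer k (A \<inter> F) + hausdorff_outer k (A - F) \<le> hausdorff_outer k A"
proof (cases "F = {} \<or> hausdorff_outer k A = top")
  case True
  then show ?thesis by (auto simp: hausdorff_outer_empty)
next
  case False
  then have ne: "F \<noteq> {}" and fin: "hausdorff_outer k A < top"
    by (auto simp: less_top)
  let ?H = "hausdorff_outer k"
  define g where "g x = infdist x F" for x
  have lip: "g x \<le> g y + dist x y" for x y
    unfolding g_def by (rule infdist_triangle)
  define An where "An n = {x \<in> A. 1 / real (Suc n) \<le> g x}" for n
  define R where "R n = {x \<in> A. 1 / real (Suc (Suc n)) \<le> g x \<and> g x < 1 / real (Suc n)}" for n
  have anti: "1 / real (Suc n) \<le> 1 / real (Suc m)" if "m \<le> n" for m n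
    using that by (simp add: field_simps)
  have RA: "R n \<subseteq> A" for n by (auto simp: R_def)
  have sepR: "\<exists>d>0. \<forall>x\<in>R i. \<forall>y\<in>R j. d \<le> dist x y" if "Suc i < j" for i j
  proof (intro exI conjI ballI)
    let ?d = "1 / real (Suc (Suc i)) - 1 / real (Suc j)"
    have "1 / real (Suc j) < 1 / real (Suc (Suc i))"
      using that by (intro divide_strict_left_mono) auto
    then show "0 < ?d" by simp
    fix x y assume "x \<in> R i" "y \<in> R j"
    then show "?d \<le> dist x y"
      using lip[of x y] by (simp add: R_def)
  qed
  have half: "(\<Sum>i. ?H (R (2 * i + c))) \<le> ?H A" for c
  proof (rule suminf_le_const)
    fix N
    have "(\<Sum>i<N. ?H (R (2 * i + c))) \<le> ?H (\<Union>i<N. R (2 * i + c))"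
      by (rule hausdorff_outer_separated_sum) (rule sepR, simp)
    also have "\<dots> \<le> ?H A"
      by (rule hausdorff_outer_mono) (use RA in blast)
    finally show "(\<Sum>i<N. ?H (R (2 * i + c))) \<le> ?H A" .
  qed simp
  have all: "(\<Sum>i. ?H (R i)) \<le> ?H A + ?H A"
  proof (rule suminf_le_const)
    fix N
    have "(\<Sum>i<N. ?H (R i)) \<le> (\<Sum>i<2 * N. ?H (R i))"
      by (rule sum_mono2) auto
    also have "\<dots> = (\<Sum>i<N. ?H (R (2 * i + 0))) + (\<Sum>i<N. ?H (R (2 * i + 1)))"
      by (induction N) (simp_all add: ac_simps)
    also have "\<dots> \<le> (\<Sum>i. ?H (R (2 * i + 0))) + (\<Sum>i. ?H (R (2 * i + 1)))"
      by (intro add_mono sum_le_suminf) auto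
    also have "\<dots> \<le> ?H A + ?H A"
      by (intro add_mono half)
    finally show "(\<Sum>i<N. ?H (R i)) \<le> ?H A + ?H A" .
  qed simp
  have tail: "(\<lambda>n. \<Sum>i. ?H (R (i + n))) \<longlonglongrightarrow> 0"
  proof -
    have "(\<Sum>i. ?H (R i)) < top"
      using all fin by (metis ennreal_add_less_top order_le_less_trans)
    then have nt: "(\<Sum>i. ?H (R i)) \<noteq> top" by simp
    have lim: "(\<lambda>n. \<Sum>i<n. ?H (R i)) \<longlonglongrightarrow> (\<Sum>i. ?H (R i))"
      by (rule summable_LIMSEQ) simp
    have eq: "(\<Sum>i. ?H (R (i + n))) = (\<Sum>i. ?H (R i)) - (\<Sum>i<n. ?H (R i))" for n
    proof -
      have "(\<Sum>i. ?H (R i)) = (\<Sum>i. ?H (R (i + n))) + (\<Sum>i<n. ?H (R i))"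
        by (rule suminf_offset) simp
      moreover have "(\<Sum>i<n. ?H (R i)) \<noteq> top"
        using nt sum_le_suminf[of "\<lambda>i. ?H (R i)" "{..<n}"]
        by (metis finite_lessThan summableI top_unique zero_le)
      ultimately show ?thesis by simp
    qed
    have "(\<lambda>n. (\<Sum>i. ?H (R i)) - (\<Sum>i<n. ?H (R i))) \<longlonglongrightarrow> (\<Sum>i. ?H (R i)) - (\<Sum>i. ?H (R i))"
      by (rule tendsto_diff_ennreal) (use lim nt in auto)
    then show ?thesis using nt by (simp add: eq)
  qed
  have cover: "A - F \<subseteq> An n \<union> (\<Union>i. R (i + n))" for n
  proof
    fix x assume x: "x \<in> A - F"
    then have pos: "0 < g x"
      unfolding g_def using F ne by (simp add: infdist_pos_not_in_closed)
    then have ex: "\<exists>m. 1 / real (Suc m) \<le> g x"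
      by (metis inverse_eq_divide less_imp_le reals_Archimedean)
    define m where "m = (LEAST m. 1 / real (Suc m) \<le> g x)"
    have m: "1 / real (Suc m) \<le> g x"
      unfolding m_def using ex by (rule LeastI_ex)
    have notm: "g x < 1 / real (Suc l)" if "l < m" for l
      using not_less_Least[of l "\<lambda>m. 1 / real (Suc m) \<le> g x"] that by (simp add: m_def)
    show "x \<in> An n \<union> (\<Union>i. R (i + n))"
    proof (cases "m \<le> n")
      case True
      then have "1 / real (Suc n) \<le> g x" using anti m order_trans by blast
      then show ?thesis using x by (simp add: An_def)
    next
      case False
      then have "x \<in> R (m - 1)"
        using x m notm[of "m - 1"] by (simp add: R_def)
      then have "x \<in> R ((m - 1 - n) + n)" using False by simp
      then show ?thesis by blast
    qed
  qed
  have step: "?H (A \<inter> F) + ?H (A - F) \<le> ?H A + (\<Sum>i. ?H (R (i + n)))" for n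
  proof -
    have "?H (A - F) \<le> ?H (An n \<union> (\<Union>i. R (i + n)))"
      by (rule hausdorff_outer_mono[OF cover])
    also have "\<dots> \<le> ?H (An n) + (\<Sum>i. ?H (R (i + n)))"
      by (rule order_trans[OF hausdorff_outer_subadditive])
         (intro add_left_mono hausdorff_outer_countable_subadditive)
    finally have 1: "?H (A - F) \<le> ?H (An n) + (\<Sum>i. ?H (R (i + n)))" .
    have "?H (A \<inter> F) + ?H (An n) \<le> ?H ((A \<inter> F) \<union> An n)"
    proof (rule hausdorff_outer_separated)
      show "(0::real) < 1 / real (Suc n)" by simp
      fix x y assume "x \<in> A \<inter> F" "y \<in> An n"
      then show "1 / real (Suc n) \<le> dist x y"
        using lip[of y x] by (simp add: An_def g_def dist_commute)
    qed
    also have "\<dots> \<le> ?H A"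
      by (rule hausdorff_outer_mono) (auto simp: An_def)
    finally have 2: "?H (A \<inter> F) + ?H (An n) \<le> ?H A" .
    have "?H (A \<inter> F) + ?H (A - F) \<le> (?H (A \<inter> F) + ?H (An n)) + (\<Sum>i. ?H (R (i + n)))"
      using add_left_mono[OF 1] by (simp add: add.assoc)
    also have "\<dots> \<le> ?H A + (\<Sum>i. ?H (R (i + n)))"
      by (rule add_right_mono[OF 2])
    finally show ?thesis .
  qed
  have "(\<lambda>n. ?H A + (\<Sum>i. ?H (R (i + n)))) \<longlonglongrightarrow> ?H A + 0"
    by (intro tendsto_add tendsto_const tail)
  then show ?thesis
    using LIMSEQ_le_const[of _ "?H A + 0"] step by simp
qed

lemma space_hausdorff_measure [simp]: "space (hausdorff_measure k) = UNIV"
  by (simp add: hausdorff_measure_def)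

lemma sets_hausdorff_measure [simp, measurable_cong]: "sets (hausdorff_measure k) = sets borel"
  by (simp add: hausdorff_measure_def sets.sigma_sets_eq[of borel, simplified])

theorem emeasure_hausdorff_measure:
  fixes A :: "'a::metric_space set"
  assumes "A \<in> sets borel"
  shows "emeasure (hausdorff_measure k) A = hausdorff_outer k A"
proof -
  let ?L = "lambda_system UNIV UNIV (hausdorff_outer k) :: 'a set set"
  interpret P: sigma_algebra "UNIV :: 'a set" "UNIV :: 'a set set"
    using sigma_algebra_Pow[of "UNIV :: 'a set"] by simp
  have ms: "measure_space UNIV ?L (hausdorff_outer k)"
    by (rule P.caratheodory_lemma[OF hausdorff_outer_measure_space])
  then interpret L: sigma_algebra UNIV ?L
    by (simp add: measure_space_def)
  have "F \<in> ?L" if "closed F" for F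
    unfolding P.lambda_system_eq
  proof (intro CollectI conjI ballI UNIV_I antisym closed_hausdorff_measurable[OF that])
    fix X
    show "hausdorff_outer k X \<le> hausdorff_outer k (X \<inter> F) + hausdorff_outer k (X - F)"
      using hausdorff_outer_subadditive[of k "X \<inter> F" "X - F"] by (simp add: Int_Diff_Un)
  qed
  then have "sigma_sets UNIV {F. closed F} \<subseteq> ?L"
    by (intro L.sigma_sets_subset) auto
  then have sub: "sets borel \<subseteq> ?L"
    by (simp add: borel_eq_closed)
  have "countably_additive (sets borel) (hausdorff_outer k :: 'a set \<Rightarrow> ennreal)"
    using ms sub unfolding measure_space_def countably_additive_def
    by (meson sets.countable_UN subset_iff order_trans)
  then show ?thesis
    unfolding hausdorff_measure_def
    using assms sets.sigma_algebra_axioms[of "borel :: 'a measure"]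
    by (intro emeasure_measure_of_sigma) (auto simp: positive_def hausdorff_outer_empty)
qed


section \<open>Domains with Hoelder-differentiable boundary\<close>

definition C1_holder :: "real \<Rightarrow> ('a::euclidean_space \<Rightarrow> real) \<Rightarrow> bool" where
  "C1_holder \<epsilon> \<gamma> \<longleftrightarrow> (\<exists>G K. \<forall>x y. (GDERIV \<gamma> x :> G x) \<and> norm (G x - G y) \<le> K * dist x y powr \<epsilon>)"

text \<open>
  Near each boundary point \<open>\<Omega>\<close> is the set strictly above a \<open>C\<^sup>1\<^sup>,\<^sup>\<epsilon>\<close> graph over the hyperplane
  orthogonal to some unit vector \<open>\<nu>\<close>. The graph function is written as a function on the whole
  space, but is evaluated only at the orthogonal projection \<open>x - (x \<bullet> \<nu>) \<nu>\<close> of \<open>x\<close>.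
\<close>

definition C1_holder_boundary :: "real \<Rightarrow> 'a::euclidean_space set \<Rightarrow> bool" where
  "C1_holder_boundary \<epsilon> \<Omega> \<longleftrightarrow>
     (\<forall>z\<in>frontier \<Omega>. \<exists>r>0. \<exists>\<nu> \<gamma>. norm \<nu> = 1 \<and> C1_holder \<epsilon> \<gamma> \<and>
        (\<forall>x\<in>ball z r. x \<in> \<Omega> \<longleftrightarrow> \<gamma> (x - (x \<bullet> \<nu>) *\<^sub>R \<nu>) < x \<bullet> \<nu>))"


section \<open>The Sobolev space \<open>W\<^sup>1\<^sup>,\<^sup>p\<close>\<close>

primrec Ck :: "nat \<Rightarrow> ('a::euclidean_space \<Rightarrow> real) \<Rightarrow> bool" where
  "Ck 0 f \<longleftrightarrow> continuous_on UNIV f"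
| "Ck (Suc k) f \<longleftrightarrow> (\<forall>x. f differentiable (at x)) \<and> (\<forall>v. Ck k (\<lambda>x. frechet_derivative f (at x) v))"

definition test_functions :: "'a::euclidean_space set \<Rightarrow> ('a \<Rightarrow> real) set" where
  "test_functions \<Omega> =
     {\<phi>. (\<forall>k. Ck k \<phi>) \<and> compact (closure {x. \<phi> x \<noteq> 0}) \<and> closure {x. \<phi> x \<noteq> 0} \<subseteq> \<Omega>}"

definition L1_loc :: "'a::euclidean_space set \<Rightarrow> ('a \<Rightarrow> 'b::euclidean_space) set" where
  "L1_loc \<Omega> = {u. \<forall>K. compact K \<and> K \<subseteq> \<Omega> \<longrightarrow> integrable (lebesgue_on K) u}"

definition Lp :: "real \<Rightarrow> 'a::euclidean_space set \<Rightarrow> ('a \<Rightarrow> 'b::euclidean_space) set" where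
  "Lp p \<Omega> = {u. u \<in> borel_measurable (lebesgue_on \<Omega>) \<and>
                integrable (lebesgue_on \<Omega>) (\<lambda>x. norm (u x) powr p)}"

definition has_weak_gradient ::
  "'a::euclidean_space set \<Rightarrow> ('a \<Rightarrow> real) \<Rightarrow> ('a \<Rightarrow> 'a) \<Rightarrow> bool" where
  "has_weak_gradient \<Omega> u g \<longleftrightarrow> u \<in> L1_loc \<Omega> \<and> g \<in> L1_loc \<Omega> \<and>
     (\<forall>\<phi>\<in>test_functions \<Omega>. \<forall>e\<in>Basis.
        (LINT x|lebesgue_on \<Omega>. u x * frechet_derivative \<phi> (at x) e)
          = - (LINT x|lebesgue_on \<Omega>. (g x \<bullet> e) * \<phi> x))"

definition sobolev :: "real \<Rightarrow> 'a::euclidean_space set \<Rightarrow> ('a \<Rightarrow> real) set" where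
  "sobolev p \<Omega> = {u \<in> Lp p \<Omega>. \<exists>g\<in>Lp p \<Omega>. has_weak_gradient \<Omega> u g}"

text \<open>
  Elements of \<^const>\<open>sobolev\<close> are functions rather than classes modulo null sets. The weak gradient
  is determined up to a null set; the choice below fixes one version.
\<close>

definition weak_gradient ::
  "real \<Rightarrow> 'a::euclidean_space set \<Rightarrow> ('a \<Rightarrow> real) \<Rightarrow> 'a \<Rightarrow> 'a" where
  "weak_gradient p \<Omega> u = (SOME g. g \<in> Lp p \<Omega> \<and> has_weak_gradient \<Omega> u g)"

text \<open>
  The representative of \<open>u\<close> that is continuous up to the boundary; its values on the closure of an
  open \<open>\<Omega>\<close> are unique. It exists for all \<open>u\<close> in \<^const>\<open>sobolev\<close> if \<open>p\<close> exceeds the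
  dimension and the boundary is regular.
\<close>

definition continuous_rep :: "'a::euclidean_space set \<Rightarrow> ('a \<Rightarrow> real) \<Rightarrow> 'a \<Rightarrow> real" where
  "continuous_rep \<Omega> u =
     (SOME v. continuous_on (closure \<Omega>) v \<and> (AE x in lebesgue_on \<Omega>. v x = u x))"

definition sobolev_nonzero :: "real \<Rightarrow> 'a::euclidean_space set \<Rightarrow> ('a \<Rightarrow> real) set" where
  "sobolev_nonzero p \<Omega> = {u \<in> sobolev p \<Omega>. \<not> (AE x in lebesgue_on \<Omega>. u x = 0)}"


section \<open>Eigenvalues with boundary densities and boundary measures\<close>

definition surface_measure :: "'a::euclidean_space set \<Rightarrow> 'a measure" where
  "surface_measure \<Omega> = restrict_space (hausdorff_measure (DIM('a) - 1)) (frontier \<Omega>)"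

definition boundary_densities :: "real \<Rightarrow> 'a::euclidean_space set \<Rightarrow> ('a \<Rightarrow> real) set" where
  "boundary_densities m \<Omega> =
     {\<sigma>. integrable (surface_measure \<Omega>) \<sigma> \<and> (AE x in surface_measure \<Omega>. 0 \<le> \<sigma> x) \<and>
         (LINT x|surface_measure \<Omega>. \<sigma> x) = m}"

definition ell1_density :: "real \<Rightarrow> ('a::euclidean_space \<Rightarrow> real) \<Rightarrow> 'a set \<Rightarrow> real" where
  "ell1_density p \<sigma> \<Omega> =
     (INF u\<in>sobolev_nonzero p \<Omega>.
        ((LINT x|lebesgue_on \<Omega>. norm (weak_gradient p \<Omega> u x) powr p) +
         (LINT x|surface_measure \<Omega>. \<sigma> x * \<bar>continuous_rep \<Omega> u x\<bar> powr p)) /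
        (LINT x|lebesgue_on \<Omega>. \<bar>u x\<bar> powr p))"

definition optimal_lambda :: "real \<Rightarrow> real \<Rightarrow> 'a::euclidean_space set \<Rightarrow> real" where
  "optimal_lambda p m \<Omega> = (INF \<sigma>\<in>boundary_densities m \<Omega>. ell1_density p \<sigma> \<Omega>)"

text \<open>
  For bounded \<open>\<Omega>\<close> the boundary is a compact metric space, so its finite Borel measures
  are exactly its finite Radon measures.
\<close>

definition boundary_measures :: "real \<Rightarrow> 'a::euclidean_space set \<Rightarrow> 'a measure set" where
  "boundary_measures m \<Omega> =
     {\<mu>. sets \<mu> = sets (restrict_space borel (frontier \<Omega>)) \<and> emeasure \<mu> (space \<mu>) = ennreal m}"

definition ell1_measure :: "real \<Rightarrow> 'a::euclidean_space measure \<Rightarrow> 'a set \<Rightarrow> real" where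
  "ell1_measure p \<mu> \<Omega> =
     (INF u\<in>sobolev_nonzero p \<Omega>.
        ((LINT x|lebesgue_on \<Omega>. norm (weak_gradient p \<Omega> u x) powr p) +
         (LINT x|\<mu>. \<bar>continuous_rep \<Omega> u x\<bar> powr p)) /
        (LINT x|lebesgue_on \<Omega>. \<bar>u x\<bar> powr p))"

definition dirac_measures :: "real \<Rightarrow> real \<Rightarrow> 'a::euclidean_space set \<Rightarrow> 'a measure set" where
  "dirac_measures p m \<Omega> =
     {\<mu> \<in> boundary_measures m \<Omega>. \<exists>x\<in>frontier \<Omega>. \<forall>u\<in>sobolev p \<Omega>.
        (LINT y|\<mu>. \<bar>continuous_rep \<Omega> u y\<bar> powr p) = m * \<bar>continuous_rep \<Omega> u x\<bar> powr p}"

definition dirac_mass :: "real \<Rightarrow> 'a::euclidean_space set \<Rightarrow> 'a \<Rightarrow> 'a measure" where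
  "dirac_mass m \<Omega> x = scale_measure (ennreal m) (return (restrict_space borel (frontier \<Omega>)) x)"

end

theory Submission
  imports Defs
begin

text \<open>
  The energy of a density \<open>\<sigma>\<close> at \<open>u\<close> is at least that of the Dirac mass at a minimum point of \<open>\<bar>u\<bar>\<close>
  on the boundary, and the Dirac mass at \<open>z\<close> is approximated by densities concentrated on small boundary
  pieces around \<open>z\<close>, which have positive finite surface measure. So \<open>\<lambda>(m, \<Omega>)\<close> is the infimum over \<open>x\<close>
  of the eigenvalues for \<open>m \<delta>\<^sub>x\<close>. By Morrey's inequality functions of bounded \<open>W\<^sup>1\<^sup>,\<^sup>p\<close> norm are
  equicontinuous up to the boundary, so this eigenvalue is continuous in \<open>x\<close> and its minimum over the
  compact boundary is attained; no compactness in the function space is needed.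

  Morrey's inequality is proved without mollifying \<open>u\<close>: the averages of \<open>u\<close> against a bump function
  supported in a ball around \<open>x + t c\<close> of radius \<open>t b\<close> have a \<open>t\<close>-derivative that is the integral of
  the weak gradient against a test field, hence of order \<open>t\<^sup>\<alpha>\<^sup>-\<^sup>1\<close> with \<open>\<alpha> = 1 - n / p > 0\<close>. Near
  the boundary \<open>c\<close> points into the domain, so \<open>x\<close> may come arbitrarily close to the boundary.
\<close>

section \<open>Bump functions\<close>

text \<open>The infima over \<open>\<sigma>\<close> and over \<open>u\<close> commute, so the
  density approximating a Dirac mass may depend on \<open>u\<close>; no convergence of measures
  uniform in \<open>u\<close> has to be set up. The obstacle is continuity in the position: an
  infimum of infinitely many continuous functions is in general merely upper semicontinuous. It is
  overcome by bounding the oscillation of \<open>\<bar>u\<bar> powr p\<close> by a small multiple of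
  the full Sobolev energy. The energy is in turn dominated by numerator plus denominator of the
  quotient, so the error multiplies the quotient by a factor close to 1 and adds a small constant,
  both independent of \<open>u\<close>. Boundary regularity enters through local Lipschitz graphs,
  which provide the interior cones. The (n-1)-dimensional Hausdorff measure is compared with
  n-dimensional volume: packing bounds it from above, and sweeping covers along a transversal
  direction bounds it from below. Weak gradients and continuous representatives are picked by
  \<open>SOME\<close>, so the Morrey estimates are proved for an arbitrary weak gradient and an
  arbitrary continuous version.\<close>

definition exp_inv_quot :: "nat \<Rightarrow> real \<Rightarrow> real" where
  "exp_inv_quot k t = (if 0 < t then exp (- 1 / t) / t ^ k else 0)"

lemma exp_inv_quot_tendsto_0: "(exp_inv_quot k \<longlongrightarrow> 0) (at 0)"
proof -
  have "((\<lambda>t::real. inverse t ^ k / exp (inverse t)) \<longlongrightarrow> 0) (at_right 0)"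
    by (rule filterlim_compose[OF tendsto_power_div_exp_0 filterlim_inverse_at_top_right])
  moreover have "\<forall>\<^sub>F t in at_right 0. inverse t ^ k / exp (inverse t) = exp_inv_quot k t"
    unfolding eventually_at_right_field
    by (auto simp: exp_inv_quot_def field_simps exp_minus intro!: exI[of _ 1])
  ultimately have "(exp_inv_quot k \<longlongrightarrow> 0) (at_right 0)"
    using tendsto_cong by fast
  moreover have "(exp_inv_quot k \<longlongrightarrow> 0) (at_left 0)"
    by (rule tendsto_eventually)
       (auto simp: exp_inv_quot_def eventually_at_left_field intro!: exI[of _ "-1"])
  ultimately show ?thesis
    by (simp add: filterlim_split_at)
qed

text \<open>Carrying the power \<open>t ^ k\<close> from the start keeps the derivative inside the
  span of the family, so smoothness follows for all orders without formulas for higher derivatives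
  of \<open>exp (- 1 / t)\<close>.\<close>

lemma has_real_derivative_exp_inv_quot:
  "(exp_inv_quot k has_real_derivative exp_inv_quot (k + 2) t - real k * exp_inv_quot (k + 1) t) (at t)"
proof (cases t "0 :: real" rule: linorder_cases)
  case greater
  have "((\<lambda>t. exp (- 1 / t) / t ^ k) has_real_derivative
          exp_inv_quot (k + 2) t - real k * exp_inv_quot (k + 1) t) (at t)"
  proof (cases k)
    case 0
    have "((\<lambda>t. exp (- 1 / t)) has_real_derivative exp (- 1 / t) * (1 / t\<^sup>2)) (at t)"
      using greater by (auto intro!: derivative_eq_intros simp: power2_eq_square)
    then show ?thesis using 0 greater by (simp add: exp_inv_quot_def power2_eq_square)
  next
    case (Suc j)
    have "((\<lambda>t. exp (- 1 / t) / t ^ k) has_real_derivative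
        (exp (- 1 / t) * (1 / t\<^sup>2) * t ^ k - exp (- 1 / t) * (real k * t ^ j)) / (t ^ k * t ^ k)) (at t)"
    proof (rule DERIV_divide)
      show "((\<lambda>t. exp (- 1 / t)) has_real_derivative exp (- 1 / t) * (1 / t\<^sup>2)) (at t)"
        using greater by (auto intro!: derivative_eq_intros simp: power2_eq_square)
      show "((\<lambda>t. t ^ k) has_real_derivative real k * t ^ j) (at t)"
        using DERIV_pow[of k t] Suc by simp
    qed (use greater in simp)
    also have "(exp (- 1 / t) * (1 / t\<^sup>2) * t ^ k - exp (- 1 / t) * (real k * t ^ j)) / (t ^ k * t ^ k)
        = exp_inv_quot (k + 2) t - real k * exp_inv_quot (k + 1) t"
    proof -
      have "exp (- 1 / t) * (1 / t\<^sup>2) * t ^ k / (t ^ k * t ^ k) = exp (- 1 / t) / t ^ (k + 2)"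
        using greater by (simp add: power2_eq_square)
      moreover have "exp (- 1 / t) * (real k * t ^ j) / (t ^ k * t ^ k) = real k * (exp (- 1 / t) / t ^ (k + 1))"
        using greater Suc by simp
      ultimately show ?thesis
        using greater by (simp add: exp_inv_quot_def diff_divide_distrib)
    qed
    finally show ?thesis .
  qed
  then show ?thesis
    by (rule has_field_derivative_transform_within_open[where S = "{0<..}"])
       (use greater in \<open>auto simp: exp_inv_quot_def\<close>)
next
  case less
  have "((\<lambda>t. 0) has_real_derivative 0) (at t)" by simp
  then have "(exp_inv_quot k has_real_derivative 0) (at t)"
    by (rule has_field_derivative_transform_within_open[where S = "{..<0}"])
       (use less in \<open>auto simp: exp_inv_quot_def\<close>)
  then show ?thesis using less by (simp add: exp_inv_quot_def)
next
  case equal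
  \<comment> \<open>The difference quotient at 0 coincides with \<open>exp_inv_quot (Suc k)\<close>,
    so the limit already known, taken one index higher, gives the derivative.\<close>
  have "((\<lambda>h. exp_inv_quot k h / h) \<longlongrightarrow> 0) (at 0)"
    using exp_inv_quot_tendsto_0[of "Suc k"]
    by (rule Lim_transform_eventually)
       (auto simp: exp_inv_quot_def field_simps eventually_at_filter)
  then show ?thesis
    using equal by (simp add: has_field_derivative_iff exp_inv_quot_def)
qed

lemma exp_inv_quot_nonneg [simp]: "0 \<le> exp_inv_quot k t"
  by (simp add: exp_inv_quot_def)

lemma exp_inv_quot_pos: "0 < t \<Longrightarrow> 0 < exp_inv_quot k t"
  by (simp add: exp_inv_quot_def)

text \<open>This span is closed under directional derivatives, which is what makes its members \<open>C\<^sup>\<infinity>\<close>.\<close>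

inductive_set bump_span :: "'a::euclidean_space \<Rightarrow> real \<Rightarrow> ('a \<Rightarrow> real) set" for c R where
  base: "(\<lambda>y. exp_inv_quot k (1 - (y - c) \<bullet> (y - c) / R\<^sup>2)) \<in> bump_span c R"
| add: "f \<in> bump_span c R \<Longrightarrow> g \<in> bump_span c R \<Longrightarrow> (\<lambda>y. f y + g y) \<in> bump_span c R"
| scale: "f \<in> bump_span c R \<Longrightarrow> (\<lambda>y. a * f y) \<in> bump_span c R"
| linear: "f \<in> bump_span c R \<Longrightarrow> (\<lambda>y. (y \<bullet> v) * f y) \<in> bump_span c R"

lemma bump_span_cmul_diff:
  assumes "f \<in> bump_span c R"
  shows "(\<lambda>y. ((y - z) \<bullet> v) * f y) \<in> bump_span c R"
  using bump_span.add[OF bump_span.linear[OF assms, of v] bump_span.scale[OF assms, of "- (z \<bullet> v)"]]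
  by (simp add: algebra_simps inner_diff_left)

text \<open>The chain rule raises the index by one or two and contributes the inner derivative, a
  first-degree factor in \<open>y - c\<close>. Sums, scalar multiples and linear factors are exactly
  the closure rules of the span; the product rule handles the last of them.\<close>

lemma bump_span_derivative:
  assumes "f \<in> bump_span c R"
  shows "\<exists>f'. (\<forall>x. (f has_derivative f' x) (at x)) \<and> (\<forall>v. (\<lambda>x. f' x v) \<in> bump_span c R)"
  using assms
proof induction
  case (base k)
  let ?q = "\<lambda>y. 1 - (y - c) \<bullet> (y - c) / R\<^sup>2"
  let ?e = "\<lambda>y. exp_inv_quot (k + 2) (?q y) - real k * exp_inv_quot (k + 1) (?q y)"
  let ?f' = "\<lambda>y v. ?e y * (- 2 / R\<^sup>2 * ((y - c) \<bullet> v))"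
  have "((\<lambda>y. exp_inv_quot k (?q y)) has_derivative ?f' x) (at x)" for x
  proof -
    have "(?q has_derivative (\<lambda>v. - 2 / R\<^sup>2 * ((x - c) \<bullet> v))) (at x)"
      by (auto intro!: derivative_eq_intros simp: fun_eq_iff inner_commute divide_inverse power_inverse algebra_simps)
    from DERIV_compose_FDERIV[OF has_real_derivative_exp_inv_quot this] show ?thesis
      by (simp add: mult.commute)
  qed
  moreover have "(\<lambda>y. ?f' y v) \<in> bump_span c R" for v
  proof -
    have "?e \<in> bump_span c R"
      using bump_span.add[OF bump_span.base bump_span.scale[OF bump_span.base, of "- real k"]]
      by simp
    then have "(\<lambda>y. (- 2 / R\<^sup>2) * (((y - c) \<bullet> v) * ?e y)) \<in> bump_span c R"
      by (intro bump_span.scale bump_span_cmul_diff)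
    then show ?thesis by (simp only: mult_ac)
  qed
  ultimately show ?case by (intro exI[of _ ?f']) simp
next
  case (add f g)
  then obtain f' g' where "\<forall>x. (f has_derivative f' x) (at x)" "\<forall>v. (\<lambda>x. f' x v) \<in> bump_span c R"
    "\<forall>x. (g has_derivative g' x) (at x)" "\<forall>v. (\<lambda>x. g' x v) \<in> bump_span c R" by blast
  then show ?case
    by (intro exI[of _ "\<lambda>x v. f' x v + g' x v"])
       (auto intro: has_derivative_add bump_span.add)
next
  case (scale f a)
  then obtain f' where "\<forall>x. (f has_derivative f' x) (at x)" "\<forall>v. (\<lambda>x. f' x v) \<in> bump_span c R"
    by blast
  then show ?case
    by (intro exI[of _ "\<lambda>x v. a * f' x v"])
       (auto intro: has_derivative_mult_right bump_span.scale)
next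
  case (linear f w)
  then obtain f' where f': "\<forall>x. (f has_derivative f' x) (at x)" "\<forall>v. (\<lambda>x. f' x v) \<in> bump_span c R"
    by blast
  have "((\<lambda>y. (y \<bullet> w) * f y) has_derivative (\<lambda>v. (x \<bullet> w) * f' x v + (v \<bullet> w) * f x)) (at x)" for x
    by (rule has_derivative_mult) (auto intro!: derivative_eq_intros simp: f')
  moreover have "(\<lambda>x. (x \<bullet> w) * f' x v + (v \<bullet> w) * f x) \<in> bump_span c R" for v
    using f' linear by (auto intro!: bump_span.intros)
  ultimately show ?case by (intro exI[of _ "\<lambda>x v. (x \<bullet> w) * f' x v + (v \<bullet> w) * f x"]) auto
qed

lemma bump_span_differentiable: "f \<in> bump_span c R \<Longrightarrow> f differentiable (at x)"
  using bump_span_derivative differentiable_def by blast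

lemma bump_span_frechet_derivative:
  assumes "f \<in> bump_span c R"
  shows "(\<lambda>x. frechet_derivative f (at x) v) \<in> bump_span c R"
proof -
  obtain f' where f': "\<And>x. (f has_derivative f' x) (at x)" "\<And>v. (\<lambda>x. f' x v) \<in> bump_span c R"
    using bump_span_derivative[OF assms] by blast
  have "frechet_derivative f (at x) = f' x" for x
    using f'(1) frechet_derivative_at by metis
  then show ?thesis using f'(2) by simp
qed

lemma bump_span_continuous_on: "f \<in> bump_span c R \<Longrightarrow> continuous_on A f"
  by (intro continuous_at_imp_continuous_on ballI differentiable_imp_continuous_within
      bump_span_differentiable)

lemma Ck_bump_span: "f \<in> bump_span c R \<Longrightarrow> Ck k f"
  by (induction k arbitrary: f)
     (auto intro: bump_span_continuous_on bump_span_differentiable bump_span_frechet_derivative)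

lemma bump_span_eq_0:
  assumes "f \<in> bump_span c R" "0 < R" "y \<notin> ball c R"
  shows "f y = 0"
  using assms(1)
proof induction
  case (base k)
  have "R \<le> norm (y - c)"
    using assms(3) by (simp add: dist_norm norm_minus_commute)
  then have "R\<^sup>2 \<le> (norm (y - c))\<^sup>2"
    using assms(2) by (intro power_mono) auto
  then have "R\<^sup>2 \<le> (y - c) \<bullet> (y - c)"
    by (simp add: power2_norm_eq_inner)
  then have "1 - (y - c) \<bullet> (y - c) / R\<^sup>2 \<le> 0"
    using assms(2) by (simp add: field_simps)
  then show ?case by (simp add: exp_inv_quot_def)
qed auto

lemma bump_span_closure_support:
  assumes "f \<in> bump_span c R" "0 < R"
  shows "closure {x. f x \<noteq> 0} \<subseteq> cball c R"
proof (rule closure_minimal)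
  show "{x. f x \<noteq> 0} \<subseteq> cball c R"
    using bump_span_eq_0[OF assms] ball_subset_cball by blast
qed simp

lemma bump_span_test_function:
  assumes "f \<in> bump_span c R" "0 < R" "cball c R \<subseteq> \<Omega>"
  shows "f \<in> test_functions \<Omega>"
  using bump_span_closure_support[OF assms(1,2)] Ck_bump_span[OF assms(1)] assms(3)
  by (auto simp: test_functions_def compact_eq_bounded_closed intro: bounded_subset[OF bounded_cball])

lemma bump_span_bounded:
  assumes "f \<in> bump_span c R" "0 < R"
  obtains B where "0 < B" "\<And>x. \<bar>f x\<bar> \<le> B"
proof -
  have "compact (f ` cball c R)"
    by (rule compact_continuous_image[OF bump_span_continuous_on[OF assms(1)] compact_cball])
  from compact_imp_bounded[OF this]
  obtain B where B: "0 < B" "\<And>x. x \<in> cball c R \<Longrightarrow> \<bar>f x\<bar> \<le> B"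
    by (auto simp only: bounded_pos real_norm_def ball_simps)
  moreover have "\<bar>f x\<bar> \<le> B" if "x \<notin> cball c R" for x
  proof -
    have "f x = 0"
      by (rule bump_span_eq_0[OF assms]) (use that in auto)
    then show ?thesis using B(1) by simp
  qed
  ultimately show thesis by (intro that[of B]) (auto simp del: mem_cball)
qed

text \<open>Every directional derivative lies in the span again and is therefore bounded; the
  finitely many basis directions control the operator norm, and the mean value inequality concludes.
  The summand 1 in the constant makes it strictly positive.\<close>

lemma bump_span_lipschitz:
  assumes f: "f \<in> bump_span c R" and R: "0 < R"
  obtains L where "0 < L" "\<And>x y. \<bar>f x - f y\<bar> \<le> L * norm (x - y)"
proof -
  have "\<exists>B. \<forall>x. \<bar>frechet_derivative f (at x) b\<bar> \<le> B" for b
    using bump_span_bounded[OF bump_span_frechet_derivative[OF f] R] by metis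
  then obtain B where B: "\<And>b x. \<bar>frechet_derivative f (at x) b\<bar> \<le> B b"
    by metis
  have B0: "0 \<le> B b" for b using B[of undefined b] by linarith
  let ?L = "1 + (\<Sum>b\<in>Basis. B b)"
  have on: "onorm (frechet_derivative f (at x)) \<le> ?L" for x
  proof (rule onorm_bound)
    show "0 \<le> ?L" by (auto intro!: add_nonneg_nonneg sum_nonneg B0)
    fix v
    have lin: "linear (frechet_derivative f (at x))"
      using bump_span_differentiable[OF f] linear_frechet_derivative by blast
    have "frechet_derivative f (at x) v = frechet_derivative f (at x) (\<Sum>b\<in>Basis. (v \<bullet> b) *\<^sub>R b)"
      by (simp add: euclidean_representation)
    also have "\<dots> = (\<Sum>b\<in>Basis. (v \<bullet> b) * frechet_derivative f (at x) b)"
      using lin by (simp add: linear_sum linear_cmul)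
    finally have "\<bar>frechet_derivative f (at x) v\<bar> \<le> (\<Sum>b\<in>Basis. \<bar>(v \<bullet> b) * frechet_derivative f (at x) b\<bar>)"
      by (simp only: sum_abs)
    also have "\<dots> \<le> (\<Sum>b\<in>Basis. norm v * B b)"
      by (intro sum_mono) (auto simp: abs_mult intro!: mult_mono B Basis_le_norm)
    also have "\<dots> = norm v * (\<Sum>b\<in>Basis. B b)"
      by (rule sum_distrib_left[symmetric])
    also have "\<dots> \<le> ?L * norm v"
      by (simp add: algebra_simps del: sum_distrib_left sum_distrib_right)
    finally show "norm (frechet_derivative f (at x) v) \<le> ?L * norm v" by simp
  qed
  have "norm (f x - f y) \<le> ?L * norm (x - y)" for x y
    by (rule differentiable_bound[of UNIV f "\<lambda>x. frechet_derivative f (at x)"])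
       (use on bump_span_differentiable[OF f] in \<open>auto simp: frechet_derivative_works\<close>)
  moreover have "0 < ?L" using sum_nonneg[of Basis B] B0 by fastforce
  ultimately show thesis using that by (metis real_norm_def)
qed

section \<open>Integration lemmas\<close>

lemma borel_measurable_lebesgue_on_continuous:
  fixes f :: "'a::euclidean_space \<Rightarrow> 'b::euclidean_space"
  assumes "continuous_on UNIV f"
  shows "f \<in> borel_measurable (lebesgue_on S)"
proof -
  have "f \<in> borel_measurable lborel"
    using borel_measurable_continuous_onI[OF assms] by simp
  then show ?thesis
    by (intro measurable_restrict_space1 measurable_completion)
qed

lemma integrable_mult_bounded_continuous:
  fixes u h :: "'a::euclidean_space \<Rightarrow> real"
  assumes u: "integrable (lebesgue_on S) u" and h: "continuous_on UNIV h" "\<And>x. \<bar>h x\<bar> \<le> B"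
  shows "integrable (lebesgue_on S) (\<lambda>x. u x * h x)"
proof (rule Bochner_Integration.integrable_bound[where f = "\<lambda>x. B * u x"])
  show "(\<lambda>x. u x * h x) \<in> borel_measurable (lebesgue_on S)"
    using borel_measurable_integrable[OF u] borel_measurable_lebesgue_on_continuous[OF h(1), of S]
    by measurable
  have "\<bar>u x\<bar> * \<bar>h x\<bar> \<le> \<bar>B\<bar> * \<bar>u x\<bar>" for x
    using mult_left_mono[OF order_trans[OF h(2) abs_ge_self[of B]], of "\<bar>u x\<bar>" x]
    by (simp add: mult.commute)
  then show "AE x in lebesgue_on S. norm (u x * h x) \<le> norm (B * u x)"
    by (simp add: abs_mult)
qed (use u in simp)

text \<open>Dominated convergence for the difference quotients, which the mean value inequality
  bounds by \<open>w\<close>. Since dominated convergence speaks of sequences, the limit is tested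
  along arbitrary null sequences, shifted by \<open>N\<close> so that they stay in the
  interval.\<close>

lemma has_real_derivative_integral:
  fixes f f' :: "real \<Rightarrow> 'a \<Rightarrow> real"
  assumes t: "a < t" "t < b"
    and int: "\<And>s. a < s \<Longrightarrow> s < b \<Longrightarrow> integrable M (f s)"
    and der: "\<And>s x. a < s \<Longrightarrow> s < b \<Longrightarrow> ((\<lambda>s. f s x) has_real_derivative f' s x) (at s)"
    and bnd: "\<And>s x. a < s \<Longrightarrow> s < b \<Longrightarrow> \<bar>f' s x\<bar> \<le> w x"
    and w: "integrable M w" and meas: "f' t \<in> borel_measurable M"
  shows "((\<lambda>s. LINT x|M. f s x) has_real_derivative (LINT x|M. f' t x)) (at t)"
proof -
  have "(\<lambda>i. ((LINT x|M. f (t + X i) x) - (LINT x|M. f t x)) / X i) \<longlonglongrightarrow> (LINT x|M. f' t x)"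
    if X: "\<And>i. X i \<noteq> 0" "X \<longlonglongrightarrow> 0" for X :: "nat \<Rightarrow> real"
  proof -
    have "\<forall>\<^sub>F i in sequentially. a - t < X i \<and> X i < b - t"
      using order_tendstoD[OF X(2), of "a - t"] order_tendstoD[OF X(2), of "b - t"] t
      by (auto intro: eventually_conj)
    then obtain N where N: "\<And>i. N \<le> i \<Longrightarrow> a < t + X i \<and> t + X i < b"
      by (auto simp: eventually_sequentially algebra_simps)
    define Y where "Y i = X (i + N)" for i
    have Y: "Y i \<noteq> 0" "a < t + Y i" "t + Y i < b" for i
      using X(1) N[of "i + N"] by (auto simp: Y_def)
    have Y0: "Y \<longlonglongrightarrow> 0"
      unfolding Y_def using X(2) by (rule LIMSEQ_ignore_initial_segment)
    have "(\<lambda>i. LINT x|M. (f (t + Y i) x - f t x) / Y i) \<longlonglongrightarrow> (LINT x|M. f' t x)"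
    proof (rule integral_dominated_convergence[where w = w])
      show "(\<lambda>x. (f (t + Y i) x - f t x) / Y i) \<in> borel_measurable M" for i
        using borel_measurable_integrable[OF int[OF Y(2,3)]] borel_measurable_integrable[OF int[OF t]]
        by measurable
      show "AE x in M. (\<lambda>i. (f (t + Y i) x - f t x) / Y i) \<longlonglongrightarrow> f' t x"
      proof (rule AE_I2)
        fix x
        have "((\<lambda>h. (f (t + h) x - f t x) / h) \<longlongrightarrow> f' t x) (at 0)"
          using der[OF t] by (simp add: has_field_derivative_iff)
                             (simp add: LIM_offset_zero_iff[of t])
        then show "(\<lambda>i. (f (t + Y i) x - f t x) / Y i) \<longlonglongrightarrow> f' t x"
          using Y(1) Y0 by (auto simp: tendsto_at_iff_sequentially comp_def)
      qed
      show "AE x in M. norm ((f (t + Y i) x - f t x) / Y i) \<le> w x" for i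
      proof (rule AE_I2)
        fix x
        have "norm (f (t + Y i) x - f t x) \<le> w x * norm (t + Y i - t)"
          by (rule field_differentiable_bound[of "{a<..<b}" "\<lambda>s. f s x" "\<lambda>s. f' s x"])
             (use der bnd t Y in \<open>auto intro: has_field_derivative_at_within\<close>)
        then show "norm ((f (t + Y i) x - f t x) / Y i) \<le> w x"
          using Y(1)[of i] by (simp add: field_simps)
      qed
    qed (use meas w in auto)
    also have "(\<lambda>i. LINT x|M. (f (t + Y i) x - f t x) / Y i)
        = (\<lambda>i. ((LINT x|M. f (t + Y i) x) - (LINT x|M. f t x)) / Y i)"
      using int[OF t] int[OF Y(2,3)] by simp
    finally show ?thesis
      unfolding Y_def by (rule LIMSEQ_offset)
  qed
  then have "((\<lambda>h. ((LINT x|M. f (t + h) x) - (LINT x|M. f t x)) / h) \<longlongrightarrow> (LINT x|M. f' t x)) (at 0)"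
    by (auto simp: tendsto_at_iff_sequentially comp_def)
  then show ?thesis
    by (simp add: has_field_derivative_iff) (simp add: LIM_offset_zero_iff[of t])
qed

text \<open>A pointwise substitute for Hoelder's inequality: the free parameter \<open>s\<close> is optimised after integration.\<close>

lemma le_power_young:
  fixes a M s p :: real
  assumes "0 \<le> a" "0 < M" "0 < s" "1 < p"
  shows "a \<le> M * (s * (a powr p / M powr p) + s powr (- 1 / (p - 1)))"
proof -
  define b where "b = a / M"
  have b: "0 \<le> b" using assms by (simp add: b_def)
  \<comment> \<open>Below the threshold \<open>s powr (- 1 / (p - 1))\<close> the second summand
    suffices; above it \<open>b powr (p - 1) \<ge> 1 / s\<close>, hence
    \<open>b \<le> s * b powr p\<close>.\<close>
  have "b \<le> s * b powr p + s powr (- 1 / (p - 1))"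
  proof (cases "b \<le> s powr (- 1 / (p - 1))")
    case True
    then show ?thesis using assms by (simp add: add_increasing)
  next
    case False
    then have "s powr (- 1 / (p - 1)) < b" by simp
    then have "(s powr (- 1 / (p - 1))) powr (p - 1) \<le> b powr (p - 1)"
      using assms by (intro powr_mono2) auto
    moreover have "(s powr (- 1 / (p - 1))) powr (p - 1) = 1 / s"
      using assms by (simp only: powr_powr) (simp add: powr_minus_divide)
    ultimately have "1 / s \<le> b powr (p - 1)" by simp
    then have "1 * b \<le> (s * b powr (p - 1)) * b"
      using assms b by (intro mult_right_mono) (auto simp: field_simps)
    also have "\<dots> = s * b powr p"
      using powr_mult_base[OF b, of "p - 1"] by (simp add: mult_ac)
    finally show ?thesis by (simp add: add_increasing2)
  qed
  then have "M * b \<le> M * (s * b powr p + s powr (- 1 / (p - 1)))"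
    using assms by (intro mult_left_mono) auto
  then show ?thesis
    using assms by (simp add: b_def powr_divide)
qed

lemma Lp_integrable:
  fixes u :: "'a::euclidean_space \<Rightarrow> 'b::euclidean_space"
  assumes u: "u \<in> Lp p \<Omega>" and p: "1 < p" and \<Omega>: "\<Omega> \<in> lmeasurable"
  shows "integrable (lebesgue_on \<Omega>) u"
proof (rule Bochner_Integration.integrable_bound[where f = "\<lambda>x. norm (u x) powr p + 1"])
  have "integrable (lebesgue_on \<Omega>) (\<lambda>x. 1 :: real)"
    using \<Omega> by (subst integrable_restrict_space)
      (auto simp: lmeasurable_iff_integrable[symmetric] fmeasurableD)
  then show "integrable (lebesgue_on \<Omega>) (\<lambda>x. norm (u x) powr p + 1)"
    using u by (auto simp: Lp_def)
  have "norm (u x) \<le> norm (u x) powr p + 1" for x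
    using le_power_young[of "norm (u x)" 1 1 p] p by simp
  then show "AE x in lebesgue_on \<Omega>. norm (u x) \<le> norm (norm (u x) powr p + 1)"
    by (intro AE_I2) (simp add: add_nonneg_nonneg abs_of_nonneg)
qed (use u in \<open>auto simp: Lp_def\<close>)

text \<open>For \<open>B\<close> of positive measure, the choice of \<open>s\<close> as the power
  \<open>(p - 1) / p\<close> of that measure gives Hoelder's bound up to a factor 2. With
  \<open>s\<close> left free, callers can insert a power of their scale parameter, or simply
  1.\<close>

lemma Lp_integral_norm_le:
  fixes g :: "'a::euclidean_space \<Rightarrow> 'b::euclidean_space"
  assumes g: "g \<in> Lp p \<Omega>" and p: "1 < p" and \<Omega>: "\<Omega> \<in> sets lebesgue"
    and M: "0 < M" "(LINT x|lebesgue_on \<Omega>. norm (g x) powr p) \<le> M powr p"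
    and s: "0 < s" and B: "B \<in> lmeasurable" "B \<subseteq> \<Omega>"
  shows "(LINT x|lebesgue_on \<Omega>. indicator B x * norm (g x))
       \<le> M * (s + s powr (- 1 / (p - 1)) * measure lebesgue B)"
proof -
  let ?r = "\<lambda>x. M * (s * (norm (g x) powr p / M powr p) + s powr (- 1 / (p - 1)) * indicator B x)"
  have iB: "integrable (lebesgue_on \<Omega>) (indicator B :: 'a \<Rightarrow> real)"
    and eB: "(LINT x|lebesgue_on \<Omega>. indicator B x) = measure lebesgue B"
    using B \<Omega> by (auto simp: integrable_restrict_space integral_restrict_space
        indicator_inter_arith[symmetric] Int_absorb1 Int_absorb2 fmeasurableD fmeasurableD2
        lmeasurable_iff_integrable measure_restrict_space)
  have ig: "integrable (lebesgue_on \<Omega>) (\<lambda>x. norm (g x) powr p)"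
    using g by (simp add: Lp_def)
  have ir: "integrable (lebesgue_on \<Omega>) ?r"
    using iB ig by simp
  have le: "indicator B x * norm (g x) \<le> ?r x" for x
    using le_power_young[of "norm (g x)" M s p] p M s by (auto simp: indicator_def)
  have "(LINT x|lebesgue_on \<Omega>. indicator B x * norm (g x)) \<le> (LINT x|lebesgue_on \<Omega>. ?r x)"
  proof (rule integral_mono_AE'[OF ir])
    show "AE x in lebesgue_on \<Omega>. indicator B x * norm (g x) \<le> ?r x"
      using le by (intro AE_I2)
    show "AE x in lebesgue_on \<Omega>. 0 \<le> ?r x"
      using M s by (intro AE_I2) (auto intro!: mult_nonneg_nonneg add_nonneg_nonneg)
  qed
  also have "\<dots> = M * (s * ((LINT x|lebesgue_on \<Omega>. norm (g x) powr p) / M powr p)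
      + s powr (- 1 / (p - 1)) * measure lebesgue B)"
    using iB ig eB by simp
  also have "\<dots> \<le> M * (s * 1 + s powr (- 1 / (p - 1)) * measure lebesgue B)"
    using M s by (intro mult_left_mono add_right_mono) (auto simp: field_simps)
  finally show ?thesis by simp
qed


section \<open>Averages over cones\<close>

definition bump :: "'a::euclidean_space \<Rightarrow> real \<Rightarrow> 'a \<Rightarrow> real" where
  "bump c R y = exp_inv_quot 0 (1 - (y - c) \<bullet> (y - c) / R\<^sup>2)"

definition bump_mass :: "'a::euclidean_space \<Rightarrow> real \<Rightarrow> real" where
  "bump_mass c R = (LINT y|lborel. bump c R y)"

text \<open>An off-centre mollifier at scale \<open>t\<close>: the divisor normalises its integral
  to 1, and a nonzero \<open>c\<close> moves the support away from the apex \<open>x\<close> in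
  proportion to \<open>t\<close>.\<close>

definition cone_kernel :: "'a::euclidean_space \<Rightarrow> real \<Rightarrow> real \<Rightarrow> 'a \<Rightarrow> 'a \<Rightarrow> real" where
  "cone_kernel c b t x y = bump c b ((y - x) /\<^sub>R t) / (bump_mass c b * t ^ DIM('a))"

definition cone_average ::
  "'a::euclidean_space \<Rightarrow> real \<Rightarrow> 'a set \<Rightarrow> ('a \<Rightarrow> real) \<Rightarrow> real \<Rightarrow> 'a \<Rightarrow> real" where
  "cone_average c b \<Omega> u t x = (LINT y|lebesgue_on \<Omega>. u y * cone_kernel c b t x y)"

lemma bump_in_bump_span: "bump c R \<in> bump_span c R"
  unfolding bump_def[abs_def] by (rule bump_span.base)

lemma bump_nonneg [simp]: "0 \<le> bump c R y"
  by (simp add: bump_def)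

lemma bump_le_1: "bump c R y \<le> 1"
  by (simp add: bump_def exp_inv_quot_def)

lemma continuous_on_bump: "continuous_on A (bump c R)"
  by (rule bump_span_continuous_on[OF bump_in_bump_span])

lemma bump_eq_0: "0 < R \<Longrightarrow> y \<notin> ball c R \<Longrightarrow> bump c R y = 0"
  by (rule bump_span_eq_0[OF bump_in_bump_span])

lemma bump_pos:
  assumes "y \<in> ball c R"
  shows "0 < bump c R y"
proof -
  have "norm (y - c) < R" using assms by (simp add: dist_norm norm_minus_commute)
  then have "(norm (y - c))\<^sup>2 < R\<^sup>2" by (intro power_strict_mono) auto
  moreover have "0 < R\<^sup>2" using calculation by (meson le_less_trans zero_le_power2)
  ultimately have "0 < 1 - (y - c) \<bullet> (y - c) / R\<^sup>2"
    by (simp add: power2_norm_eq_inner)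
  then show ?thesis unfolding bump_def by (rule exp_inv_quot_pos)
qed

text \<open>Rescaling stays within the family of bumps, so support, bounds and membership in the
  test functions carry over to the kernel at every scale.\<close>

lemma bump_rescale:
  assumes "0 < t"
  shows "bump c b ((y - x) /\<^sub>R t) = bump (x + t *\<^sub>R c) (t * b) y"
proof -
  have "(y - x) /\<^sub>R t - c = (y - (x + t *\<^sub>R c)) /\<^sub>R t"
    using assms by (simp add: algebra_simps)
  then show ?thesis
    by (simp only: bump_def inner_scaleR_left inner_scaleR_right)
       (simp add: power2_eq_square field_simps)
qed

lemma borel_measurable_bump [measurable]: "bump c R \<in> borel_measurable borel"
  by (rule borel_measurable_continuous_onI[OF continuous_on_bump])

lemma integrable_bump:
  assumes "0 < R"
  shows "integrable lborel (bump c R)"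
proof (rule Bochner_Integration.integrable_bound[where f = "indicator (cball c R) :: _ \<Rightarrow> real"])
  have "norm (bump c R y) \<le> norm (indicator (cball c R) y :: real)" for y
    using bump_eq_0[OF assms, of y c] bump_le_1[of c R y]
    by (auto simp: indicator_def)
  then show "AE y in lborel. norm (bump c R y) \<le> norm (indicator (cball c R) y :: real)"
    by (intro AE_I2)
qed (auto intro: emeasure_lborel_cball_finite)

lemma bump_mass_pos:
  assumes "0 < R"
  shows "0 < bump_mass c R"
proof (rule ccontr)
  assume "\<not> 0 < bump_mass c R"
  moreover have "0 \<le> bump_mass c R"
    unfolding bump_mass_def by (rule Bochner_Integration.integral_nonneg) simp
  ultimately have "(LINT y|lborel. bump c R y) = 0"
    unfolding bump_mass_def by linarith
  then have "AE y in lborel. bump c R y = 0"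
    using integral_nonneg_eq_0_iff_AE[OF integrable_bump[OF assms, of c]] by simp
  then have "AE y in lborel. y \<notin> ball c R"
    by eventually_elim (use bump_pos[of _ c R] in fastforce)
  then have "emeasure lborel (ball c R) = 0"
    by (subst (asm) AE_iff_measurable[where N = "ball c R"]) auto
  then show False
    using content_ball_pos[OF assms, of c] by (simp add: measure_def)
qed

lemma cone_kernel_nonneg: "0 < b \<Longrightarrow> 0 < t \<Longrightarrow> 0 \<le> cone_kernel c b t x y"
  using bump_mass_pos[of b c] by (simp add: cone_kernel_def)

lemma cone_kernel_le:
  fixes c :: "'a::euclidean_space"
  assumes "0 < b" "0 < t"
  shows "cone_kernel c b t x y \<le> 1 / (bump_mass c b * t ^ DIM('a))"
  unfolding cone_kernel_def
  using bump_mass_pos[of b c] assms bump_le_1 by (intro divide_right_mono) auto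

lemma cone_kernel_eq_0:
  assumes "0 < b" "0 < t" "y \<notin> ball (x + t *\<^sub>R c) (t * b)"
  shows "cone_kernel c b t x y = 0"
  using bump_eq_0[OF _ assms(3)] assms(1,2) by (simp add: cone_kernel_def bump_rescale)

lemma continuous_on_cone_kernel: "continuous_on A (cone_kernel c b t x)"
  unfolding cone_kernel_def[abs_def] divide_inverse
  by (intro continuous_on_mult continuous_on_const
      continuous_on_compose2[OF continuous_on_bump[of UNIV]]) (auto intro!: continuous_intros)

text \<open>The apex enters through \<open>(y - x) /\<^sub>R t\<close>, which costs one power of
  \<open>t\<close> beyond the normalisation by \<open>t ^ DIM('a)\<close>.\<close>

lemma cone_kernel_lipschitz:
  fixes c :: "'a::euclidean_space"
  assumes b: "0 < b"
  obtains L where "0 < L" "\<And>t x x' y. 0 < t \<Longrightarrow>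
    \<bar>cone_kernel c b t x y - cone_kernel c b t x' y\<bar> \<le> L / t ^ (DIM('a) + 1) * norm (x - x')"
proof -
  obtain L where L: "0 < L" "\<And>x y. \<bar>bump c b x - bump c b y\<bar> \<le> L * norm (x - y)"
    using bump_span_lipschitz[OF bump_in_bump_span b] by blast
  have Z: "0 < bump_mass c b" by (rule bump_mass_pos[OF b])
  have "\<bar>cone_kernel c b t x y - cone_kernel c b t x' y\<bar>
      \<le> L / bump_mass c b / t ^ (DIM('a) + 1) * norm (x - x')" if t: "0 < t" for t x x' y
  proof -
    have "\<bar>bump c b ((y - x) /\<^sub>R t) - bump c b ((y - x') /\<^sub>R t)\<bar>
        \<le> L * norm ((y - x) /\<^sub>R t - (y - x') /\<^sub>R t)"
      by (rule L(2))
    also have "(y - x) /\<^sub>R t - (y - x') /\<^sub>R t = (x' - x) /\<^sub>R t"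
      by (simp add: scaleR_diff_right)
    also have "L * norm ((x' - x) /\<^sub>R t) = L * norm (x - x') / t"
      using t by (simp only: norm_scaleR norm_minus_commute[of x']) (simp add: divide_inverse)
    finally have le: "\<bar>bump c b ((y - x) /\<^sub>R t) - bump c b ((y - x') /\<^sub>R t)\<bar> \<le> L * norm (x - x') / t" .
    have "\<bar>cone_kernel c b t x y - cone_kernel c b t x' y\<bar>
        = \<bar>bump c b ((y - x) /\<^sub>R t) - bump c b ((y - x') /\<^sub>R t)\<bar> / (bump_mass c b * t ^ DIM('a))"
      using Z t by (simp add: cone_kernel_def diff_divide_distrib[symmetric] abs_mult)
    also have "\<dots> \<le> (L * norm (x - x') / t) / (bump_mass c b * t ^ DIM('a))"
      using Z t by (intro divide_right_mono le) auto
    also have "\<dots> = L / bump_mass c b / t ^ (DIM('a) + 1) * norm (x - x')"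
      by simp
    finally show ?thesis .
  qed
  then show thesis using that[of "L / bump_mass c b"] L Z by simp
qed

lemma integral_cone_kernel:
  fixes c :: "'a::euclidean_space"
  assumes b: "0 < b" and t: "0 < t"
  shows "integrable lborel (cone_kernel c b t x)" "(LINT y|lborel. cone_kernel c b t x y) = 1"
proof -
  let ?f = "\<lambda>y. bump c b ((y - x) /\<^sub>R t)"
  have [measurable]: "?f \<in> borel_measurable borel" by measurable
  have f: "?f = bump (x + t *\<^sub>R c) (t * b)"
    by (simp add: bump_rescale[OF t] fun_eq_iff)
  have "integrable lborel ?f"
    using b t unfolding f by (intro integrable_bump) simp
  then show "integrable lborel (cone_kernel c b t x)"
    unfolding cone_kernel_def[abs_def] by simp
  have "(LINT y|lborel. ?f y)
      = (LINT y|density (distr lborel borel (\<lambda>w. x + t *\<^sub>R w)) (\<lambda>_. \<bar>t\<bar> ^ DIM('a)). ?f y)"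
    using lborel_affine[of t x] t by simp
  also have "\<dots> = (LINT w|lborel. t ^ DIM('a) * ?f (x + t *\<^sub>R w))"
    using t by (subst integral_density) (auto simp: integral_distr)
  also have "\<dots> = t ^ DIM('a) * bump_mass c b"
    using t by (simp add: bump_mass_def)
  finally show "(LINT y|lborel. cone_kernel c b t x y) = 1"
    unfolding cone_kernel_def using bump_mass_pos[OF b, of c] t by simp
qed

lemma integral_cone_kernel_on:
  fixes c :: "'a::euclidean_space"
  assumes b: "0 < b" and t: "0 < t" and \<Omega>: "\<Omega> \<in> sets lebesgue" "cball (x + t *\<^sub>R c) (t * b) \<subseteq> \<Omega>"
  shows "integrable (lebesgue_on \<Omega>) (cone_kernel c b t x)"
    "(LINT y|lebesgue_on \<Omega>. cone_kernel c b t x y) = 1"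
proof -
  have ind: "indicator \<Omega> y *\<^sub>R cone_kernel c b t x y = cone_kernel c b t x y" for y
  proof (cases "y \<in> \<Omega>")
    case False
    then have "cone_kernel c b t x y = 0"
      using \<Omega>(2) ball_subset_cball by (intro cone_kernel_eq_0[OF b t]) blast
    then show ?thesis by simp
  qed simp
  have m: "cone_kernel c b t x \<in> borel_measurable lborel"
    using integral_cone_kernel(1)[OF b t] by (rule borel_measurable_integrable)
  show "integrable (lebesgue_on \<Omega>) (cone_kernel c b t x)"
    using \<Omega> integral_cone_kernel(1)[OF b t, of c x] m
    by (subst integrable_restrict_space) (simp_all add: ind integrable_completion del: real_scaleR_def)
  show "(LINT y|lebesgue_on \<Omega>. cone_kernel c b t x y) = 1"
    using \<Omega> integral_cone_kernel(2)[OF b t, of c x] m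
    by (subst integral_restrict_space) (simp_all add: ind integral_completion del: real_scaleR_def)
qed

text \<open>
  The divergence of the field \<open>w \<mapsto> bump c b w *\<^sub>R w\<close>; it appears as the scaling derivative of the kernel.
\<close>

definition bump_divergence :: "'a::euclidean_space \<Rightarrow> real \<Rightarrow> 'a \<Rightarrow> real" where
  "bump_divergence c b w =
     (\<Sum>e\<in>Basis. bump c b w + (w \<bullet> e) * frechet_derivative (bump c b) (at w) e)"

text \<open>With n the dimension and \<open>w = (y - x) /\<^sub>R t\<close>, differentiating
  \<open>bump c b w / t ^ n\<close> in \<open>t\<close> produces \<open>n * bump c b w\<close> plus
  the derivative of the bump in direction \<open>w\<close>, all divided by
  \<open>- t ^ (n + 1)\<close>. That sum is a divergence in space, which is what makes integration
  by parts available.\<close>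

lemma cone_kernel_derivative:
  fixes c :: "'a::euclidean_space"
  assumes t: "0 < t"
  shows "((\<lambda>t. cone_kernel c b t x y) has_real_derivative
           - bump_divergence c b ((y - x) /\<^sub>R t) / (bump_mass c b * t ^ (DIM('a) + 1))) (at t)"
proof -
  let ?w = "\<lambda>t. (y - x) /\<^sub>R t"
  let ?B = "bump c b" and ?n = "DIM('a)"
  let ?D = "frechet_derivative ?B (at (?w t))"
  have dB: "(?B has_derivative ?D) (at (?w t))"
    using bump_span_differentiable[OF bump_in_bump_span] frechet_derivative_works by blast
  have lin: "linear ?D" using dB by (rule has_derivative_linear)
  have dw: "(?w has_derivative (\<lambda>h. h *\<^sub>R (- (?w t /\<^sub>R t)))) (at t)"
    using t by (auto intro!: derivative_eq_intros simp: fun_eq_iff power2_eq_square)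
  have "((\<lambda>t. ?B (?w t)) has_derivative (\<lambda>h. ?D (h *\<^sub>R (- (?w t /\<^sub>R t))))) (at t)"
    using has_derivative_compose[OF dw dB] .
  moreover have "(\<lambda>h. ?D (h *\<^sub>R (- (?w t /\<^sub>R t)))) = (*) (- ?D (?w t) / t)"
    using lin by (simp add: fun_eq_iff linear_cmul linear_neg divide_inverse mult_ac)
  ultimately have dBw: "((\<lambda>t. ?B (?w t)) has_real_derivative - ?D (?w t) / t) (at t)"
    by (simp add: has_field_derivative_def)
  have D: "?D (?w t) = (\<Sum>e\<in>Basis. (?w t \<bullet> e) * ?D e)"
  proof -
    have "?D (?w t) = ?D (\<Sum>e\<in>Basis. (?w t \<bullet> e) *\<^sub>R e)"
      by (simp only: euclidean_representation)
    then show ?thesis using lin by (simp only: linear_sum linear_cmul real_scaleR_def)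
  qed
  have H: "bump_divergence c b (?w t) = real ?n * ?B (?w t) + ?D (?w t)"
    by (simp only: bump_divergence_def D sum.distrib) simp
  have n: "?n = Suc (?n - 1)" using DIM_positive[where 'a = 'a] by simp
  have dn: "((\<lambda>t. t ^ ?n) has_real_derivative real ?n * t ^ (?n - 1)) (at t)"
    using DERIV_pow[of ?n t] by simp
  have "((\<lambda>t. ?B (?w t) / t ^ ?n) has_real_derivative
      (- ?D (?w t) / t * t ^ ?n - ?B (?w t) * (real ?n * t ^ (?n - 1))) / (t ^ ?n * t ^ ?n)) (at t)"
    using t by (intro DERIV_divide dBw dn) auto
  also have "(- ?D (?w t) / t * t ^ ?n - ?B (?w t) * (real ?n * t ^ (?n - 1))) / (t ^ ?n * t ^ ?n)
      = - bump_divergence c b (?w t) / t ^ (?n + 1)"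
  proof -
    have 1: "- ?D (?w t) / t * t ^ ?n / (t ^ ?n * t ^ ?n) = - ?D (?w t) / t ^ (?n + 1)"
      using t by simp
    have "t ^ ?n = t * t ^ (?n - 1)" using n power_Suc by metis
    then have 2: "?B (?w t) * (real ?n * t ^ (?n - 1)) / (t ^ ?n * t ^ ?n)
        = real ?n * ?B (?w t) / t ^ (?n + 1)"
      using t by simp
    show ?thesis
      unfolding H diff_divide_distrib 1 2 by (simp add: diff_divide_distrib add_divide_distrib)
  qed
  finally have "((\<lambda>t. ?B (?w t) / t ^ ?n / bump_mass c b) has_real_derivative
      - bump_divergence c b (?w t) / t ^ (?n + 1) / bump_mass c b) (at t)"
    by (rule DERIV_cdivide)
  then show ?thesis
    by (simp add: cone_kernel_def mult.commute)
qed

lemma bump_span_sum: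
  "finite A \<Longrightarrow> (\<And>i. i \<in> A \<Longrightarrow> f i \<in> bump_span c R) \<Longrightarrow> (\<lambda>y. \<Sum>i\<in>A. f i y) \<in> bump_span c R"
proof (induction A rule: finite_induct)
  case empty
  show ?case using bump_span.scale[OF bump_span.base, of 0] by simp
qed (auto intro: bump_span.add)

lemma bump_divergence_in_bump_span: "bump_divergence c b \<in> bump_span c b"
  unfolding bump_divergence_def[abs_def]
  by (intro bump_span_sum bump_span.add bump_span.linear bump_in_bump_span
      bump_span_frechet_derivative) auto

text \<open>\<open>M\<close> bounds both norms rather than their p-th powers, so the estimates below
  are linear in \<open>M\<close>. It is positive because it serves as a divisor in
  \<open>le_power_young\<close>.\<close>

definition sobolev_bound ::
  "real \<Rightarrow> 'a::euclidean_space set \<Rightarrow> real \<Rightarrow> ('a \<Rightarrow> real) \<Rightarrow> ('a \<Rightarrow> 'a) \<Rightarrow> bool" where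
  "sobolev_bound p \<Omega> M u g \<longleftrightarrow> u \<in> Lp p \<Omega> \<and> g \<in> Lp p \<Omega> \<and> has_weak_gradient \<Omega> u g \<and> 0 < M \<and>
     (LINT x|lebesgue_on \<Omega>. \<bar>u x\<bar> powr p) \<le> M powr p \<and>
     (LINT x|lebesgue_on \<Omega>. norm (g x) powr p) \<le> M powr p"

text \<open>The truncated cone with apex \<open>x\<close>, the union of these balls, lies in \<open>\<Omega>\<close>; \<open>x\<close> itself need not.\<close>

definition cone_fits :: "'a::euclidean_space set \<Rightarrow> 'a \<Rightarrow> real \<Rightarrow> real \<Rightarrow> 'a \<Rightarrow> bool" where
  "cone_fits \<Omega> c b T x \<longleftrightarrow> (\<forall>t. 0 < t \<and> t \<le> T \<longrightarrow> cball (x + t *\<^sub>R c) (t * b) \<subseteq> \<Omega>)"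

text \<open>The weak gradient is tested against the components of the field
  \<open>bump c b w *\<^sub>R (y - x)\<close> with \<open>w = (y - x) /\<^sub>R t\<close>. The
  factor \<open>1 / t\<close> from the chain rule turns \<open>y - x\<close> into \<open>w\<close>,
  so the divergence of the field is \<open>bump_divergence c b w\<close> without any power of
  \<open>t\<close>. The inclusion of the closed ball makes the components test functions on
  \<open>\<Omega>\<close>.\<close>

lemma weak_gradient_cone:
  fixes \<Omega> :: "'a::euclidean_space set"
  assumes u: "integrable (lebesgue_on \<Omega>) u" and g: "integrable (lebesgue_on \<Omega>) g"
    and wg: "has_weak_gradient \<Omega> u g" and b: "0 < b" and t: "0 < t"
    and fit: "cball (x + t *\<^sub>R c) (t * b) \<subseteq> \<Omega>"
  shows "(LINT y|lebesgue_on \<Omega>. u y * bump_divergence c b ((y - x) /\<^sub>R t))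
       = - (LINT y|lebesgue_on \<Omega>. (g y \<bullet> (y - x)) * bump c b ((y - x) /\<^sub>R t))"
proof -
  let ?S = "bump_span (x + t *\<^sub>R c) (t * b)"
  define \<psi> where "\<psi> e y = ((y - x) \<bullet> e) * bump c b ((y - x) /\<^sub>R t)" for e y
  have tb: "0 < t * b" using t b by simp
  have \<psi>S: "\<psi> e \<in> ?S" for e
    unfolding \<psi>_def[abs_def] bump_rescale[OF t]
    by (rule bump_span_cmul_diff[OF bump_in_bump_span])
  have D\<psi>: "frechet_derivative (\<psi> e) (at y) e = bump c b ((y - x) /\<^sub>R t)
      + (((y - x) /\<^sub>R t) \<bullet> e) * frechet_derivative (bump c b) (at ((y - x) /\<^sub>R t)) e"
    if e: "e \<in> Basis" for e y
  proof -
    let ?w = "(y - x) /\<^sub>R t"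
    let ?D = "frechet_derivative (bump c b) (at ?w)"
    have dB: "(bump c b has_derivative ?D) (at ?w)"
      using bump_span_differentiable[OF bump_in_bump_span] frechet_derivative_works by blast
    have lin: "linear ?D" using dB by (rule has_derivative_linear)
    have "((\<lambda>y. (y - x) /\<^sub>R t) has_derivative (\<lambda>v. v /\<^sub>R t)) (at y)"
      by (auto intro!: derivative_eq_intros)
    from has_derivative_compose[OF this dB]
    have "((\<lambda>y. bump c b ((y - x) /\<^sub>R t)) has_derivative (\<lambda>v. ?D (v /\<^sub>R t))) (at y)" .
    moreover have "((\<lambda>y. (y - x) \<bullet> e) has_derivative (\<lambda>v. v \<bullet> e)) (at y)"
      by (auto intro!: derivative_eq_intros)
    ultimately have "(\<psi> e has_derivative
        (\<lambda>v. ((y - x) \<bullet> e) * ?D (v /\<^sub>R t) + (v \<bullet> e) * bump c b ?w)) (at y)"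
      unfolding \<psi>_def[abs_def] by (intro has_derivative_mult)
    then have "frechet_derivative (\<psi> e) (at y)
        = (\<lambda>v. ((y - x) \<bullet> e) * ?D (v /\<^sub>R t) + (v \<bullet> e) * bump c b ?w)"
      by (simp add: frechet_derivative_at[symmetric])
    then show ?thesis
      using e lin by (simp add: linear_cmul)
  qed
  have int_u: "integrable (lebesgue_on \<Omega>) (\<lambda>y. u y * frechet_derivative (\<psi> e) (at y) e)" for e
  proof -
    have S: "(\<lambda>y. frechet_derivative (\<psi> e) (at y) e) \<in> ?S"
      by (rule bump_span_frechet_derivative[OF \<psi>S])
    obtain B where "\<And>y. \<bar>frechet_derivative (\<psi> e) (at y) e\<bar> \<le> B"
      using bump_span_bounded[OF S tb] by blast
    then show ?thesis
      by (rule integrable_mult_bounded_continuous[OF u bump_span_continuous_on[OF S]])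
  qed
  have int_g: "integrable (lebesgue_on \<Omega>) (\<lambda>y. (g y \<bullet> e) * \<psi> e y)" for e
  proof -
    obtain B where "\<And>y. \<bar>\<psi> e y\<bar> \<le> B"
      using bump_span_bounded[OF \<psi>S tb] by blast
    moreover have "integrable (lebesgue_on \<Omega>) (\<lambda>y. g y \<bullet> e)"
      using g by simp
    ultimately show ?thesis
      by (intro integrable_mult_bounded_continuous bump_span_continuous_on[OF \<psi>S])
  qed
  have "(LINT y|lebesgue_on \<Omega>. u y * bump_divergence c b ((y - x) /\<^sub>R t))
      = (LINT y|lebesgue_on \<Omega>. (\<Sum>e\<in>Basis. u y * frechet_derivative (\<psi> e) (at y) e))"
    by (simp add: bump_divergence_def D\<psi> sum_distrib_left cong: sum.cong)
  also have "\<dots> = (\<Sum>e\<in>Basis. (LINT y|lebesgue_on \<Omega>. u y * frechet_derivative (\<psi> e) (at y) e))"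
    using int_u by (rule Bochner_Integration.integral_sum)
  also have "\<dots> = (\<Sum>e\<in>Basis. - (LINT y|lebesgue_on \<Omega>. (g y \<bullet> e) * \<psi> e y))"
    using wg bump_span_test_function[OF \<psi>S tb fit]
    by (intro sum.cong) (auto simp: has_weak_gradient_def)
  also have "\<dots> = - (LINT y|lebesgue_on \<Omega>. (\<Sum>e\<in>Basis. (g y \<bullet> e) * \<psi> e y))"
    using int_g by (simp add: Bochner_Integration.integral_sum sum_negf)
  also have "(\<lambda>y. \<Sum>e\<in>Basis. (g y \<bullet> e) * \<psi> e y)
      = (\<lambda>y. (g y \<bullet> (y - x)) * bump c b ((y - x) /\<^sub>R t))"
    by (simp add: \<psi>_def fun_eq_iff euclidean_inner[of "g _" "_ - x"] sum_distrib_right mult.assoc)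
  finally show ?thesis .
qed

text \<open>Counting powers of \<open>t\<close>, with n the dimension: on the support
  \<open>y - x\<close> has size \<open>t\<close>, Hoelder on a ball of volume of order
  \<open>t ^ n\<close> contributes the exponent \<open>n - n / p\<close>, and the kernel derivative
  divides by \<open>t ^ (n + 1)\<close>. The exponent \<open>- n / p\<close> remains.\<close>

lemma cone_average_derivative:
  fixes \<Omega> :: "'a::euclidean_space set"
  assumes \<Omega>: "open \<Omega>" "bounded \<Omega>" and p: "1 < p" and b: "0 < b"
  shows "\<exists>C>0. \<forall>u g M x t. sobolev_bound p \<Omega> M u g \<and> 0 < t \<and> cball (x + t *\<^sub>R c) (t * b) \<subseteq> \<Omega>
    \<longrightarrow> (\<exists>D. ((\<lambda>t. cone_average c b \<Omega> u t x) has_real_derivative D) (at t) \<and>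
          \<bar>D\<bar> \<le> C * M * t powr (- DIM('a) / p))"
proof -
  let ?n = "DIM('a)" and ?Z = "bump_mass c b" and ?H = "bump_divergence c b"
  let ?V = "unit_ball_vol (real DIM('a)) * b ^ DIM('a)"
  let ?C = "(norm c + b) / ?Z * (1 + ?V)"
  have Z: "0 < ?Z" by (rule bump_mass_pos[OF b])
  have V: "0 < ?V" using b by (simp add: unit_ball_vol_pos)
  have C: "0 < ?C" using Z b V by (intro mult_pos_pos divide_pos_pos add_nonneg_pos) auto
  obtain h where h: "0 < h" "\<And>w. \<bar>?H w\<bar> \<le> h"
    using bump_span_bounded[OF bump_divergence_in_bump_span b] by blast
  have lm: "\<Omega> \<in> lmeasurable" using \<Omega> by (simp add: lmeasurable_open)
  have "\<exists>D. ((\<lambda>t. cone_average c b \<Omega> u t x) has_real_derivative D) (at t) \<and>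
      \<bar>D\<bar> \<le> ?C * M * t powr (- ?n / p)"
    if sb: "sobolev_bound p \<Omega> M u g" and t: "0 < t" and fit: "cball (x + t *\<^sub>R c) (t * b) \<subseteq> \<Omega>"
    for u g M x t
  proof (intro exI conjI)
    have u: "integrable (lebesgue_on \<Omega>) u" and g: "integrable (lebesgue_on \<Omega>) g"
      using sb Lp_integrable[OF _ p lm] by (auto simp: sobolev_bound_def)
    have wg: "has_weak_gradient \<Omega> u g" and M: "0 < M" and gLp: "g \<in> Lp p \<Omega>"
      and gM: "(LINT x|lebesgue_on \<Omega>. norm (g x) powr p) \<le> M powr p"
      using sb by (auto simp: sobolev_bound_def)
    let ?f' = "\<lambda>s y. u y * (- ?H ((y - x) /\<^sub>R s) / (?Z * s ^ (?n + 1)))"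
    let ?D = "LINT y|lebesgue_on \<Omega>. ?f' t y"
    have Hcont: "continuous_on UNIV (\<lambda>y. ?H ((y - x) /\<^sub>R s))" for s
      by (rule continuous_on_compose2[OF bump_span_continuous_on[OF bump_divergence_in_bump_span, of UNIV]])
         (auto intro!: continuous_intros)
    \<comment> \<open>The interval from \<open>t / 2\<close> to \<open>2 * t\<close> keeps the scale
      away from 0, so the derivative of the kernel is bounded by one constant and a multiple of
      \<open>\<bar>u\<bar>\<close> dominates.\<close>
    show "((\<lambda>t. cone_average c b \<Omega> u t x) has_real_derivative ?D) (at t)"
      unfolding cone_average_def
    proof (rule has_real_derivative_integral[where a = "t / 2" and b = "2 * t"
          and w = "\<lambda>y. \<bar>u y\<bar> * (h / (?Z * (t / 2) ^ (?n + 1)))"])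
      fix s assume s: "t / 2 < s" "s < 2 * t"
      then have s0: "0 < s" using t by simp
      have "\<bar>cone_kernel c b s x y\<bar> \<le> 1 / (?Z * s ^ ?n)" for y
        using cone_kernel_le[OF b s0, of c x y] cone_kernel_nonneg[OF b s0, of c x y] by simp
      then show "integrable (lebesgue_on \<Omega>) (\<lambda>y. u y * cone_kernel c b s x y)"
        by (rule integrable_mult_bounded_continuous[OF u continuous_on_cone_kernel])
      fix y
      show "((\<lambda>s. u y * cone_kernel c b s x y) has_real_derivative ?f' s y) (at s)"
        by (intro DERIV_cmult cone_kernel_derivative s0)
      have "(t / 2) ^ (?n + 1) \<le> s ^ (?n + 1)"
        using s t by (intro power_mono) auto
      then have "\<bar>- ?H ((y - x) /\<^sub>R s) / (?Z * s ^ (?n + 1))\<bar> \<le> h / (?Z * (t / 2) ^ (?n + 1))"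
        using h Z s0 t unfolding abs_divide abs_minus_cancel
        by (intro frac_le) (auto simp del: power_Suc)
      then show "\<bar>?f' s y\<bar> \<le> \<bar>u y\<bar> * (h / (?Z * (t / 2) ^ (?n + 1)))"
        unfolding abs_mult by (intro mult_left_mono) auto
    next
      show "integrable (lebesgue_on \<Omega>) (\<lambda>y. \<bar>u y\<bar> * (h / (?Z * (t / 2) ^ (?n + 1))))"
        using u by simp
      show "?f' t \<in> borel_measurable (lebesgue_on \<Omega>)"
        using borel_measurable_integrable[OF u]
          borel_measurable_lebesgue_on_continuous[OF Hcont, of t \<Omega>]
        by measurable
    qed (use t in auto)
    let ?G = "LINT y|lebesgue_on \<Omega>. (g y \<bullet> (y - x)) * bump c b ((y - x) /\<^sub>R t)"
    let ?B = "cball (x + t *\<^sub>R c) (t * b)"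
    let ?I = "LINT y|lebesgue_on \<Omega>. indicator ?B y * norm (g y)"
    have "?D = - (LINT y|lebesgue_on \<Omega>. u y * ?H ((y - x) /\<^sub>R t)) / (?Z * t ^ (?n + 1))"
      by simp
    also have "\<dots> = ?G / (?Z * t ^ (?n + 1))"
      by (simp only: weak_gradient_cone[OF u g wg b t fit] minus_minus)
    finally have "\<bar>?D\<bar> = \<bar>?G\<bar> / (?Z * t ^ (?n + 1))"
      using Z t by (simp add: abs_mult)
    also have "\<dots> \<le> (t * (norm c + b) * ?I) / (?Z * t ^ (?n + 1))"
    proof (rule divide_right_mono)
      have iB: "integrable (lebesgue_on \<Omega>) (\<lambda>y. indicator ?B y * norm (g y))"
        using integrable_mult_indicator[of ?B "lebesgue_on \<Omega>" "\<lambda>y. norm (g y)"] g fit lm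
        by (simp add: sets_restrict_space_iff fmeasurableD)
      have pw: "\<bar>(g y \<bullet> (y - x)) * bump c b ((y - x) /\<^sub>R t)\<bar>
          \<le> t * (norm c + b) * (indicator ?B y * norm (g y))" for y
      proof (cases "y \<in> ?B")
        case True
        have "norm (y - x) \<le> norm (y - (x + t *\<^sub>R c)) + norm (t *\<^sub>R c)"
          using norm_triangle_ineq[of "y - (x + t *\<^sub>R c)" "t *\<^sub>R c"] by simp
        also have "\<dots> \<le> t * b + t * norm c"
          using True t by (intro add_mono) (auto simp: dist_norm norm_minus_commute)
        finally have yx: "norm (y - x) \<le> t * (norm c + b)" by (simp add: algebra_simps)
        have "\<bar>(g y \<bullet> (y - x)) * bump c b ((y - x) /\<^sub>R t)\<bar> \<le> \<bar>g y \<bullet> (y - x)\<bar> * 1"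
          unfolding abs_mult by (intro mult_left_mono) (auto simp: bump_le_1)
        also have "\<dots> \<le> norm (g y) * norm (y - x)"
          using Cauchy_Schwarz_ineq2 by simp
        also have "\<dots> \<le> norm (g y) * (t * (norm c + b))"
          by (intro mult_left_mono yx) simp
        finally show ?thesis using True by (simp add: mult.commute)
      next
        case False
        then have "bump c b ((y - x) /\<^sub>R t) = 0"
          unfolding bump_rescale[OF t] using b t ball_subset_cball by (intro bump_eq_0) auto
        then show ?thesis using t b by simp
      qed
      have "\<bar>?G\<bar> \<le> (LINT y|lebesgue_on \<Omega>. \<bar>(g y \<bullet> (y - x)) * bump c b ((y - x) /\<^sub>R t)\<bar>)"
        by (rule integral_abs_bound)
      also have "\<dots> \<le> (LINT y|lebesgue_on \<Omega>. t * (norm c + b) * (indicator ?B y * norm (g y)))"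
      proof (rule integral_mono_AE')
        show "integrable (lebesgue_on \<Omega>) (\<lambda>y. t * (norm c + b) * (indicator ?B y * norm (g y)))"
          by (intro integrable_mult_right iB)
        show "AE y in lebesgue_on \<Omega>. \<bar>(g y \<bullet> (y - x)) * bump c b ((y - x) /\<^sub>R t)\<bar>
            \<le> t * (norm c + b) * (indicator ?B y * norm (g y))"
          using pw by (intro AE_I2)
        show "AE y in lebesgue_on \<Omega>. 0 \<le> t * (norm c + b) * (indicator ?B y * norm (g y))"
          using t b by (intro AE_I2) simp
      qed
      finally have "\<bar>?G\<bar> \<le> (LINT y|lebesgue_on \<Omega>. t * (norm c + b) * (indicator ?B y * norm (g y)))" .
      then show "\<bar>?G\<bar> \<le> t * (norm c + b) * ?I" by simp
    qed (use Z t in auto)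
    also have "\<dots> = (norm c + b) / ?Z * (?I / t ^ ?n)"
      using t by simp
    also have "\<dots> \<le> (norm c + b) / ?Z * (M * (1 + ?V) * t powr (- ?n / p))"
    proof (intro mult_left_mono)
      \<comment> \<open>This \<open>s\<close> balances the two summands of
        \<open>Lp_integral_norm_le\<close> on a ball of volume \<open>?V * t ^ ?n\<close>: both
        become multiples of \<open>t powr (?n - ?n / p)\<close>.\<close>
      define s where "s = t powr (real ?n * (p - 1) / p)"
      have s: "0 < s" using t by (simp add: s_def)
      have e1: "s / t ^ ?n = t powr (- ?n / p)"
      proof -
        have "s / t ^ ?n = t powr (real ?n * (p - 1) / p - real ?n)"
          using t by (simp add: s_def powr_diff powr_realpow)
        also have "real ?n * (p - 1) / p - real ?n = - ?n / p"
          using p by (simp add: field_simps)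
        finally show ?thesis .
      qed
      have e2: "s powr (- 1 / (p - 1)) = t powr (- ?n / p)"
        using p by (simp add: s_def powr_powr)
      have "measure lebesgue ?B = ?V * t ^ ?n"
        using b t by (simp add: content_cball power_mult_distrib)
      then have "?I \<le> M * (s + s powr (- 1 / (p - 1)) * (?V * t ^ ?n))"
        using Lp_integral_norm_le[OF gLp p _ M gM s, of ?B] fit lm by (auto simp: fmeasurableD)
      then have "?I / t ^ ?n \<le> M * (s + s powr (- 1 / (p - 1)) * (?V * t ^ ?n)) / t ^ ?n"
        using t by (intro divide_right_mono) auto
      also have "\<dots> = M * (s / t ^ ?n + s powr (- 1 / (p - 1)) * ?V)"
        using t by (simp add: field_simps)
      also have "\<dots> = M * (1 + ?V) * t powr (- ?n / p)"
        unfolding e1 e2 by (simp add: algebra_simps)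
      finally show "?I / t ^ ?n \<le> M * (1 + ?V) * t powr (- ?n / p)" .
    qed (use Z b in auto)
    finally show "\<bar>?D\<bar> \<le> ?C * M * t powr (- ?n / p)"
      by (simp add: mult_ac)
  qed
  with C show ?thesis by blast
qed

text \<open>The exponent \<open>- n / p\<close>, with n the dimension, equals
  \<open>?\<alpha> - 1\<close> with \<open>?\<alpha> > 0\<close>, which is where
  \<open>p > n\<close> enters. Comparing with the antiderivative
  \<open>?K * \<tau> powr ?\<alpha>\<close> by monotonicity, once subtracted and once added,
  replaces integrating the derivative, so nothing about its regularity in \<open>\<tau>\<close> is
  asked.\<close>

lemma cone_average_diff:
  fixes \<Omega> :: "'a::euclidean_space set"
  assumes \<Omega>: "open \<Omega>" "bounded \<Omega>" and p: "1 < p" "real DIM('a) < p" and b: "0 < b"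
  shows "\<exists>C>0. \<forall>u g M x T s t. sobolev_bound p \<Omega> M u g \<and> cone_fits \<Omega> c b T x \<and>
      0 < s \<and> s \<le> t \<and> t \<le> T \<longrightarrow>
      \<bar>cone_average c b \<Omega> u t x - cone_average c b \<Omega> u s x\<bar> \<le> C * M * t powr (1 - DIM('a) / p)"
proof -
  let ?\<alpha> = "1 - DIM('a) / p"
  have \<alpha>: "0 < ?\<alpha>" using p by simp
  obtain C where C: "0 < C" and D: "\<And>u g M x t. sobolev_bound p \<Omega> M u g \<Longrightarrow> 0 < t \<Longrightarrow>
      cball (x + t *\<^sub>R c) (t * b) \<subseteq> \<Omega> \<Longrightarrow>
      \<exists>D. ((\<lambda>t. cone_average c b \<Omega> u t x) has_real_derivative D) (at t) \<and>
          \<bar>D\<bar> \<le> C * M * t powr (- DIM('a) / p)"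
    using cone_average_derivative[OF \<Omega> p(1) b, of c] by blast
  have "\<bar>cone_average c b \<Omega> u t x - cone_average c b \<Omega> u s x\<bar> \<le> C / ?\<alpha> * M * t powr ?\<alpha>"
    if sb: "sobolev_bound p \<Omega> M u g" and fit: "cone_fits \<Omega> c b T x"
      and st: "0 < s" "s \<le> t" "t \<le> T" for u g M x T s t
  proof -
    let ?F = "\<lambda>\<tau>. cone_average c b \<Omega> u \<tau> x" and ?K = "C * M / ?\<alpha>"
    have M: "0 < M" using sb by (simp add: sobolev_bound_def)
    have der: "\<exists>D. (?F has_real_derivative D) (at \<tau>) \<and> \<bar>D\<bar> \<le> C * M * \<tau> powr (?\<alpha> - 1)"
      if "s \<le> \<tau>" "\<tau> \<le> t" for \<tau>
    proof -
      have "cball (x + \<tau> *\<^sub>R c) (\<tau> * b) \<subseteq> \<Omega>"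
        using fit that st unfolding cone_fits_def by (meson less_le_trans order_trans)
      then show ?thesis
        using D[OF sb, of \<tau> x] that st by simp
    qed
    have dp: "((\<lambda>\<tau>. ?K * \<tau> powr ?\<alpha>) has_real_derivative C * M * \<tau> powr (?\<alpha> - 1)) (at \<tau>)"
      if "s \<le> \<tau>" for \<tau>
      using DERIV_cmult[OF has_real_derivative_powr[of \<tau> ?\<alpha>], of ?K] that st p(2) \<alpha>
      by (simp add: less_imp_neq[THEN not_sym, OF p(2)] mult_ac)
    have "?F t - ?K * t powr ?\<alpha> \<le> ?F s - ?K * s powr ?\<alpha>"
    proof (rule DERIV_nonpos_imp_nonincreasing[OF st(2), of "\<lambda>\<tau>. ?F \<tau> - ?K * \<tau> powr ?\<alpha>"])
      fix \<tau> assume \<tau>: "s \<le> \<tau>" "\<tau> \<le> t"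
      then obtain D where "(?F has_real_derivative D) (at \<tau>)" "\<bar>D\<bar> \<le> C * M * \<tau> powr (?\<alpha> - 1)"
        using der by blast
      then show "\<exists>y. ((\<lambda>\<tau>. ?F \<tau> - ?K * \<tau> powr ?\<alpha>) has_real_derivative y) (at \<tau>) \<and> y \<le> 0"
        by (intro exI[of _ "D - C * M * \<tau> powr (?\<alpha> - 1)"] conjI DERIV_diff dp[OF \<tau>(1)]) auto
    qed
    moreover have "?F s + ?K * s powr ?\<alpha> \<le> ?F t + ?K * t powr ?\<alpha>"
    proof (rule DERIV_nonneg_imp_nondecreasing[OF st(2), of "\<lambda>\<tau>. ?F \<tau> + ?K * \<tau> powr ?\<alpha>"])
      fix \<tau> assume \<tau>: "s \<le> \<tau>" "\<tau> \<le> t"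
      then obtain D where "(?F has_real_derivative D) (at \<tau>)" "\<bar>D\<bar> \<le> C * M * \<tau> powr (?\<alpha> - 1)"
        using der by blast
      then show "\<exists>y. ((\<lambda>\<tau>. ?F \<tau> + ?K * \<tau> powr ?\<alpha>) has_real_derivative y) (at \<tau>) \<and> 0 \<le> y"
        by (intro exI[of _ "D + C * M * \<tau> powr (?\<alpha> - 1)"] conjI DERIV_add dp[OF \<tau>(1)]) auto
    qed
    moreover have "0 \<le> ?K * s powr ?\<alpha>"
      using C M \<alpha> by simp
    ultimately have "\<bar>?F t - ?F s\<bar> \<le> ?K * t powr ?\<alpha>" by linarith
    then show ?thesis by simp
  qed
  then show ?thesis
    using C \<alpha> by (intro exI[of _ "C / ?\<alpha>"]) (auto intro!: divide_pos_pos)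
qed

text \<open>Crude bounds from the size of the kernel and its Lipschitz constant. They blow up as
  \<open>t\<close> tends to 0, which is harmless because they are applied at one scale fixed
  beforehand.\<close>

lemma cone_average_bounds:
  fixes \<Omega> :: "'a::euclidean_space set"
  assumes \<Omega>: "open \<Omega>" "bounded \<Omega>" and p: "1 < p" and b: "0 < b"
  shows "\<exists>C>0. \<forall>u g M x y t. sobolev_bound p \<Omega> M u g \<and> 0 < t \<longrightarrow>
      \<bar>cone_average c b \<Omega> u t x\<bar> \<le> C * M / t ^ DIM('a) \<and>
      \<bar>cone_average c b \<Omega> u t x - cone_average c b \<Omega> u t y\<bar> \<le> C * M / t ^ (DIM('a) + 1) * norm (x - y)"
proof -
  let ?n = "DIM('a)" and ?Z = "bump_mass c b"
  have Z: "0 < ?Z" by (rule bump_mass_pos[OF b])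
  have lm: "\<Omega> \<in> lmeasurable" using \<Omega> by (simp add: lmeasurable_open)
  obtain L where L: "0 < L" and Lip: "\<And>t x x' y. 0 < t \<Longrightarrow>
      \<bar>cone_kernel c b t x y - cone_kernel c b t x' y\<bar> \<le> L / t ^ (?n + 1) * norm (x - x')"
    using cone_kernel_lipschitz[OF b, of c] by blast
  \<comment> \<open>The value that \<open>Lp_integral_norm_le\<close> gives on all of
    \<open>\<Omega>\<close> with \<open>s = 1\<close>.\<close>
  define A where "A = 1 + measure lebesgue \<Omega>"
  define C where "C = A * (1 / ?Z + L)"
  have A: "0 < A" by (simp add: A_def add_pos_nonneg)
  have bound: "\<bar>LINT y|lebesgue_on \<Omega>. u y * k y\<bar> \<le> A * M * K"
    if sb: "sobolev_bound p \<Omega> M u g" and k: "\<And>y. \<bar>k y\<bar> \<le> K" for u g M k K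
  proof -
    have u: "integrable (lebesgue_on \<Omega>) u" and uLp: "u \<in> Lp p \<Omega>" and M: "0 < M"
      and uM: "(LINT x|lebesgue_on \<Omega>. norm (u x) powr p) \<le> M powr p"
      using sb Lp_integrable[OF _ p lm] by (auto simp: sobolev_bound_def)
    have K: "0 \<le> K" using k[of undefined] by linarith
    have "(LINT x|lebesgue_on \<Omega>. \<bar>u x\<bar>) = (LINT x|lebesgue_on \<Omega>. indicator \<Omega> x * norm (u x))"
      by (rule Bochner_Integration.integral_cong) auto
    also have "\<dots> \<le> M * A"
      using Lp_integral_norm_le[OF uLp p _ M uM, of 1 \<Omega>] lm by (simp add: A_def fmeasurableD)
    finally have uA: "(LINT x|lebesgue_on \<Omega>. \<bar>u x\<bar>) \<le> M * A" .
    have "\<bar>LINT y|lebesgue_on \<Omega>. u y * k y\<bar> \<le> (LINT y|lebesgue_on \<Omega>. \<bar>u y * k y\<bar>)"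
      by (rule integral_abs_bound)
    also have "\<dots> \<le> (LINT y|lebesgue_on \<Omega>. \<bar>u y\<bar> * K)"
      using u k K by (intro integral_mono_AE' AE_I2) (auto simp: abs_mult intro!: mult_left_mono)
    also have "\<dots> \<le> M * A * K"
      using uA K u by (simp add: mult_right_mono)
    finally show ?thesis by (simp add: mult.commute)
  qed
  have "\<bar>cone_average c b \<Omega> u t x\<bar> \<le> C * M / t ^ ?n" (is ?P)
    and "\<bar>cone_average c b \<Omega> u t x - cone_average c b \<Omega> u t y\<bar> \<le> C * M / t ^ (?n + 1) * norm (x - y)" (is ?Q)
    if sb: "sobolev_bound p \<Omega> M u g" and t: "0 < t" for u g M x y t
  proof -
    have M: "0 < M" using sb by (simp add: sobolev_bound_def)
    have u: "integrable (lebesgue_on \<Omega>) u"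
      using sb Lp_integrable[OF _ p lm] by (auto simp: sobolev_bound_def)
    have kb: "\<bar>cone_kernel c b t x y\<bar> \<le> 1 / (?Z * t ^ ?n)" for x y
      using cone_kernel_le[OF b t, of c x y] cone_kernel_nonneg[OF b t, of c x y] by simp
    have "\<bar>cone_average c b \<Omega> u t x\<bar> \<le> A * M * (1 / (?Z * t ^ ?n))"
      unfolding cone_average_def by (rule bound[OF sb kb])
    also have "\<dots> = A * (1 / ?Z) * (M / t ^ ?n)" by simp
    also have "\<dots> \<le> C * (M / t ^ ?n)"
      unfolding C_def using A L M t by (intro mult_right_mono mult_left_mono) auto
    finally show ?P by simp
    have int: "integrable (lebesgue_on \<Omega>) (\<lambda>y. u y * cone_kernel c b t x y)" for x
      by (rule integrable_mult_bounded_continuous[OF u continuous_on_cone_kernel kb])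
    have "cone_average c b \<Omega> u t x - cone_average c b \<Omega> u t y
        = (LINT w|lebesgue_on \<Omega>. u w * (cone_kernel c b t x w - cone_kernel c b t y w))"
      unfolding cone_average_def using int by (simp add: right_diff_distrib)
    then have "\<bar>cone_average c b \<Omega> u t x - cone_average c b \<Omega> u t y\<bar>
        \<le> A * M * (L / t ^ (?n + 1) * norm (x - y))"
      using bound[OF sb Lip[OF t]] by simp
    also have "\<dots> = A * L * (M / t ^ (?n + 1) * norm (x - y))" by simp
    also have "\<dots> \<le> C * (M / t ^ (?n + 1) * norm (x - y))"
      unfolding C_def using A Z M t
      by (intro mult_right_mono mult_left_mono mult_nonneg_nonneg) auto
    finally show ?Q by simp
  qed
  moreover have "0 < C"
    unfolding C_def using A Z L by (intro mult_pos_pos add_pos_pos) auto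
  ultimately show ?thesis by blast
qed

section \<open>Limits of the averages as the scale tends to zero\<close>

lemma cone_average_near_limit:
  fixes \<Omega> :: "'a::euclidean_space set"
  assumes \<Omega>: "open \<Omega>" "bounded \<Omega>" and p: "1 < p" "real DIM('a) < p" and b: "0 < b"
  shows "\<exists>C>0. \<forall>u g M x T t v. sobolev_bound p \<Omega> M u g \<and> cone_fits \<Omega> c b T x \<and> 0 < t \<and> t \<le> T \<and>
      ((\<lambda>t. cone_average c b \<Omega> u t x) \<longlongrightarrow> v) (at_right 0) \<longrightarrow>
      \<bar>cone_average c b \<Omega> u t x - v\<bar> \<le> C * M * t powr (1 - DIM('a) / p)"
proof -
  obtain C where C: "0 < C" and D: "\<And>u g M x T s t. sobolev_bound p \<Omega> M u g \<Longrightarrow>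
      cone_fits \<Omega> c b T x \<Longrightarrow> 0 < s \<Longrightarrow> s \<le> t \<Longrightarrow> t \<le> T \<Longrightarrow>
      \<bar>cone_average c b \<Omega> u t x - cone_average c b \<Omega> u s x\<bar> \<le> C * M * t powr (1 - DIM('a) / p)"
    using cone_average_diff[OF \<Omega> p b, of c] by blast
  have "\<bar>cone_average c b \<Omega> u t x - v\<bar> \<le> C * M * t powr (1 - DIM('a) / p)"
    if sb: "sobolev_bound p \<Omega> M u g" and fit: "cone_fits \<Omega> c b T x" and t: "0 < t" "t \<le> T"
      and lim: "((\<lambda>t. cone_average c b \<Omega> u t x) \<longlongrightarrow> v) (at_right 0)" for u g M x T t v
  proof (rule tendsto_upperbound)
    show "((\<lambda>s. \<bar>cone_average c b \<Omega> u t x - cone_average c b \<Omega> u s x\<bar>) \<longlongrightarrow>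
        \<bar>cone_average c b \<Omega> u t x - v\<bar>) (at_right 0)"
      by (intro tendsto_intros lim)
    show "\<forall>\<^sub>F s in at_right 0. \<bar>cone_average c b \<Omega> u t x - cone_average c b \<Omega> u s x\<bar>
        \<le> C * M * t powr (1 - DIM('a) / p)"
      unfolding eventually_at_right_field
      by (rule exI[of _ t]) (use t D[OF sb fit] in auto)
  qed simp
  with C show ?thesis by blast
qed

text \<open>The increment bound depends on the larger scale alone and tends to 0 with it, so the
  averages are Cauchy. The limit exists at every apex whose cone fits, rather than almost
  everywhere; this makes it a candidate for the continuous version.\<close>

lemma cone_average_convergent:
  fixes \<Omega> :: "'a::euclidean_space set"
  assumes \<Omega>: "open \<Omega>" "bounded \<Omega>" and p: "1 < p" "real DIM('a) < p" and b: "0 < b"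
    and sb: "sobolev_bound p \<Omega> M u g" and T: "0 < T" and fit: "cone_fits \<Omega> c b T x"
  shows "\<exists>v. ((\<lambda>t. cone_average c b \<Omega> u t x) \<longlongrightarrow> v) (at_right 0)"
proof -
  let ?F = "\<lambda>t. cone_average c b \<Omega> u t x" and ?\<alpha> = "1 - DIM('a) / p"
  have \<alpha>: "0 < ?\<alpha>" using p by simp
  obtain C where C: "0 < C" and D: "\<And>s t. 0 < s \<Longrightarrow> s \<le> t \<Longrightarrow> t \<le> T \<Longrightarrow>
      \<bar>?F t - ?F s\<bar> \<le> C * M * t powr ?\<alpha>"
    using cone_average_diff[OF \<Omega> p b, of c] sb fit by blast
  have pow0: "((\<lambda>t. C * M * t powr ?\<alpha>) \<longlongrightarrow> 0) (at_right 0)"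
    using \<alpha> by (intro tendsto_mult_right_zero tendsto_zero_powrI[where b = ?\<alpha>])
               (auto intro: tendsto_ident_at eventually_at_right_less eventually_mono)
  have "cauchy_filter (filtermap ?F (at_right 0))"
    unfolding cauchy_filter_metric_filtermap
  proof (intro allI impI)
    fix e :: real assume "0 < e"
    then have "\<forall>\<^sub>F t in at_right 0. C * M * t powr ?\<alpha> < e"
      using order_tendstoD(2)[OF pow0] by blast
    then obtain d where d: "0 < d" "\<And>t. 0 < t \<Longrightarrow> t < d \<Longrightarrow> C * M * t powr ?\<alpha> < e"
      by (auto simp: eventually_at_right_field)
    let ?P = "\<lambda>t. 0 < t \<and> t < d \<and> t \<le> T"
    have "dist (?F s) (?F t) < e" if "?P s" "?P t" "s \<le> t" for s t
      using D[of s t] d(2)[of t] that by (simp add: dist_real_def abs_minus_commute)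
    then have "dist (?F s) (?F t) < e" if "?P s" "?P t" for s t
      using that by (metis dist_commute nle_le)
    moreover have "eventually ?P (at_right 0)"
      unfolding eventually_at_right_field by (rule exI[of _ "min d T"]) (use d T in auto)
    ultimately show "\<exists>P. eventually P (at_right 0) \<and> (\<forall>s t. P s \<and> P t \<longrightarrow> dist (?F s) (?F t) < e)"
      by (intro exI[of _ ?P]) auto
  qed
  then show ?thesis
    using cauchy_filter_convergent[of "filtermap ?F (at_right 0)"]
    by (auto simp: convergent_filter.simps filterlim_def)
qed

text \<open>Both limits are compared with averages at a common scale, and these averages are
  Lipschitz in the apex. \<open>\<delta>\<close> is independent of the function, of \<open>M\<close>
  and of the two points, which is the equicontinuity needed later.\<close>

lemma cone_average_modulus:
  fixes \<Omega> :: "'a::euclidean_space set"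
  assumes \<Omega>: "open \<Omega>" "bounded \<Omega>" and p: "1 < p" "real DIM('a) < p" and b: "0 < b"
    and T: "0 < T" and \<eta>: "0 < \<eta>"
  shows "\<exists>\<delta>>0. \<forall>u g M x y v w. sobolev_bound p \<Omega> M u g \<and> cone_fits \<Omega> c b T x \<and> cone_fits \<Omega> c b T y \<and>
      ((\<lambda>t. cone_average c b \<Omega> u t x) \<longlongrightarrow> v) (at_right 0) \<and>
      ((\<lambda>t. cone_average c b \<Omega> u t y) \<longlongrightarrow> w) (at_right 0) \<and> norm (x - y) < \<delta> \<longrightarrow>
      \<bar>v - w\<bar> \<le> \<eta> * M"
proof -
  let ?\<alpha> = "1 - DIM('a) / p" and ?A = "\<lambda>u t x. cone_average c b \<Omega> u t x"
  have \<alpha>: "0 < ?\<alpha>" using p by simp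
  obtain C where C: "0 < C" and D: "\<And>u g M x T t v. sobolev_bound p \<Omega> M u g \<Longrightarrow>
      cone_fits \<Omega> c b T x \<Longrightarrow> 0 < t \<Longrightarrow> t \<le> T \<Longrightarrow> ((\<lambda>t. ?A u t x) \<longlongrightarrow> v) (at_right 0) \<Longrightarrow>
      \<bar>?A u t x - v\<bar> \<le> C * M * t powr ?\<alpha>"
    using cone_average_near_limit[OF \<Omega> p b, of c] by blast
  obtain C' where C': "0 < C'" and E: "\<And>u g M x y t. sobolev_bound p \<Omega> M u g \<Longrightarrow> 0 < t \<Longrightarrow>
      \<bar>?A u t x - ?A u t y\<bar> \<le> C' * M / t ^ (DIM('a) + 1) * norm (x - y)"
    using cone_average_bounds[OF \<Omega> p(1) b, of c] by blast
  \<comment> \<open>Chosen so that passing from an average to its limit costs at most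
    \<open>\<eta> / 3 * M\<close>. Then \<open>\<delta>\<close> compensates the blow-up of the
    Lipschitz bound at this one scale.\<close>
  define t where "t = min T ((\<eta> / (3 * C)) powr (1 / ?\<alpha>))"
  have t: "0 < t" "t \<le> T" using T C \<eta> by (auto simp: t_def)
  have "t powr ?\<alpha> \<le> ((\<eta> / (3 * C)) powr (1 / ?\<alpha>)) powr ?\<alpha>"
    using t \<alpha> by (intro powr_mono2) (auto simp: t_def)
  also have "\<dots> = \<eta> / (3 * C)"
    using C \<eta> by (simp add: powr_powr less_imp_neq[THEN not_sym, OF p(2)])
  finally have Ct: "C * t powr ?\<alpha> \<le> \<eta> / 3"
    using C by (simp add: field_simps)
  define \<delta> where "\<delta> = \<eta> / 3 * t ^ (DIM('a) + 1) / C'"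
  have "\<bar>v - w\<bar> \<le> \<eta> * M"
    if sb: "sobolev_bound p \<Omega> M u g" and fit: "cone_fits \<Omega> c b T x" "cone_fits \<Omega> c b T y"
      and lim: "((\<lambda>t. ?A u t x) \<longlongrightarrow> v) (at_right 0)" "((\<lambda>t. ?A u t y) \<longlongrightarrow> w) (at_right 0)"
      and xy: "norm (x - y) < \<delta>" for u g M x y v w
  proof -
    have M: "0 < M" using sb by (simp add: sobolev_bound_def)
    have "C * t powr ?\<alpha> * M \<le> \<eta> / 3 * M"
      using Ct M by (intro mult_right_mono) auto
    then have "\<bar>?A u t x - v\<bar> \<le> \<eta> / 3 * M" "\<bar>?A u t y - w\<bar> \<le> \<eta> / 3 * M"
      using D[OF sb fit(1) t lim(1)] D[OF sb fit(2) t lim(2)] by (auto simp: mult_ac)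
    moreover have "\<bar>?A u t x - ?A u t y\<bar> \<le> \<eta> / 3 * M"
    proof -
      have "\<bar>?A u t x - ?A u t y\<bar> \<le> C' * M / t ^ (DIM('a) + 1) * norm (x - y)"
        by (rule E[OF sb t(1)])
      also have "\<dots> \<le> C' * M / t ^ (DIM('a) + 1) * \<delta>"
        using xy C' M t by (intro mult_left_mono) auto
      also have "\<dots> = \<eta> / 3 * M"
        using C' t by (simp add: \<delta>_def)
      finally show ?thesis .
    qed
    moreover have "\<eta> * M = \<eta> / 3 * M + \<eta> / 3 * M + \<eta> / 3 * M" by simp
    ultimately show ?thesis by linarith
  qed
  moreover have "0 < \<delta>" using \<eta> t C' by (simp add: \<delta>_def)
  ultimately show ?thesis by blast
qed

text \<open>The average at the largest scale \<open>T\<close> is bounded by the integral norm, and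
  the limit differs from it by the increment bound.\<close>

lemma cone_average_limit_bounded:
  fixes \<Omega> :: "'a::euclidean_space set"
  assumes \<Omega>: "open \<Omega>" "bounded \<Omega>" and p: "1 < p" "real DIM('a) < p" and b: "0 < b" and T: "0 < T"
  shows "\<exists>C>0. \<forall>u g M x v. sobolev_bound p \<Omega> M u g \<and> cone_fits \<Omega> c b T x \<and>
      ((\<lambda>t. cone_average c b \<Omega> u t x) \<longlongrightarrow> v) (at_right 0) \<longrightarrow> \<bar>v\<bar> \<le> C * M"
proof -
  let ?\<alpha> = "1 - DIM('a) / p" and ?A = "\<lambda>u t x. cone_average c b \<Omega> u t x"
  obtain C where C: "0 < C" and D: "\<And>u g M x t v. sobolev_bound p \<Omega> M u g \<Longrightarrow>
      cone_fits \<Omega> c b T x \<Longrightarrow> ((\<lambda>t. ?A u t x) \<longlongrightarrow> v) (at_right 0) \<Longrightarrow>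
      \<bar>?A u T x - v\<bar> \<le> C * M * T powr ?\<alpha>"
    using cone_average_near_limit[OF \<Omega> p b, of c] T by blast
  obtain C' where C': "0 < C'" and E: "\<And>u g M x. sobolev_bound p \<Omega> M u g \<Longrightarrow>
      \<bar>?A u T x\<bar> \<le> C' * M / T ^ DIM('a)"
    using cone_average_bounds[OF \<Omega> p(1) b, of c] T by blast
  have "\<bar>v\<bar> \<le> (C * T powr ?\<alpha> + C' / T ^ DIM('a)) * M"
    if "sobolev_bound p \<Omega> M u g" "cone_fits \<Omega> c b T x"
      "((\<lambda>t. ?A u t x) \<longlongrightarrow> v) (at_right 0)" for u g M x v
    using D[OF that] E[OF that(1), of x] by (simp add: algebra_simps abs_le_iff)
  moreover have "0 < C * T powr ?\<alpha> + C' / T ^ DIM('a)"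
    using C C' T by (intro add_pos_pos) auto
  ultimately show ?thesis by blast
qed

section \<open>Cones inside the domain and identification of the limit with the function\<close>

lemma cone_fits_interior:
  fixes \<Omega> :: "'a::euclidean_space set"
  assumes "open \<Omega>" "z \<in> \<Omega>" "0 \<le> b"
  shows "\<exists>r>0. \<exists>T>0. \<forall>x\<in>ball z r. cone_fits \<Omega> c b T x"
proof -
  obtain e where e: "0 < e" "ball z e \<subseteq> \<Omega>"
    using assms open_contains_ball by blast
  \<comment> \<open>At parameter \<open>t\<close> the cone reaches at most
    \<open>t * (norm c + b)\<close> from its apex; the added 1 keeps the divisor positive even if
    \<open>c\<close> and \<open>b\<close> vanish.\<close>
  let ?k = "norm c + b + 1"
  define T where "T = (e / 2) / ?k"
  have k: "0 < ?k" using assms(3) by (simp add: add_nonneg_pos)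
  have T: "0 < T" using e k by (simp add: T_def)
  have "cone_fits \<Omega> c b T x" if x: "x \<in> ball z (e / 2)" for x
    unfolding cone_fits_def
  proof (intro allI impI subsetI)
    fix t y assume t: "0 < t \<and> t \<le> T" and y: "y \<in> cball (x + t *\<^sub>R c) (t * b)"
    have "dist z y \<le> dist z x + dist x (x + t *\<^sub>R c) + dist (x + t *\<^sub>R c) y"
      using dist_triangle[of z y x] dist_triangle[of x y "x + t *\<^sub>R c"] by linarith
    also have "\<dots> \<le> dist z x + t * (norm c + b)"
      using y t by (simp add: dist_norm algebra_simps)
    also have "t * (norm c + b) \<le> T * ?k"
      using t k T assms(3) by (intro mult_mono) auto
    also have "T * ?k = e / 2"
      using k by (intro nonzero_eq_divide_eq[THEN iffD1]) (auto simp: T_def)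
    finally have "dist z y < e"
      using x by simp
    then show "y \<in> \<Omega>" using e by auto
  qed
  then show ?thesis using e T by (intro exI[of _ "e / 2"] conjI exI[of _ T]) auto
qed

lemma cone_fitsD: "cone_fits \<Omega> c b T x \<Longrightarrow> 0 < t \<Longrightarrow> t \<le> T \<Longrightarrow> cball (x + t *\<^sub>R c) (t * b) \<subseteq> \<Omega>"
  by (simp add: cone_fits_def)

text \<open>The kernel is nonnegative with integral one over \<open>\<Omega>\<close>, so the
  constant \<open>q\<close> can be moved inside the average.\<close>

lemma cone_average_minus_const:
  fixes \<Omega> :: "'a::euclidean_space set"
  assumes u: "integrable (lebesgue_on \<Omega>) u" and \<Omega>: "\<Omega> \<in> sets lebesgue"
    and b: "0 < b" and t: "0 < t" and fit: "cball (x + t *\<^sub>R c) (t * b) \<subseteq> \<Omega>"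
  shows "\<bar>cone_average c b \<Omega> u t x - q\<bar> \<le> (LINT y|lebesgue_on \<Omega>. \<bar>u y - q\<bar> * cone_kernel c b t x y)"
    and "integrable (lebesgue_on \<Omega>) (\<lambda>y. \<bar>u y - q\<bar> * cone_kernel c b t x y)"
proof -
  note K = integral_cone_kernel_on[OF b t \<Omega> fit]
  have kb: "\<bar>cone_kernel c b t x y\<bar> \<le> 1 / (bump_mass c b * t ^ DIM('a))" for y
    using cone_kernel_le[OF b t, of c x y] cone_kernel_nonneg[OF b t, of c x y] by simp
  have uK: "integrable (lebesgue_on \<Omega>) (\<lambda>y. u y * cone_kernel c b t x y)"
    by (rule integrable_mult_bounded_continuous[OF u continuous_on_cone_kernel kb])
  have i: "integrable (lebesgue_on \<Omega>) (\<lambda>y. (u y - q) * cone_kernel c b t x y)"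
    using uK K(1) by (simp add: left_diff_distrib)
  have e: "\<bar>(u y - q) * cone_kernel c b t x y\<bar> = \<bar>u y - q\<bar> * cone_kernel c b t x y" for y
    using cone_kernel_nonneg[OF b t, of c x y] by (simp add: abs_mult)
  show "integrable (lebesgue_on \<Omega>) (\<lambda>y. \<bar>u y - q\<bar> * cone_kernel c b t x y)"
    using integrable_abs[OF i] by (simp only: e)
  have "cone_average c b \<Omega> u t x - q = (LINT y|lebesgue_on \<Omega>. (u y - q) * cone_kernel c b t x y)"
    using uK K by (simp add: cone_average_def left_diff_distrib)
  then show "\<bar>cone_average c b \<Omega> u t x - q\<bar> \<le> (LINT y|lebesgue_on \<Omega>. \<bar>u y - q\<bar> * cone_kernel c b t x y)"
    using integral_abs_bound[of "lebesgue_on \<Omega>" "\<lambda>y. (u y - q) * cone_kernel c b t x y"]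
    by (simp only: e)
qed

text \<open>The kernels form an approximate identity: at scale \<open>t\<close> the support lies
  within \<open>t * (norm c + b)\<close> of \<open>x\<close>. Through this lemma the estimates for
  limits of averages apply to any continuous version \<open>v\<close> of \<open>u\<close>.\<close>

lemma cone_average_tendsto:
  fixes \<Omega> :: "'a::euclidean_space set"
  assumes \<Omega>: "open \<Omega>" and u: "integrable (lebesgue_on \<Omega>) u"
    and v: "continuous_on \<Omega> v" "AE x in lebesgue_on \<Omega>. v x = u x"
    and x: "x \<in> \<Omega>" and b: "0 < b" and T: "0 < T" "cone_fits \<Omega> c b T x"
  shows "((\<lambda>t. cone_average c b \<Omega> u t x) \<longlongrightarrow> v x) (at_right 0)"
proof (rule tendstoI)
  fix e :: real assume e: "0 < e"
  obtain \<delta> where \<delta>: "0 < \<delta>" "\<And>y. y \<in> \<Omega> \<Longrightarrow> dist y x < \<delta> \<Longrightarrow> dist (v y) (v x) < e / 2"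
    using v(1) x e unfolding continuous_on_iff by (meson half_gt_zero)
  let ?k = "norm c + b"
  have k: "0 < ?k" using b by (simp add: add_nonneg_pos)
  have L: "\<Omega> \<in> sets lebesgue" using \<Omega> by (simp add: borel_open)
  have "dist (cone_average c b \<Omega> u t x) (v x) < e" if t: "0 < t" "t < min T (\<delta> / ?k)" for t
  proof -
    have fit: "cball (x + t *\<^sub>R c) (t * b) \<subseteq> \<Omega>"
      using cone_fitsD[OF T(2)] t by simp
    note K = integral_cone_kernel_on[OF b t(1) L fit]
    have pw: "\<bar>v y - v x\<bar> * cone_kernel c b t x y \<le> e / 2 * cone_kernel c b t x y" for y
    proof (cases "y \<in> ball (x + t *\<^sub>R c) (t * b)")
      case True
      have "dist y x \<le> dist y (x + t *\<^sub>R c) + dist (x + t *\<^sub>R c) x"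
        by (rule dist_triangle)
      also have "\<dots> < t * b + t * norm c"
        using True t by (intro add_less_le_mono) (auto simp: dist_commute dist_norm)
      also have "\<dots> \<le> \<delta>"
        using t k by (simp add: field_simps)
      finally have "\<bar>v y - v x\<bar> \<le> e / 2"
        using \<delta>(2)[of y] True fit ball_subset_cball by (force simp: dist_real_def)
      then show ?thesis
        using cone_kernel_nonneg[OF b t(1)] by (intro mult_right_mono)
    next
      case False
      then show ?thesis using cone_kernel_eq_0[OF b t(1) False] by simp
    qed
    have "\<bar>cone_average c b \<Omega> u t x - v x\<bar> \<le> (LINT y|lebesgue_on \<Omega>. \<bar>u y - v x\<bar> * cone_kernel c b t x y)"
      by (rule cone_average_minus_const(1)[OF u L b t(1) fit])
    also have "\<dots> \<le> (LINT y|lebesgue_on \<Omega>. e / 2 * cone_kernel c b t x y)"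
    proof (rule integral_mono_AE)
      show "AE y in lebesgue_on \<Omega>. \<bar>u y - v x\<bar> * cone_kernel c b t x y \<le> e / 2 * cone_kernel c b t x y"
        using v(2) by eventually_elim (use pw in metis)
    qed (use K cone_average_minus_const(2)[OF u L b t(1) fit] in auto)
    also have "\<dots> = e / 2" using K by simp
    finally show ?thesis using e by (simp add: dist_real_def)
  qed
  then show "\<forall>\<^sub>F t in at_right 0. dist (cone_average c b \<Omega> u t x) (v x) < e"
    unfolding eventually_at_right_field
    using T \<delta> k by (intro exI[of _ "min T (\<delta> / ?k)"]) auto
qed

section \<open>Continuity and equicontinuity up to the boundary\<close>

lemma sobolev_continuous_interior:
  fixes \<Omega> :: "'a::euclidean_space set"
  assumes \<Omega>: "open \<Omega>" "bounded \<Omega>" and p: "1 < p" "real DIM('a) < p"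
    and sb: "sobolev_bound p \<Omega> M u g"
  shows "\<exists>v. continuous_on \<Omega> v \<and> (AE x in lebesgue_on \<Omega>. v x = u x)"
proof -
  \<comment> \<open>With this choice the kernel at scale \<open>t\<close> lives in the cube \<open>cbox x (x + t *\<^sub>R One)\<close>, the shape for
    which the library has the Lebesgue differentiation theorem. Applying that theorem to all \<open>\<bar>u - q\<bar>\<close>
    with \<open>q\<close> rational identifies the limit of the averages with \<open>u\<close> almost everywhere.\<close>
  define c :: 'a where "c = (1/2) *\<^sub>R One"
  define b :: real where "b = 1/4"
  let ?F = "\<lambda>t x. cone_average c b \<Omega> u t x" and ?n = "DIM('a)" and ?Z = "bump_mass c b"
  have b: "0 < b" by (simp add: b_def)
  have Z: "0 < ?Z" by (rule bump_mass_pos[OF b])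
  have M: "0 < M" using sb by (simp add: sobolev_bound_def)
  have lm: "\<Omega> \<in> lmeasurable" using \<Omega> by (simp add: lmeasurable_open)
  then have L: "\<Omega> \<in> sets lebesgue" by (rule fmeasurableD)
  have u: "integrable (lebesgue_on \<Omega>) u"
    using sb Lp_integrable[OF _ p(1) lm] by (auto simp: sobolev_bound_def)
  define v where "v x = (SOME l. ((\<lambda>t. ?F t x) \<longlongrightarrow> l) (at_right 0))" for x
  have local: "\<exists>r>0. \<exists>T>0. \<forall>x\<in>ball z r. cone_fits \<Omega> c b T x" if "z \<in> \<Omega>" for z
    using cone_fits_interior[OF \<Omega>(1) that] b by simp
  have lim: "((\<lambda>t. ?F t x) \<longlongrightarrow> v x) (at_right 0)" if T: "0 < T" "cone_fits \<Omega> c b T x" for T x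
    unfolding v_def using cone_average_convergent[OF \<Omega> p b sb T] by (rule someI_ex)
  have "continuous_on \<Omega> v"
    unfolding continuous_on_iff
  proof (intro ballI allI impI)
    fix x e :: real and z assume z: "z \<in> \<Omega>" and e: "0 < (e::real)"
    obtain r T where r: "0 < r" "0 < T" "\<And>x. x \<in> ball z r \<Longrightarrow> cone_fits \<Omega> c b T x"
      using local[OF z] by blast
    obtain \<delta> where \<delta>: "0 < \<delta>" "\<And>x y l m. cone_fits \<Omega> c b T x \<Longrightarrow> cone_fits \<Omega> c b T y \<Longrightarrow>
        ((\<lambda>t. ?F t x) \<longlongrightarrow> l) (at_right 0) \<Longrightarrow> ((\<lambda>t. ?F t y) \<longlongrightarrow> m) (at_right 0) \<Longrightarrow>
        norm (x - y) < \<delta> \<Longrightarrow> \<bar>l - m\<bar> \<le> e / (2 * M) * M"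
      using cone_average_modulus[OF \<Omega> p b r(2), of "e / (2 * M)" c] sb e M
      by (auto 0 3 simp del: times_divide_eq_left)
    have "dist (v y) (v z) < e" if y: "dist y z < min r \<delta>" for y
    proof -
      have f: "cone_fits \<Omega> c b T y" "cone_fits \<Omega> c b T z"
        using y r by (auto simp: dist_commute)
      have "\<bar>v y - v z\<bar> \<le> e / (2 * M) * M"
        by (rule \<delta>(2)[OF f lim[OF r(2) f(1)] lim[OF r(2) f(2)]]) (use y in \<open>simp add: dist_norm\<close>)
      then show ?thesis using e M by (simp add: dist_real_def)
    qed
    then show "\<exists>d>0. \<forall>y\<in>\<Omega>. dist y z < d \<longrightarrow> dist (v y) (v z) < e"
      using r \<delta> by (intro exI[of _ "min r \<delta>"]) auto
  qed
  moreover have "AE x in lebesgue_on \<Omega>. v x = u x"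
  proof -
    define f where "f q x = (if x \<in> \<Omega> then \<bar>u x - q\<bar> else 0)" for q x
    have f_int: "integrable lebesgue (f q)" for q
    proof -
      have "integrable (lebesgue_on \<Omega>) (\<lambda>x. q)"
        using lm by (subst integrable_restrict_space)
          (auto simp: lmeasurable_iff_integrable[symmetric] fmeasurableD intro!: integrable_mult_left)
      then have "integrable (lebesgue_on \<Omega>) (\<lambda>x. \<bar>u x - q\<bar>)"
        using u by simp
      then have "integrable lebesgue (\<lambda>x. indicator \<Omega> x *\<^sub>R \<bar>u x - q\<bar>)"
        using L by (subst (asm) integrable_restrict_space) auto
      also have "(\<lambda>x. indicator \<Omega> x *\<^sub>R \<bar>u x - q\<bar>) = f q"
        by (auto simp: f_def)
      finally show ?thesis .
    qed
    have f_box: "integrable (lebesgue_on (cbox a a')) (f q)" for a a' q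
      by (subst integrable_restrict_space) (auto intro!: integrable_mult_indicator f_int simp del: real_scaleR_def)
    have f_hk: "f q integrable_on cbox a a'" for a a' q
      by (rule integrable_on_lebesgue_on[OF f_box]) auto
    have "\<exists>N. negligible N \<and> (\<forall>x e. x \<notin> N \<longrightarrow> 0 < e \<longrightarrow> (\<exists>d>0. \<forall>h. 0 < h \<and> h < d \<longrightarrow>
        norm (integral (cbox x (x + h *\<^sub>R One)) (f q) /\<^sub>R h ^ ?n - f q x) < e))" for q
      by (rule integrable_ccontinuous_explicit[of "f q", OF f_hk]) blast
    then obtain N where N: "\<And>q. negligible (N q)"
      and Nlim: "\<And>q x e. x \<notin> N q \<Longrightarrow> 0 < e \<Longrightarrow> \<exists>d>0. \<forall>h. 0 < h \<and> h < d \<longrightarrow>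
        norm (integral (cbox x (x + h *\<^sub>R One)) (f q) /\<^sub>R h ^ ?n - f q x) < e"
      by metis
    have "v x = u x" if x: "x \<in> \<Omega>" "x \<notin> (\<Union>q\<in>\<rat>. N q)" for x
    proof -
      obtain T where T: "0 < T" "cone_fits \<Omega> c b T x"
        using local[OF x(1)] by (metis centre_in_ball)
      \<comment> \<open>The kernel is at most \<open>1 / (?Z * t ^ ?n)\<close> and vanishes outside
        a cube of volume \<open>t ^ ?n\<close>, so the kernel average of
        \<open>\<bar>u - q\<bar>\<close> is at most \<open>1 / ?Z\<close> times its mean over the
        cube. The factor does no harm because \<open>q\<close> may be taken arbitrarily close to
        \<open>u x\<close>.\<close>
      have le: "\<bar>v x - q\<bar> \<le> 1 / ?Z * \<bar>u x - q\<bar>" if q: "q \<in> \<rat>" for q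
      proof -
        let ?I = "\<lambda>t. integral (cbox x (x + t *\<^sub>R One)) (f q) /\<^sub>R t ^ ?n"
        have "x \<notin> N q" using x(2) q by blast
        then have "(?I \<longlongrightarrow> f q x) (at_right 0)"
        proof (intro tendstoI)
          fix e :: real assume "0 < e"
          then obtain d where "0 < d" "\<forall>h. 0 < h \<and> h < d \<longrightarrow> norm (?I h - f q x) < e"
            using Nlim[OF \<open>x \<notin> N q\<close>] by blast
          then show "\<forall>\<^sub>F t in at_right 0. dist (?I t) (f q x) < e"
            unfolding eventually_at_right_field dist_norm by (intro exI[of _ d]) auto
        qed
        then have I: "((\<lambda>t. 1 / ?Z * ?I t) \<longlongrightarrow> 1 / ?Z * f q x) (at_right 0)"
          by (rule tendsto_mult_left)
        have F: "((\<lambda>t. \<bar>?F t x - q\<bar>) \<longlongrightarrow> \<bar>v x - q\<bar>) (at_right 0)"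
          by (intro tendsto_intros lim[OF T])
        have "\<bar>?F t x - q\<bar> \<le> 1 / ?Z * ?I t" if t: "0 < t" "t \<le> T" for t
        proof -
          let ?B = "cbox x (x + t *\<^sub>R One)"
          have fit: "cball (x + t *\<^sub>R c) (t * b) \<subseteq> \<Omega>"
            using cone_fitsD[OF T(2) t] .
          have box: "y \<in> ?B" if y: "y \<in> ball (x + t *\<^sub>R c) (t * b)" for y
          proof -
            have "x \<bullet> i \<le> y \<bullet> i \<and> y \<bullet> i \<le> x \<bullet> i + t" if i: "i \<in> Basis" for i
            proof -
              have "\<bar>(y - (x + t *\<^sub>R c)) \<bullet> i\<bar> \<le> t * b"
                using Basis_le_norm[OF i, of "y - (x + t *\<^sub>R c)"] y
                by (simp add: dist_norm norm_minus_commute)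
              then have "\<bar>y \<bullet> i - (x \<bullet> i + t / 2)\<bar> \<le> t / 4"
                using i by (simp add: c_def b_def inner_diff_left inner_add_left)
              then show ?thesis using t unfolding abs_le_iff by linarith
            qed
            then show ?thesis by (simp add: mem_box inner_add_left)
          qed
          have "\<bar>?F t x - q\<bar> \<le> (LINT y|lebesgue_on \<Omega>. \<bar>u y - q\<bar> * cone_kernel c b t x y)"
            by (rule cone_average_minus_const(1)[OF u L b t(1) fit])
          also have "\<dots> = (LINT y|lebesgue. indicator \<Omega> y *\<^sub>R (\<bar>u y - q\<bar> * cone_kernel c b t x y))"
            using L by (subst integral_restrict_space) auto
          also have "\<dots> \<le> (LINT y|lebesgue. indicator ?B y *\<^sub>R f q y * (1 / (?Z * t ^ ?n)))"
          proof (rule integral_mono_AE')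
            show "integrable lebesgue (\<lambda>y. indicator ?B y *\<^sub>R f q y * (1 / (?Z * t ^ ?n)))"
              by (intro integrable_mult_left integrable_mult_indicator f_int) auto
            have "indicator \<Omega> y *\<^sub>R (\<bar>u y - q\<bar> * cone_kernel c b t x y)
                \<le> indicator ?B y *\<^sub>R f q y * (1 / (?Z * t ^ ?n))" for y
            proof (cases "y \<in> ball (x + t *\<^sub>R c) (t * b)")
              case True
              then have "y \<in> \<Omega>" "y \<in> ?B" using box fit ball_subset_cball by blast+
              then show ?thesis
                using cone_kernel_le[OF b t(1), of c x y]
                by (simp add: f_def del: times_divide_eq_right mult_1_right) (intro mult_left_mono; simp)
            next
              case False
              then have "cone_kernel c b t x y = 0" by (rule cone_kernel_eq_0[OF b t(1)])
              then show ?thesis using Z t by (simp add: f_def indicator_def)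
            qed
            then show "AE y in lebesgue. indicator \<Omega> y *\<^sub>R (\<bar>u y - q\<bar> * cone_kernel c b t x y)
                \<le> indicator ?B y *\<^sub>R f q y * (1 / (?Z * t ^ ?n))" by simp
            show "AE y in lebesgue. 0 \<le> indicator ?B y *\<^sub>R f q y * (1 / (?Z * t ^ ?n))"
              using Z t by (intro AE_I2) (auto simp: f_def indicator_def)
          qed
          also have "\<dots> = (LINT y|lebesgue_on ?B. f q y) * (1 / (?Z * t ^ ?n))"
            by (subst integral_restrict_space) auto
          also have "(LINT y|lebesgue_on ?B. f q y) = integral ?B (f q)"
            by (rule lebesgue_integral_eq_integral[OF f_box]) auto
          finally show ?thesis by (simp add: field_simps)
        qed
        then have "\<forall>\<^sub>F t in at_right 0. \<bar>?F t x - q\<bar> \<le> 1 / ?Z * ?I t"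
          unfolding eventually_at_right_field using T by (intro exI[of _ T]) auto
        then have "\<bar>v x - q\<bar> \<le> 1 / ?Z * f q x"
          using tendsto_le[OF _ I F] by simp
        then show ?thesis using x by (simp add: f_def)
      qed
      have "\<bar>v x - u x\<bar> \<le> 0 + e" if e: "0 < e" for e
      proof -
        let ?d = "e / (1 / ?Z + 1)"
        have d: "0 < ?d" using e Z by (simp add: add_pos_pos)
        obtain q where q: "q \<in> \<rat>" "u x < q" "q < u x + ?d"
          using Rats_dense_in_real[of "u x" "u x + ?d"] d by auto
        have "\<bar>v x - u x\<bar> \<le> \<bar>v x - q\<bar> + \<bar>u x - q\<bar>" by linarith
        also have "\<dots> \<le> (1 / ?Z + 1) * \<bar>u x - q\<bar>"
          using le[OF q(1)] by (simp add: algebra_simps)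
        also have "\<dots> \<le> (1 / ?Z + 1) * ?d"
          using q Z by (intro mult_left_mono) (auto simp: add_nonneg_nonneg)
        also have "\<dots> = e"
        proof -
          have "1 / ?Z + 1 \<noteq> 0" using Z by (simp add: add_pos_pos less_imp_neq[THEN not_sym])
          then show ?thesis by simp
        qed
        finally show ?thesis by simp
      qed
      then have "\<bar>v x - u x\<bar> \<le> 0" by (rule field_le_epsilon)
      then show ?thesis by simp
    qed
    moreover have "(\<Union>q\<in>\<rat>. N q) \<in> null_sets lebesgue"
      using N by (intro null_sets_UN' countable_rat) (auto simp: negligible_iff_null_sets)
    ultimately have "AE x in lebesgue. x \<in> \<Omega> \<longrightarrow> v x = u x"
      by (intro AE_I') auto
    then show ?thesis
      using L by (subst AE_restrict_space_iff) auto
  qed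
  ultimately show ?thesis by blast
qed

section \<open>Boundary graphs and the interior cone condition\<close>

lemma norm_orthogonal_projection_le:
  fixes x \<nu> :: "'a::euclidean_space"
  assumes "norm \<nu> = 1"
  shows "norm (x - (x \<bullet> \<nu>) *\<^sub>R \<nu>) \<le> norm x"
proof -
  have "(norm (x - (x \<bullet> \<nu>) *\<^sub>R \<nu>))\<^sup>2 = (norm x)\<^sup>2 - (x \<bullet> \<nu>)\<^sup>2"
    using assms
    by (simp only: power2_norm_eq_inner inner_diff_left inner_diff_right inner_scaleR_left
        inner_scaleR_right norm_eq_1) (simp add: power2_eq_square inner_commute)
  then have "(norm (x - (x \<bullet> \<nu>) *\<^sub>R \<nu>))\<^sup>2 \<le> (norm x)\<^sup>2" by simp
  then show ?thesis by (rule power2_le_imp_le) simp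
qed

text \<open>The Hoelder condition compares the gradient with its value at 0 and thereby bounds it on
  each ball; the mean value inequality on the convex ball does the rest. The absolute values cover
  negative \<open>K\<close> and \<open>R\<close>.\<close>

lemma C1_holder_lipschitz:
  fixes \<gamma> :: "'a::euclidean_space \<Rightarrow> real"
  assumes "C1_holder \<epsilon> \<gamma>" "0 \<le> \<epsilon>"
  shows "\<exists>L\<ge>0. \<forall>x\<in>cball 0 R. \<forall>y\<in>cball 0 R. \<bar>\<gamma> x - \<gamma> y\<bar> \<le> L * norm (x - y)"
proof -
  obtain G K where G: "\<And>x. GDERIV \<gamma> x :> G x"
    and K: "\<And>x y. norm (G x - G y) \<le> K * dist x y powr \<epsilon>"
    using assms by (auto simp: C1_holder_def)
  define L where "L = norm (G 0) + \<bar>K\<bar> * \<bar>R\<bar> powr \<epsilon>"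
  have GL: "norm (G x) \<le> L" if "x \<in> cball 0 R" for x
  proof -
    have "norm (G x) \<le> norm (G 0) + norm (G x - G 0)"
      using norm_triangle_ineq[of "G 0" "G x - G 0"] by simp
    also have "norm (G x - G 0) \<le> \<bar>K\<bar> * dist x 0 powr \<epsilon>"
      using K[of x 0] by (rule order_trans) (intro mult_right_mono; simp)
    also have "\<dots> \<le> \<bar>K\<bar> * \<bar>R\<bar> powr \<epsilon>"
      using that assms(2) by (intro mult_left_mono powr_mono2) auto
    finally show ?thesis by (simp add: L_def)
  qed
  have "norm (\<gamma> x - \<gamma> y) \<le> L * norm (x - y)" if "x \<in> cball 0 R" "y \<in> cball 0 R" for x y
  proof (rule differentiable_bound[of "cball 0 R" \<gamma> "\<lambda>x h. h \<bullet> G x"])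
    fix x assume x: "x \<in> cball (0 :: 'a) R"
    show "(\<gamma> has_derivative (\<lambda>h. h \<bullet> G x)) (at x within cball 0 R)"
      using G[of x] by (auto simp: gderiv_def intro: has_derivative_at_withinI)
    show "onorm (\<lambda>h. h \<bullet> G x) \<le> L"
    proof (rule onorm_bound)
      show "0 \<le> L" by (simp add: L_def)
      show "norm (h \<bullet> G x) \<le> L * norm h" for h
        using Cauchy_Schwarz_ineq2[of h "G x"] mult_left_mono[OF GL[OF x], of "norm h"]
        by (simp add: mult.commute)
    qed
  qed (use that in auto)
  then show ?thesis
    by (intro exI[of _ L]) (auto simp: L_def)
qed

text \<open>
  \<open>h\<close> is the signed height over the boundary graph in the direction \<open>\<nu>\<close>; the last inequality says that
  \<open>h x - x \<bullet> \<nu>\<close> depends Lipschitz-continuously on the component of \<open>x\<close> orthogonal to \<open>\<nu>\<close> alone.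
\<close>

lemma C1_holder_boundary_chart:
  fixes \<Omega> :: "'a::euclidean_space set"
  assumes "C1_holder_boundary \<epsilon> \<Omega>" "0 \<le> \<epsilon>" and z: "z \<in> frontier \<Omega>"
  obtains r L \<nu> h where "0 < r" "0 \<le> L" "norm \<nu> = 1"
    "\<And>x. x \<in> ball z r \<Longrightarrow> x \<in> \<Omega> \<longleftrightarrow> 0 < h x"
    "\<And>x y. x \<in> ball z r \<Longrightarrow> y \<in> ball z r \<Longrightarrow> \<bar>h x - h y - (x - y) \<bullet> \<nu>\<bar> \<le> L * norm ((x - y) - ((x - y) \<bullet> \<nu>) *\<^sub>R \<nu>)"
proof -
  obtain r \<nu> \<gamma> where r: "0 < r" and \<nu>: "norm \<nu> = 1" and \<gamma>: "C1_holder \<epsilon> \<gamma>"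
    and eq: "\<And>x. x \<in> ball z r \<Longrightarrow> x \<in> \<Omega> \<longleftrightarrow> \<gamma> (x - (x \<bullet> \<nu>) *\<^sub>R \<nu>) < x \<bullet> \<nu>"
    using assms unfolding C1_holder_boundary_def by metis
  \<comment> \<open>Orthogonal projection does not increase the norm, so the projections of all
    points of \<open>ball z r\<close> lie in \<open>cball 0 R\<close>, where the Lipschitz constant
    of \<open>\<gamma>\<close> is taken.\<close>
  define R where "R = norm z + r"
  obtain L where L: "0 \<le> L" "\<And>x y. x \<in> cball 0 R \<Longrightarrow> y \<in> cball 0 R \<Longrightarrow> \<bar>\<gamma> x - \<gamma> y\<bar> \<le> L * norm (x - y)"
    using C1_holder_lipschitz[OF \<gamma> assms(2), of R] by blast
  let ?P = "\<lambda>x. x - (x \<bullet> \<nu>) *\<^sub>R \<nu>"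
  have PR: "?P x \<in> cball 0 R" if "x \<in> ball z r" for x
  proof -
    have "norm x \<le> norm z + norm (x - z)"
      using norm_triangle_ineq[of z "x - z"] by simp
    then show ?thesis
      using norm_orthogonal_projection_le[OF \<nu>, of x] that
      by (simp add: R_def dist_norm norm_minus_commute)
  qed
  let ?h = "\<lambda>x. x \<bullet> \<nu> - \<gamma> (?P x)"
  have "\<bar>?h x - ?h y - (x - y) \<bullet> \<nu>\<bar> \<le> L * norm (?P (x - y))"
    if "x \<in> ball z r" "y \<in> ball z r" for x y
  proof -
    have "?h x - ?h y - (x - y) \<bullet> \<nu> = - (\<gamma> (?P x) - \<gamma> (?P y))"
      by (simp add: inner_diff_left)
    moreover have "?P x - ?P y = ?P (x - y)"
      by (simp add: inner_diff_left scaleR_diff_left)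
    ultimately show ?thesis
      using L(2)[OF PR[OF that(1)] PR[OF that(2)]] by (simp only: abs_minus_cancel)
  qed
  then show thesis
    using that[of r L \<nu> ?h] r L \<nu> eq by auto
qed

lemma cone_condition:
  fixes \<Omega> :: "'a::euclidean_space set"
  assumes \<Omega>: "open \<Omega>" and bd: "C1_holder_boundary \<epsilon> \<Omega>" "0 \<le> \<epsilon>" and z: "z \<in> closure \<Omega>"
  shows "\<exists>r>0. \<exists>c b T. 0 < b \<and> 0 < T \<and> (\<forall>x\<in>\<Omega> \<inter> ball z r. cone_fits \<Omega> c b T x)"
proof (cases "z \<in> \<Omega>")
  case True
  then obtain r T where "0 < r" "0 < T" "\<forall>x\<in>ball z r. cone_fits \<Omega> 0 1 T x"
    using cone_fits_interior[OF \<Omega> True, of 1 0] by auto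
  then show ?thesis by (intro exI[of _ r] conjI exI[of _ "0 :: 'a"] exI[of _ "1 :: real"] exI[of _ T]) auto
next
  case False
  then have "z \<in> frontier \<Omega>"
    using z \<Omega> by (simp add: frontier_def interior_open)
  then obtain r L \<nu> h where r: "0 < r" and L: "0 \<le> L" and \<nu>: "norm \<nu> = 1"
    and h: "\<And>x. x \<in> ball z r \<Longrightarrow> x \<in> \<Omega> \<longleftrightarrow> 0 < h x"
    and lip: "\<And>x y. x \<in> ball z r \<Longrightarrow> y \<in> ball z r \<Longrightarrow>
      \<bar>h x - h y - (x - y) \<bullet> \<nu>\<bar> \<le> L * norm ((x - y) - ((x - y) \<bullet> \<nu>) *\<^sub>R \<nu>)"
    using C1_holder_boundary_chart[OF bd] by metis
  \<comment> \<open>A deviation of size \<open>t * b\<close> from the axis lowers the height by at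
    most \<open>t * b\<close> along \<open>\<nu>\<close> and by at most \<open>L * t * b\<close>
    through the graph. With this \<open>b\<close> the loss is at most \<open>t / 2\<close>, while
    moving along the axis gains \<open>t\<close>.\<close>
  define b where "b = 1 / (2 * (1 + L))"
  have b: "0 < b" "b \<le> 1" "b * (1 + L) = 1 / 2"
    using L by (auto simp: b_def field_simps)
  \<comment> \<open>Since \<open>b \<le> 1\<close>, the cone up to parameter \<open>r / 4\<close>
    stays within \<open>r / 2\<close> of its apex, so it does not leave the chart
    \<open>ball z r\<close>.\<close>
  have "cone_fits \<Omega> \<nu> b (r / 4) x" if x: "x \<in> \<Omega> \<inter> ball z (r / 2)" for x
    unfolding cone_fits_def
  proof (intro allI impI subsetI)
    fix t y assume t: "0 < t \<and> t \<le> r / 4" and y: "y \<in> cball (x + t *\<^sub>R \<nu>) (t * b)"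
    define d where "d = y - (x + t *\<^sub>R \<nu>)"
    have d: "norm d \<le> t * b"
      using y by (simp add: d_def dist_norm norm_minus_commute)
    have yx: "y - x = t *\<^sub>R \<nu> + d" by (simp add: d_def)
    have "norm (y - x) \<le> norm (t *\<^sub>R \<nu>) + norm d"
      unfolding yx by (rule norm_triangle_ineq)
    also have "\<dots> \<le> t + t * b" using d t \<nu> by simp
    also have "\<dots> \<le> t + t * 1" using b t by (intro add_left_mono mult_left_mono) auto
    finally have "norm (y - x) \<le> r / 2" using t by simp
    moreover have "dist z y \<le> dist z x + dist x y" by (rule dist_triangle)
    ultimately have yb: "y \<in> ball z r" and xb: "x \<in> ball z r"
      using x r by (auto simp: dist_norm norm_minus_commute)
    have \<nu>\<nu>: "\<nu> \<bullet> \<nu> = 1" using \<nu> by (simp add: norm_eq_1)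
    have "(y - x) - ((y - x) \<bullet> \<nu>) *\<^sub>R \<nu> = d - (d \<bullet> \<nu>) *\<^sub>R \<nu>"
      by (simp add: yx inner_add_left \<nu>\<nu> scaleR_add_left)
    then have "norm ((y - x) - ((y - x) \<bullet> \<nu>) *\<^sub>R \<nu>) \<le> t * b"
      using norm_orthogonal_projection_le[OF \<nu>, of d] d by simp
    then have "\<bar>h y - h x - (y - x) \<bullet> \<nu>\<bar> \<le> L * (t * b)"
      using order_trans[OF lip[OF yb xb] mult_left_mono[OF _ L]] by blast
    moreover have "(y - x) \<bullet> \<nu> \<ge> t - t * b"
      using Cauchy_Schwarz_ineq2[of d \<nu>] d \<nu> by (simp add: yx inner_add_left \<nu>\<nu> abs_le_iff)
    moreover have "0 < h x" using h[OF xb] x by simp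
    moreover have "L * (t * b) + t * b = t / 2"
      using arg_cong[OF b(3), of "\<lambda>s. t * s"] by (simp add: algebra_simps)
    ultimately have "0 < h y" using t by linarith
    then show "y \<in> \<Omega>" using h[OF yb] by simp
  qed
  then show ?thesis
    using r b by (intro exI[of _ "r / 2"] conjI exI[of _ \<nu>] exI[of _ b] exI[of _ "r / 4"]) auto
qed

text \<open>Near each point of the closure one cone shape serves all apexes, so the modulus holds
  there with fixed constants. A Lebesgue number of the resulting cover of the compact closure makes
  it uniform: two points at smaller distance lie in a common ball.\<close>

lemma sobolev_modulus:
  fixes \<Omega> :: "'a::euclidean_space set"
  assumes \<Omega>: "open \<Omega>" "bounded \<Omega>" and p: "1 < p" "real DIM('a) < p"
    and bd: "C1_holder_boundary \<epsilon> \<Omega>" "0 \<le> \<epsilon>" and \<eta>: "0 < \<eta>"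
  shows "\<exists>\<delta>>0. \<forall>u g M v x y. sobolev_bound p \<Omega> M u g \<and> continuous_on \<Omega> v \<and>
      (AE x in lebesgue_on \<Omega>. v x = u x) \<and> x \<in> \<Omega> \<and> y \<in> \<Omega> \<and> dist x y < \<delta> \<longrightarrow>
      \<bar>v x - v y\<bar> \<le> \<eta> * M"
proof -
  have lm: "\<Omega> \<in> lmeasurable" using \<Omega> by (simp add: lmeasurable_open)
  define Q where "Q z r \<longleftrightarrow> (\<forall>u g M v x y. sobolev_bound p \<Omega> M u g \<and> continuous_on \<Omega> v \<and>
      (AE x in lebesgue_on \<Omega>. v x = u x) \<and> x \<in> \<Omega> \<inter> ball z r \<and> y \<in> \<Omega> \<inter> ball z r \<longrightarrow>
      \<bar>v x - v y\<bar> \<le> \<eta> * M)" for z r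
  have "\<exists>r>0. Q z r" if z: "z \<in> closure \<Omega>" for z
  proof -
    obtain r c b T where r: "0 < r" and b: "0 < b" and T: "0 < T"
      and fit: "\<And>x. x \<in> \<Omega> \<inter> ball z r \<Longrightarrow> cone_fits \<Omega> c b T x"
      using cone_condition[OF \<Omega>(1) bd z] by blast
    obtain \<delta> where \<delta>: "0 < \<delta>" "\<And>u g M x y v w. sobolev_bound p \<Omega> M u g \<Longrightarrow> cone_fits \<Omega> c b T x \<Longrightarrow>
        cone_fits \<Omega> c b T y \<Longrightarrow> ((\<lambda>t. cone_average c b \<Omega> u t x) \<longlongrightarrow> v) (at_right 0) \<Longrightarrow>
        ((\<lambda>t. cone_average c b \<Omega> u t y) \<longlongrightarrow> w) (at_right 0) \<Longrightarrow> norm (x - y) < \<delta> \<Longrightarrow>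
        \<bar>v - w\<bar> \<le> \<eta> * M"
      using cone_average_modulus[OF \<Omega> p b T \<eta>, of c] by blast
    have "Q z (min r (\<delta> / 2))"
      unfolding Q_def
    proof (intro allI impI)
      fix u g M v x y
      assume A: "sobolev_bound p \<Omega> M u g \<and> continuous_on \<Omega> v \<and> (AE x in lebesgue_on \<Omega>. v x = u x) \<and>
        x \<in> \<Omega> \<inter> ball z (min r (\<delta> / 2)) \<and> y \<in> \<Omega> \<inter> ball z (min r (\<delta> / 2))"
      then have u: "integrable (lebesgue_on \<Omega>) u"
        using Lp_integrable[OF _ p(1) lm] by (auto simp: sobolev_bound_def)
      have fxy: "cone_fits \<Omega> c b T x" "cone_fits \<Omega> c b T y"
        using A fit by auto
      have "dist x y \<le> dist x z + dist z y" by (rule dist_triangle)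
      then have "norm (x - y) < \<delta>"
        using A by (simp add: dist_norm norm_minus_commute)
      moreover have v: "continuous_on \<Omega> v" "AE x in lebesgue_on \<Omega>. v x = u x"
        and sb: "sobolev_bound p \<Omega> M u g" and xy: "x \<in> \<Omega>" "y \<in> \<Omega>"
        using A by simp_all
      ultimately show "\<bar>v x - v y\<bar> \<le> \<eta> * M"
        by (intro \<delta>(2)[OF sb fxy cone_average_tendsto[OF \<Omega>(1) u v xy(1) b T fxy(1)]
              cone_average_tendsto[OF \<Omega>(1) u v xy(2) b T fxy(2)]])
    qed
    then show ?thesis using r \<delta> by (intro exI[of _ "min r (\<delta> / 2)"]) auto
  qed
  then obtain \<rho> where \<rho>: "\<And>z. z \<in> closure \<Omega> \<Longrightarrow> 0 < \<rho> z" "\<And>z. z \<in> closure \<Omega> \<Longrightarrow> Q z (\<rho> z)"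
    by metis
  have "compact (closure \<Omega>)" using \<Omega> by (simp add: compact_closure)
  moreover have "closure \<Omega> \<subseteq> \<Union> ((\<lambda>z. ball z (\<rho> z)) ` closure \<Omega>)"
    using \<rho>(1) by force
  ultimately obtain e where e: "0 < e"
    "\<And>x. x \<in> closure \<Omega> \<Longrightarrow> \<exists>G\<in>(\<lambda>z. ball z (\<rho> z)) ` closure \<Omega>. ball x e \<subseteq> G"
    by (rule Heine_Borel_lemma) auto
  show ?thesis
  proof (intro exI[of _ e] conjI allI impI e(1))
    fix u g M v x y
    assume A: "sobolev_bound p \<Omega> M u g \<and> continuous_on \<Omega> v \<and> (AE x in lebesgue_on \<Omega>. v x = u x) \<and>
        x \<in> \<Omega> \<and> y \<in> \<Omega> \<and> dist x y < e"
    then obtain z where z: "z \<in> closure \<Omega>" "ball x e \<subseteq> ball z (\<rho> z)"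
      using e(2)[of x] closure_subset by blast
    moreover have "x \<in> ball x e" "y \<in> ball x e" using A e(1) by simp_all
    ultimately have "x \<in> \<Omega> \<inter> ball z (\<rho> z)" "y \<in> \<Omega> \<inter> ball z (\<rho> z)"
      using A by blast+
    then show "\<bar>v x - v y\<bar> \<le> \<eta> * M"
      using \<rho>(2)[OF z(1)] A unfolding Q_def by blast
  qed
qed

text \<open>Local bounds from a fixed cone shape, made uniform by a finite subcover; the sum of the
  local constants stands in for their maximum.\<close>

lemma sobolev_sup_bound:
  fixes \<Omega> :: "'a::euclidean_space set"
  assumes \<Omega>: "open \<Omega>" "bounded \<Omega>" and p: "1 < p" "real DIM('a) < p"
    and bd: "C1_holder_boundary \<epsilon> \<Omega>" "0 \<le> \<epsilon>"
  shows "\<exists>C>0. \<forall>u g M v x. sobolev_bound p \<Omega> M u g \<and> continuous_on \<Omega> v \<and>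
      (AE x in lebesgue_on \<Omega>. v x = u x) \<and> x \<in> \<Omega> \<longrightarrow> \<bar>v x\<bar> \<le> C * M"
proof -
  have lm: "\<Omega> \<in> lmeasurable" using \<Omega> by (simp add: lmeasurable_open)
  define Q where "Q z r C \<longleftrightarrow> (\<forall>u g M v x. sobolev_bound p \<Omega> M u g \<and> continuous_on \<Omega> v \<and>
      (AE x in lebesgue_on \<Omega>. v x = u x) \<and> x \<in> \<Omega> \<inter> ball z r \<longrightarrow> \<bar>v x\<bar> \<le> C * M)" for z r C
  have "\<exists>r C. 0 < r \<and> 0 < C \<and> Q z r C" if z: "z \<in> closure \<Omega>" for z
  proof -
    obtain r c b T where r: "0 < r" and b: "0 < b" and T: "0 < T"
      and fit: "\<And>x. x \<in> \<Omega> \<inter> ball z r \<Longrightarrow> cone_fits \<Omega> c b T x"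
      using cone_condition[OF \<Omega>(1) bd z] by blast
    obtain C where C: "0 < C" "\<And>u g M x v. sobolev_bound p \<Omega> M u g \<Longrightarrow> cone_fits \<Omega> c b T x \<Longrightarrow>
        ((\<lambda>t. cone_average c b \<Omega> u t x) \<longlongrightarrow> v) (at_right 0) \<Longrightarrow> \<bar>v\<bar> \<le> C * M"
      using cone_average_limit_bounded[OF \<Omega> p b T, of c] by blast
    have "Q z r C"
      unfolding Q_def
    proof (intro allI impI)
      fix u g M v x
      assume A: "sobolev_bound p \<Omega> M u g \<and> continuous_on \<Omega> v \<and> (AE x in lebesgue_on \<Omega>. v x = u x) \<and>
        x \<in> \<Omega> \<inter> ball z r"
      then have u: "integrable (lebesgue_on \<Omega>) u"
        using Lp_integrable[OF _ p(1) lm] by (auto simp: sobolev_bound_def)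
      have v: "continuous_on \<Omega> v" "AE x in lebesgue_on \<Omega>. v x = u x"
        and sb: "sobolev_bound p \<Omega> M u g" and x: "x \<in> \<Omega>" "cone_fits \<Omega> c b T x"
        using A fit by simp_all
      show "\<bar>v x\<bar> \<le> C * M"
        by (rule C(2)[OF sb x(2) cone_average_tendsto[OF \<Omega>(1) u v x(1) b T x(2)]])
    qed
    then show ?thesis using r C by blast
  qed
  then obtain \<rho> C where \<rho>: "\<And>z. z \<in> closure \<Omega> \<Longrightarrow> 0 < \<rho> z"
    and C: "\<And>z. z \<in> closure \<Omega> \<Longrightarrow> 0 < C z" "\<And>z. z \<in> closure \<Omega> \<Longrightarrow> Q z (\<rho> z) (C z)"
    by metis
  have "compact (closure \<Omega>)" using \<Omega> by (simp add: compact_closure)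
  then obtain Z where Z: "Z \<subseteq> closure \<Omega>" "finite Z" "closure \<Omega> \<subseteq> (\<Union>z\<in>Z. ball z (\<rho> z))"
    by (rule compactE_image[of "closure \<Omega>" "closure \<Omega>" "\<lambda>z. ball z (\<rho> z)"]) (use \<rho> in force)+
  let ?C = "1 + (\<Sum>z\<in>Z. C z)"
  have "\<bar>v x\<bar> \<le> ?C * M"
    if A: "sobolev_bound p \<Omega> M u g" "continuous_on \<Omega> v" "AE x in lebesgue_on \<Omega>. v x = u x" "x \<in> \<Omega>"
    for u g M v x
  proof -
    obtain z where z: "z \<in> Z" "x \<in> ball z (\<rho> z)"
      using Z(3) A(4) closure_subset by blast
    have "\<bar>v x\<bar> \<le> C z * M" using C(2)[of z] Z(1) z A unfolding Q_def by blast
    moreover have "C z \<le> (\<Sum>z\<in>Z. C z)"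
      using Z C(1) z by (intro member_le_sum) (auto intro: less_imp_le)
    moreover have "0 < M" using A(1) by (simp add: sobolev_bound_def)
    ultimately show ?thesis
      using mult_right_mono[of "C z" ?C M] by linarith
  qed
  moreover have "0 < ?C"
    using sum_nonneg[of Z C] C(1) Z(1) by (metis add_pos_nonneg less_imp_le subsetD zero_less_one)
  ultimately show ?thesis by blast
qed

section \<open>The continuous representative on the closure\<close>

definition sobolev_energy :: "real \<Rightarrow> 'a::euclidean_space set \<Rightarrow> ('a \<Rightarrow> real) \<Rightarrow> real" where
  "sobolev_energy p \<Omega> u = (LINT x|lebesgue_on \<Omega>. norm (weak_gradient p \<Omega> u x) powr p) +
     (LINT x|lebesgue_on \<Omega>. \<bar>u x\<bar> powr p)"

lemma weak_gradient_sobolev: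
  assumes "u \<in> sobolev p \<Omega>"
  shows "weak_gradient p \<Omega> u \<in> Lp p \<Omega>" "has_weak_gradient \<Omega> u (weak_gradient p \<Omega> u)"
proof -
  have "\<exists>g. g \<in> Lp p \<Omega> \<and> has_weak_gradient \<Omega> u g"
    using assms by (auto simp: sobolev_def)
  from someI_ex[OF this]
  show "weak_gradient p \<Omega> u \<in> Lp p \<Omega>" "has_weak_gradient \<Omega> u (weak_gradient p \<Omega> u)"
    unfolding weak_gradient_def by blast+
qed

lemma sobolev_boundI:
  assumes "u \<in> sobolev p \<Omega>" "0 < M" "sobolev_energy p \<Omega> u \<le> M powr p"
  shows "sobolev_bound p \<Omega> M u (weak_gradient p \<Omega> u)"
proof -
  have "0 \<le> (LINT x|lebesgue_on \<Omega>. norm (weak_gradient p \<Omega> u x) powr p)"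
    "0 \<le> (LINT x|lebesgue_on \<Omega>. \<bar>u x\<bar> powr p)"
    by (intro Bochner_Integration.integral_nonneg; simp)+
  then have "(LINT x|lebesgue_on \<Omega>. \<bar>u x\<bar> powr p) \<le> M powr p"
    "(LINT x|lebesgue_on \<Omega>. norm (weak_gradient p \<Omega> u x) powr p) \<le> M powr p"
    using assms(3) unfolding sobolev_energy_def by linarith+
  then show ?thesis
    using assms weak_gradient_sobolev[OF assms(1)]
    by (auto simp: sobolev_bound_def sobolev_def)
qed

lemma sobolev_energy_nonneg: "0 \<le> sobolev_energy p \<Omega> u"
  unfolding sobolev_energy_def
  by (intro add_nonneg_nonneg Bochner_Integration.integral_nonneg) auto

lemma sobolev_nonzero_integral_pos:
  assumes "u \<in> sobolev_nonzero p \<Omega>" "0 < p"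
  shows "0 < (LINT x|lebesgue_on \<Omega>. \<bar>u x\<bar> powr p)"
proof -
  have "integrable (lebesgue_on \<Omega>) (\<lambda>x. \<bar>u x\<bar> powr p)"
    and nz: "\<not> (AE x in lebesgue_on \<Omega>. u x = 0)"
    using assms by (auto simp: sobolev_nonzero_def sobolev_def Lp_def)
  then have "(LINT x|lebesgue_on \<Omega>. \<bar>u x\<bar> powr p) \<noteq> 0"
    by (subst integral_nonneg_eq_0_iff_AE) auto
  moreover have "0 \<le> (LINT x|lebesgue_on \<Omega>. \<bar>u x\<bar> powr p)"
    by (rule Bochner_Integration.integral_nonneg) simp
  ultimately show ?thesis by linarith
qed

text \<open>The modulus makes the continuous version on \<open>\<Omega>\<close> uniformly
  continuous, so it extends to the closure. The extension witnesses that the choice in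
  \<open>continuous_rep\<close> is not a junk value.\<close>

lemma sobolev_continuous_rep:
  fixes \<Omega> :: "'a::euclidean_space set"
  assumes \<Omega>: "open \<Omega>" "bounded \<Omega>" and p: "1 < p" "real DIM('a) < p"
    and bd: "C1_holder_boundary \<epsilon> \<Omega>" "0 \<le> \<epsilon>" and u: "u \<in> sobolev p \<Omega>"
  shows "continuous_on (closure \<Omega>) (continuous_rep \<Omega> u)"
    and "AE x in lebesgue_on \<Omega>. continuous_rep \<Omega> u x = u x"
proof -
  \<comment> \<open>The added 1 keeps \<open>M\<close> positive when the energy of \<open>u\<close>
    is zero.\<close>
  define M where "M = (1 + sobolev_energy p \<Omega> u) powr (1 / p)"
  have M: "0 < M" "M powr p = 1 + sobolev_energy p \<Omega> u"
    using sobolev_energy_nonneg[of p \<Omega> u] p by (auto simp: M_def powr_powr)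
  have sb: "sobolev_bound p \<Omega> M u (weak_gradient p \<Omega> u)"
    using M by (intro sobolev_boundI u) auto
  obtain v where v: "continuous_on \<Omega> v" "AE x in lebesgue_on \<Omega>. v x = u x"
    using sobolev_continuous_interior[OF \<Omega> p sb] by blast
  have "uniformly_continuous_on \<Omega> v"
    unfolding uniformly_continuous_on_def
  proof (intro allI impI)
    fix e :: real assume e: "0 < e"
    define \<eta> where "\<eta> = e / (2 * M)"
    have \<eta>: "0 < \<eta>" "\<eta> * M < e" using e M by (simp_all add: \<eta>_def)
    then obtain \<delta> where "0 < \<delta>" "\<And>u g M v x y. sobolev_bound p \<Omega> M u g \<Longrightarrow> continuous_on \<Omega> v \<Longrightarrow>
        AE x in lebesgue_on \<Omega>. v x = u x \<Longrightarrow> x \<in> \<Omega> \<Longrightarrow> y \<in> \<Omega> \<Longrightarrow> dist x y < \<delta> \<Longrightarrow>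
        \<bar>v x - v y\<bar> \<le> \<eta> * M"
      using sobolev_modulus[OF \<Omega> p bd, of \<eta>] by blast
    note \<delta> = this(1) this(2)[OF sb v]
    have "dist (v y) (v x) < e" if "x \<in> \<Omega>" "y \<in> \<Omega>" "dist y x < \<delta>" for x y
      using \<delta>(2)[OF that(2,1,3)] \<eta> by (simp add: dist_real_def)
    then show "\<exists>d>0. \<forall>x\<in>\<Omega>. \<forall>y\<in>\<Omega>. dist y x < d \<longrightarrow> dist (v y) (v x) < e"
      using \<delta>(1) by blast
  qed
  then obtain w where w: "uniformly_continuous_on (closure \<Omega>) w" "\<And>x. x \<in> \<Omega> \<Longrightarrow> v x = w x"
    by (rule uniformly_continuous_on_extension_on_closure) blast
  have "AE x in lebesgue_on \<Omega>. w x = u x"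
    using v(2) AE_space by eventually_elim (simp add: w(2))
  then have "\<exists>w. continuous_on (closure \<Omega>) w \<and> (AE x in lebesgue_on \<Omega>. w x = u x)"
    using uniformly_continuous_imp_continuous[OF w(1)] by blast
  from someI_ex[OF this]
  show "continuous_on (closure \<Omega>) (continuous_rep \<Omega> u)"
    "AE x in lebesgue_on \<Omega>. continuous_rep \<Omega> u x = u x"
    unfolding continuous_rep_def by blast+
qed

text \<open>The error is proportional to the energy because it has to survive an infimum over
  functions of arbitrary size. Division by \<open>M\<close>, the p-th root of the energy, maps the
  values into the fixed interval \<open>{0..C}\<close>, on which the p-th power is uniformly
  continuous. Points of the closure are reached by sequences from \<open>\<Omega>\<close>.\<close>

lemma sobolev_powr_modulus:
  fixes \<Omega> :: "'a::euclidean_space set"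
  assumes \<Omega>: "open \<Omega>" "bounded \<Omega>" and p: "1 < p" "real DIM('a) < p"
    and bd: "C1_holder_boundary \<epsilon> \<Omega>" "0 \<le> \<epsilon>" and \<eta>: "0 < \<eta>"
  shows "\<exists>\<delta>>0. \<forall>u\<in>sobolev_nonzero p \<Omega>. \<forall>x\<in>closure \<Omega>. \<forall>y\<in>closure \<Omega>. dist x y < \<delta> \<longrightarrow>
      \<bar>\<bar>continuous_rep \<Omega> u x\<bar> powr p - \<bar>continuous_rep \<Omega> u y\<bar> powr p\<bar> \<le> \<eta> * sobolev_energy p \<Omega> u"
proof -
  obtain C where C: "0 < C" "\<And>u g M v x. sobolev_bound p \<Omega> M u g \<Longrightarrow> continuous_on \<Omega> v \<Longrightarrow>
      AE x in lebesgue_on \<Omega>. v x = u x \<Longrightarrow> x \<in> \<Omega> \<Longrightarrow> \<bar>v x\<bar> \<le> C * M"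
    using sobolev_sup_bound[OF \<Omega> p bd] by blast
  have "uniformly_continuous_on {0..C} (\<lambda>s. s powr p)"
    using p by (intro compact_uniformly_continuous continuous_on_powr') (auto intro!: continuous_intros)
  then obtain d where d: "0 < d" "\<And>s t. s \<in> {0..C} \<Longrightarrow> t \<in> {0..C} \<Longrightarrow> dist t s < d \<Longrightarrow>
      dist (t powr p) (s powr p) < \<eta>"
    using \<eta> unfolding uniformly_continuous_on_def by meson
  have "0 < d / 2" using d by simp
  then obtain \<delta> where \<delta>: "0 < \<delta>" "\<And>u g M v x y. sobolev_bound p \<Omega> M u g \<Longrightarrow> continuous_on \<Omega> v \<Longrightarrow>
        AE x in lebesgue_on \<Omega>. v x = u x \<Longrightarrow> x \<in> \<Omega> \<Longrightarrow> y \<in> \<Omega> \<Longrightarrow> dist x y < \<delta> \<Longrightarrow>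
        \<bar>v x - v y\<bar> \<le> d / 2 * M"
    using sobolev_modulus[OF \<Omega> p bd, of "d / 2"] by blast
  have "\<bar>\<bar>continuous_rep \<Omega> u x\<bar> powr p - \<bar>continuous_rep \<Omega> u y\<bar> powr p\<bar> \<le> \<eta> * sobolev_energy p \<Omega> u"
    if u: "u \<in> sobolev_nonzero p \<Omega>" and x: "x \<in> closure \<Omega>" and y: "y \<in> closure \<Omega>"
      and xy: "dist x y < \<delta>" for u x y
  proof -
    let ?w = "continuous_rep \<Omega> u" and ?E = "sobolev_energy p \<Omega> u"
    have us: "u \<in> sobolev p \<Omega>" using u by (simp add: sobolev_nonzero_def)
    note w = sobolev_continuous_rep[OF \<Omega> p bd us]
    have w\<Omega>: "continuous_on \<Omega> ?w"
      using w(1) closure_subset by (rule continuous_on_subset)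
    have "0 \<le> (LINT x|lebesgue_on \<Omega>. norm (weak_gradient p \<Omega> u x) powr p)"
      by (rule Bochner_Integration.integral_nonneg) simp
    then have E: "0 < ?E"
      using sobolev_nonzero_integral_pos[OF u] p unfolding sobolev_energy_def by linarith
    define M where "M = ?E powr (1 / p)"
    have M: "0 < M" "M powr p = ?E"
      using E p by (auto simp: M_def powr_powr)
    have sb: "sobolev_bound p \<Omega> M u (weak_gradient p \<Omega> u)"
      using M by (intro sobolev_boundI us) auto
    have bound: "\<bar>?w z\<bar> \<le> C * M" if "z \<in> closure \<Omega>" for z
    proof -
      have "\<forall>z\<in>\<Omega>. norm (?w z) \<le> C * M"
        using C(2)[OF sb w\<Omega> w(2)] by simp
      then show ?thesis
        using continuous_on_closure_norm_le[OF w(1) _ that] by simp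
    qed
    obtain a where a: "\<And>n. a n \<in> \<Omega>" "a \<longlonglongrightarrow> x" using x by (auto simp: closure_sequential)
    obtain b where b: "\<And>n. b n \<in> \<Omega>" "b \<longlonglongrightarrow> y" using y by (auto simp: closure_sequential)
    have "(\<lambda>n. dist (a n) (b n)) \<longlonglongrightarrow> dist x y"
      by (intro tendsto_dist a b)
    then have ev: "\<forall>\<^sub>F n in sequentially. dist (a n) (b n) < \<delta>"
      using xy by (rule order_tendstoD)
    have ca: "(\<lambda>n. ?w (a n)) \<longlonglongrightarrow> ?w x"
      by (rule continuous_on_tendsto_compose[OF w(1) a(2) x])
         (use a(1) closure_subset in \<open>blast intro: always_eventually\<close>)
    have cb: "(\<lambda>n. ?w (b n)) \<longlonglongrightarrow> ?w y"
      by (rule continuous_on_tendsto_compose[OF w(1) b(2) y])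
         (use b(1) closure_subset in \<open>blast intro: always_eventually\<close>)
    have "\<bar>?w x - ?w y\<bar> \<le> d / 2 * M"
    proof (rule tendsto_upperbound)
      show "(\<lambda>n. \<bar>?w (a n) - ?w (b n)\<bar>) \<longlonglongrightarrow> \<bar>?w x - ?w y\<bar>"
        by (intro tendsto_intros ca cb)
      show "\<forall>\<^sub>F n in sequentially. \<bar>?w (a n) - ?w (b n)\<bar> \<le> d / 2 * M"
        using ev by eventually_elim (rule \<delta>(2)[OF sb w\<Omega> w(2) a(1) b(1)])
    qed simp
    then have "\<bar>\<bar>?w x\<bar> - \<bar>?w y\<bar>\<bar> \<le> d / 2 * M"
      using abs_triangle_ineq3[of "?w x" "?w y"] by linarith
    then have "\<bar>(\<bar>?w x\<bar> - \<bar>?w y\<bar>) / M\<bar> \<le> d / 2"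
      using M by (simp add: field_simps)
    then have "dist (\<bar>?w x\<bar> / M) (\<bar>?w y\<bar> / M) < d"
      using d(1) by (simp add: dist_real_def diff_divide_distrib)
    then have "dist ((\<bar>?w x\<bar> / M) powr p) ((\<bar>?w y\<bar> / M) powr p) < \<eta>"
      using bound[OF x] bound[OF y] M by (intro d(2)) (auto simp: field_simps)
    then have "\<bar>\<bar>?w x\<bar> powr p - \<bar>?w y\<bar> powr p\<bar> / ?E \<le> \<eta>"
      using M E by (simp add: dist_real_def powr_divide diff_divide_distrib[symmetric])
    then show ?thesis using E by (simp add: field_simps)
  qed
  with \<delta>(1) show ?thesis by blast
qed

section \<open>Surface measure of boundary pieces\<close>

text \<open>Balls of radius \<open>s / 2\<close> around the points are disjoint and lie in
  \<open>cball z (R + s)\<close>; comparing volumes bounds their number.\<close>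

lemma separated_card_bound:
  fixes Q :: "'a::euclidean_space set"
  assumes Q: "finite Q" "Q \<subseteq> cball z R" and s: "0 < s" and R: "0 \<le> R"
    and sep: "\<And>x y. x \<in> Q \<Longrightarrow> y \<in> Q \<Longrightarrow> x \<noteq> y \<Longrightarrow> s \<le> dist x y"
  shows "real (card Q) * (s / 2) ^ DIM('a) \<le> (R + s) ^ DIM('a)"
proof -
  let ?V = "unit_ball_vol (real DIM('a))"
  have V: "0 < ?V" by (simp add: unit_ball_vol_pos)
  have disj: "disjoint_family_on (\<lambda>x. ball x (s / 2)) Q"
    unfolding disjoint_family_on_def
  proof (intro ballI impI)
    fix x y assume xy: "x \<in> Q" "y \<in> Q" "x \<noteq> y"
    show "ball x (s / 2) \<inter> ball y (s / 2) = {}"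
    proof (rule ccontr)
      assume "ball x (s / 2) \<inter> ball y (s / 2) \<noteq> {}"
      then obtain w where "dist x w < s / 2" "dist y w < s / 2" by auto
      then have "dist x y < s"
        using dist_triangle[of x y w] by (simp add: dist_commute)
      then show False using sep[OF xy] by simp
    qed
  qed
  have "real (card Q) * (?V * (s / 2) ^ DIM('a)) = (\<Sum>x\<in>Q. measure lborel (ball x (s / 2)))"
    using s by (simp add: content_ball)
  also have "\<dots> = measure lborel (\<Union>x\<in>Q. ball x (s / 2))"
    by (rule measure_finite_Union[symmetric])
       (use Q disj emeasure_lborel_ball_finite in \<open>auto simp: less_le\<close>)
  also have "\<dots> \<le> measure lborel (cball z (R + s))"
  proof (rule measure_mono_fmeasurable)
    show "(\<Union>x\<in>Q. ball x (s / 2)) \<subseteq> cball z (R + s)"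
    proof
      fix w assume "w \<in> (\<Union>x\<in>Q. ball x (s / 2))"
      then obtain x where "x \<in> Q" "dist x w < s / 2" by auto
      then show "w \<in> cball z (R + s)"
        using Q(2) dist_triangle[of z w x] s by fastforce
    qed
  qed (use emeasure_lborel_cball_finite[of z "R + s"] in \<open>auto simp: fmeasurable_def intro!: borel_open\<close>)
  also have "\<dots> = ?V * (R + s) ^ DIM('a)"
    using R s by (simp add: content_cball)
  finally have "?V * (real (card Q) * (s / 2) ^ DIM('a)) \<le> ?V * (R + s) ^ DIM('a)"
    by (simp add: mult_ac)
  then show ?thesis using V by simp
qed

text \<open>The packing bound lets a separated subset of largest cardinality be chosen. It must
  cover \<open>A\<close>, since an uncovered point could be added to it.\<close>

lemma finite_separated_net:
  fixes A :: "'a::euclidean_space set"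
  assumes A: "A \<subseteq> cball z R" and R: "0 \<le> R" and s: "0 < s"
  obtains T where "finite T" "T \<subseteq> A" "\<And>x y. x \<in> T \<Longrightarrow> y \<in> T \<Longrightarrow> x \<noteq> y \<Longrightarrow> s \<le> dist x y"
    "A \<subseteq> (\<Union>x\<in>T. ball x s)"
proof -
  define P where "P T \<longleftrightarrow> finite T \<and> T \<subseteq> A \<and> (\<forall>x\<in>T. \<forall>y\<in>T. x \<noteq> y \<longrightarrow> s \<le> dist x y)" for T
  define B where "B = (R + s) ^ DIM('a) / (s / 2) ^ DIM('a)"
  have "card T \<le> nat \<lceil>B\<rceil>" if "P T" for T
  proof -
    have "real (card T) * (s / 2) ^ DIM('a) \<le> (R + s) ^ DIM('a)"
      by (rule separated_card_bound[of T z R s]) (use that A R s in \<open>auto simp: P_def\<close>)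
    then have "real (card T) \<le> B"
      using s by (simp add: B_def pos_le_divide_eq)
    then show ?thesis by linarith
  qed
  then have bound: "\<forall>T. P T \<longrightarrow> card T < Suc (nat \<lceil>B\<rceil>)" by (simp add: less_Suc_eq_le)
  have "P {}" by (simp add: P_def)
  from ex_has_greatest_nat[OF this bound]
  obtain T where T: "P T" "\<And>S. P S \<Longrightarrow> card S \<le> card T" by auto
  have "A \<subseteq> (\<Union>x\<in>T. ball x s)"
  proof
    fix a assume a: "a \<in> A"
    show "a \<in> (\<Union>x\<in>T. ball x s)"
    proof (rule ccontr)
      assume far: "a \<notin> (\<Union>x\<in>T. ball x s)"
      then have "a \<notin> T" using s by auto
      moreover have "P (insert a T)"
        using T(1) a far by (auto simp: P_def dist_commute not_less)
      ultimately show False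
        using T(2)[of "insert a T"] T(1) by (simp add: P_def)
    qed
  qed
  then show thesis using that[of T] T(1) by (auto simp: P_def)
qed

text \<open>
  The translates of an \<open>s\<close>-separated subset of the graph by multiples of \<open>(1 + L) s \<nu>\<close> are together still
  \<open>s\<close>-separated, and about \<open>1 / s\<close> of them fit into the ball. So packing in dimension \<open>n\<close> bounds the
  size of such a subset by a multiple of \<open>s\<^sup>1\<^sup>-\<^sup>n\<close>.
\<close>

lemma hausdorff_outer_frontier_finite:
  fixes \<Omega> :: "'a::euclidean_space set"
  assumes r: "0 < r" and L: "0 \<le> L" and \<nu>: "norm \<nu> = 1"
    and h0: "\<And>x. x \<in> A \<Longrightarrow> h x = 0" and A: "A \<subseteq> cball z (r / 4)"
    and lip: "\<And>x y. x \<in> ball z r \<Longrightarrow> y \<in> ball z r \<Longrightarrow> \<bar>h x - h y\<bar> \<le> (1 + L) * norm (x - y)"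
    and tr: "\<And>x t. x \<in> ball z r \<Longrightarrow> x + t *\<^sub>R \<nu> \<in> ball z r \<Longrightarrow> h (x + t *\<^sub>R \<nu>) = h x + t"
  shows "hausdorff_outer (DIM('a) - 1) (A :: 'a set) < top"
proof -
  let ?n = "DIM('a)" and ?k = "DIM('a) - 1"
  let ?V = "unit_ball_vol (real ?k)"
  \<comment> \<open>The result of solving the packing inequality for \<open>card T * s ^ ?k\<close>:
    the number of layers is at least \<open>(r / 4) / ((1 + L) * s)\<close>, which absorbs one power
    of \<open>s\<close>, and \<open>s \<le> 1\<close> replaces \<open>r / 2 + s\<close> by
    \<open>r / 2 + 1\<close>.\<close>
  define K where "K = (r / 2 + 1) ^ ?n * 2 ^ ?n * (1 + L) / (r / 4)"
  have V: "0 < ?V" by (simp add: unit_ball_vol_pos)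
  have n: "?n = Suc ?k" by simp
  have pre: "hausdorff_pre ?k (2 * s) A \<le> ennreal (?V * K)" if s: "0 < s" "s \<le> 1" for s
  proof -
    obtain T where T: "finite T" "T \<subseteq> A" "\<And>x y. x \<in> T \<Longrightarrow> y \<in> T \<Longrightarrow> x \<noteq> y \<Longrightarrow> s \<le> dist x y"
      "A \<subseteq> (\<Union>x\<in>T. ball x s)"
      using finite_separated_net[OF A _ s(1)] r by (metis divide_nonneg_pos less_imp_le zero_less_numeral)
    define \<tau> where "\<tau> = (1 + L) * s"
    have \<tau>: "0 < \<tau>" using L s by (simp add: \<tau>_def)
    \<comment> \<open>As many shifts by \<open>\<tau>\<close> as keep the points within
      \<open>r / 2\<close> of \<open>z\<close>, given that \<open>A\<close> lies within
      \<open>r / 4\<close>.\<close>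
    define J where "J = nat \<lfloor>(r / 4) / \<tau>\<rfloor>"
    have J: "real J * \<tau> \<le> r / 4" "(r / 4) / \<tau> \<le> real J + 1"
    proof -
      have "real J \<le> (r / 4) / \<tau>" using r \<tau> by (simp add: J_def)
      then show "real J * \<tau> \<le> r / 4" using \<tau> by (simp add: pos_le_divide_eq)
      show "(r / 4) / \<tau> \<le> real J + 1" unfolding J_def by linarith
    qed
    define f where "f = (\<lambda>(y, j). y + (real j * \<tau>) *\<^sub>R \<nu>)"
    define Q where "Q = f ` (T \<times> {..J})"
    have f_ball: "f (y, j) \<in> cball z (r / 2)" if "y \<in> T" "j \<le> J" for y j
    proof -
      have "dist z (f (y, j)) \<le> dist z y + norm ((real j * \<tau>) *\<^sub>R \<nu>)"
        using dist_triangle[of z "f (y, j)" y] by (simp add: f_def dist_norm)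
      also have "norm ((real j * \<tau>) *\<^sub>R \<nu>) \<le> real J * \<tau>"
        using that \<nu> \<tau> by (simp add: mult_right_mono)
      also have "dist z y \<le> r / 4" using that T(2) A by auto
      finally show ?thesis using J(1) by simp
    qed
    have sepf: "s \<le> dist (f (y, j)) (f (y', j'))"
      if "y \<in> T" "j \<le> J" "y' \<in> T" "j' \<le> J" "(y, j) \<noteq> (y', j')" for y j y' j'
    proof (cases "j = j'")
      case True
      then show ?thesis using T(3)[of y y'] that by (simp add: f_def)
    next
      case False
      have b: "f (y, j) \<in> ball z r" "f (y', j') \<in> ball z r" "y \<in> ball z r" "y' \<in> ball z r"
        using f_ball that T(2) A r by fastforce+
      \<comment> \<open>Heights in different layers differ by at least
        \<open>\<tau> = (1 + L) * s\<close>; as \<open>h\<close> is Lipschitz with constant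
        \<open>1 + L\<close>, the points are at least \<open>s\<close> apart.\<close>
      have "h (f (y, j)) = real j * \<tau>" "h (f (y', j')) = real j' * \<tau>"
        using tr[of y "real j * \<tau>"] tr[of y' "real j' * \<tau>"] b that T(2) h0 by (auto simp: f_def)
      then have "\<bar>real j - real j'\<bar> * \<tau> \<le> (1 + L) * dist (f (y, j)) (f (y', j'))"
        using lip[OF b(1,2)] \<tau> by (simp add: dist_norm left_diff_distrib[symmetric] abs_mult)
      moreover have "1 * \<tau> \<le> \<bar>real j - real j'\<bar> * \<tau>"
        using False \<tau> by (intro mult_right_mono) auto
      ultimately have "(1 + L) * s \<le> (1 + L) * dist (f (y, j)) (f (y', j'))"
        by (simp add: \<tau>_def)
      then show ?thesis using L by simp
    qed
    have inj: "inj_on f (T \<times> {..J})"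
      using sepf s(1) by (fastforce simp: inj_on_def)
    have "real (card Q) * (s / 2) ^ ?n \<le> (r / 2 + s) ^ ?n"
    proof (rule separated_card_bound)
      show "finite Q" using T by (simp add: Q_def)
      show "Q \<subseteq> cball z (r / 2)" using f_ball by (auto simp: Q_def)
      show "s \<le> dist x y" if "x \<in> Q" "y \<in> Q" "x \<noteq> y" for x y
        using that sepf by (auto simp: Q_def)
    qed (use s r in auto)
    also have "card Q = card T * (J + 1)"
      using inj by (simp add: Q_def card_image card_cartesian_product)
    also have "(r / 2 + s) ^ ?n \<le> (r / 2 + 1) ^ ?n"
      using s r by (intro power_mono) auto
    finally have c: "real (card T) * (real J + 1) * (s / 2) ^ ?n \<le> (r / 2 + 1) ^ ?n"
      by (simp only: of_nat_mult of_nat_add of_nat_1)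
    have sn: "s ^ ?n = s * s ^ ?k"
      using n power_Suc by metis
    have "real (card T) * s ^ ?k * ((r / 4) / (1 + L)) = real (card T) * ((r / 4) / \<tau>) * s ^ ?n"
      using s L by (simp add: sn \<tau>_def)
    also have "\<dots> \<le> real (card T) * (real J + 1) * s ^ ?n"
      using J(2) s by (intro mult_right_mono mult_left_mono) auto
    also have "\<dots> = real (card T) * (real J + 1) * (s / 2) ^ ?n * 2 ^ ?n"
      by (simp add: power_divide)
    also have "\<dots> \<le> (r / 2 + 1) ^ ?n * 2 ^ ?n"
      by (intro mult_right_mono c) simp
    finally have "real (card T) * s ^ ?k \<le> (r / 2 + 1) ^ ?n * 2 ^ ?n / ((r / 4) / (1 + L))"
      using r L by (subst pos_le_divide_eq) auto
    then have count: "real (card T) * s ^ ?k \<le> K"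
      unfolding K_def by (simp only: divide_divide_eq_right)
    obtain g where g: "bij_betw g {0..<card T} T"
      using ex_bij_betw_nat_finite[OF T(1)] by blast
    define C where "C i = (if i < card T then ball (g i) s else {})" for i
    have "A \<subseteq> (\<Union>i. C i)"
    proof
      fix a assume "a \<in> A"
      then obtain x where "x \<in> T" "a \<in> ball x s" using T(4) by blast
      moreover then obtain i where "i < card T" "g i = x"
        using g unfolding bij_betw_def by (metis atLeastLessThan_iff imageE)
      ultimately show "a \<in> (\<Union>i. C i)" by (auto simp: C_def)
    qed
    then have "C \<in> hausdorff_covers (2 * s) A"
      using s by (auto simp: hausdorff_covers_def C_def)
    then have "hausdorff_pre ?k (2 * s) A \<le> (\<Sum>i. hausdorff_gauge ?k (C i))"
      unfolding hausdorff_pre_def by (rule INF_lower)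
    also have "\<dots> = (\<Sum>i<card T. hausdorff_gauge ?k (C i))"
      by (rule suminf_finite) (auto simp: C_def hausdorff_gauge_def)
    also have "\<dots> = (\<Sum>i<card T. ennreal (?V * s ^ ?k))"
      using s by (intro sum.cong) (auto simp: C_def hausdorff_gauge_def)
    also have "\<dots> = ennreal (real (card T) * (?V * s ^ ?k))"
      using V s by (simp add: ennreal_of_nat_eq_real_of_nat ennreal_mult'')
    also have "\<dots> \<le> ennreal (?V * K)"
      using mult_left_mono[OF count, of ?V] V by (intro ennreal_leI) (simp add: mult_ac)
    finally show ?thesis .
  qed
  have "hausdorff_outer ?k A \<le> ennreal (?V * K)"
    unfolding hausdorff_outer_def
  proof (rule SUP_least)
    fix \<delta> :: real assume "\<delta> \<in> {0<..}"
    then have "hausdorff_pre ?k \<delta> A \<le> hausdorff_pre ?k (2 * min 1 (\<delta> / 2)) A"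
      by (intro hausdorff_pre_antimono) auto
    also have "\<dots> \<le> ennreal (?V * K)"
      by (rule pre) (use \<open>\<delta> \<in> {0<..}\<close> in auto)
    finally show "hausdorff_pre ?k \<delta> A \<le> ennreal (?V * K)" .
  qed
  then show ?thesis using ennreal_less_top le_less_trans by blast
qed

text \<open>For \<open>d\<close> slightly above the diameter, balls of radius \<open>2 * d\<close>
  placed at steps \<open>d\<close> along the axis cover the tube: one \<open>d\<close> pays for the
  cross-section, one for the rounding. Their number is at most \<open>2 / d + 3\<close>, hence at
  most \<open>5 / d\<close>. Working with \<open>d\<close> instead of the diameter avoids division
  by zero for singletons; the limit is taken at the end. The closure makes the tube compact and thus
  measurable.\<close>

lemma tube_measure_le:
  fixes C :: "'a::euclidean_space set"
  assumes C: "bounded C" "C \<noteq> {}" "diameter C \<le> 1 / 2" and \<nu>: "norm \<nu> = 1"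
  defines "T \<equiv> (\<lambda>(c, t). c + t *\<^sub>R \<nu>) ` (closure C \<times> {-1..1::real})"
  shows "compact T"
    and "measure lebesgue T \<le> 5 * unit_ball_vol (real DIM('a)) * 2 ^ DIM('a) * diameter C ^ (DIM('a) - 1)"
proof -
  let ?n = "DIM('a)" and ?k = "DIM('a) - 1" and ?D = "diameter C"
  let ?V = "unit_ball_vol (real ?n)"
  have V: "0 < ?V" by (simp add: unit_ball_vol_pos)
  show cT: "compact T"
    unfolding T_def using C(1)
    by (intro compact_continuous_image compact_Times)
       (auto simp: compact_closure case_prod_unfold intro!: continuous_intros)
  obtain c0 where c0: "c0 \<in> closure C" using C(2) closure_subset by blast
  have le: "measure lebesgue T \<le> 5 * ?V * 2 ^ ?n * d ^ ?k" if d: "?D < d" "d \<le> 1" for d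
  proof -
    have d0: "0 < d" using d diameter_ge_0[OF C(1)] by linarith
    define J where "J = \<lceil>1 / d\<rceil>"
    let ?B = "\<lambda>j :: int. cball (c0 + (real_of_int j * d) *\<^sub>R \<nu>) (2 * d)"
    have sub: "T \<subseteq> (\<Union>j\<in>{-J..J}. ?B j)"
    proof
      fix y assume "y \<in> T"
      then obtain c t where ct: "c \<in> closure C" "-1 \<le> t" "t \<le> 1" "y = c + t *\<^sub>R \<nu>"
        by (auto simp: T_def)
      define j where "j = \<lfloor>t / d\<rfloor>"
      have j: "real_of_int j * d \<le> t" "t \<le> real_of_int j * d + d"
      proof -
        have "real_of_int j \<le> t / d" unfolding j_def by linarith
        then show "real_of_int j * d \<le> t" using d0 by (simp add: pos_le_divide_eq)
        have "t / d \<le> real_of_int j + 1" unfolding j_def by linarith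
        then show "t \<le> real_of_int j * d + d" using d0 by (simp add: pos_divide_le_eq distrib_right)
      qed
      have "- (1 / d) \<le> t / d" "t / d \<le> 1 / d"
        using ct d0 by (auto simp: field_simps)
      then have jJ: "j \<in> {-J..J}"
        unfolding j_def J_def by (auto simp: le_floor_iff) (linarith)+
      have "dist c0 c \<le> diameter (closure C)"
        using C(1) c0 ct(1) by (intro diameter_bounded_bound) auto
      then have "dist c0 c \<le> d" using d C(1) by (simp add: diameter_closure)
      moreover have "dist (c0 + (real_of_int j * d) *\<^sub>R \<nu>) y \<le> dist c0 c + norm ((t - real_of_int j * d) *\<^sub>R \<nu>)"
      proof -
        have "c0 + (real_of_int j * d) *\<^sub>R \<nu> - y = (c0 - c) - (t - real_of_int j * d) *\<^sub>R \<nu>"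
          by (simp add: ct(4) algebra_simps)
        then show ?thesis unfolding dist_norm by (simp only: norm_triangle_ineq4)
      qed
      moreover have "norm ((t - real_of_int j * d) *\<^sub>R \<nu>) \<le> d"
        using j \<nu> by simp
      ultimately have "y \<in> ?B j" by simp
      then show "y \<in> (\<Union>j\<in>{-J..J}. ?B j)" using jJ by blast
    qed
    have "0 < 1 / d" using d0 by simp
    then have J: "0 \<le> J" "real_of_int J \<le> 1 / d + 1"
      unfolding J_def by linarith+
    have "measure lebesgue T \<le> measure lebesgue (\<Union>j\<in>{-J..J}. ?B j)"
      using cT sub by (intro measure_mono_fmeasurable) (auto simp: lmeasurable_compact fmeasurableD)
    also have "\<dots> \<le> (\<Sum>j\<in>{-J..J}. measure lebesgue (?B j))"
      by (rule measure_UNION_le) auto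
    also have "\<dots> = (2 * real_of_int J + 1) * (?V * (2 * d) ^ ?n)"
      using d0 J by (simp add: content_cball)
    also have "\<dots> \<le> (5 / d) * (?V * (2 * d) ^ ?n)"
    proof (rule mult_right_mono)
      have "1 \<le> 1 / d" using d d0 by simp
      then have "2 * real_of_int J + 1 \<le> 5 * (1 / d)" using J by linarith
      then show "2 * real_of_int J + 1 \<le> 5 / d" by simp
    qed (use V d0 in auto)
    also have "\<dots> = 5 * ?V * 2 ^ ?n * (d ^ ?n / d)"
      by (simp add: power_mult_distrib)
    also have "d ^ ?n / d = d ^ ?k"
    proof -
      have "?n = Suc ?k" by simp
      then have "d ^ ?n = d * d ^ ?k" using power_Suc by metis
      then show ?thesis using d0 by simp
    qed
    finally show ?thesis .
  qed
  show "measure lebesgue T \<le> 5 * ?V * 2 ^ ?n * ?D ^ ?k"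
  proof (rule tendsto_lowerbound)
    show "((\<lambda>d. 5 * ?V * 2 ^ ?n * d ^ ?k) \<longlongrightarrow> 5 * ?V * 2 ^ ?n * ?D ^ ?k) (at_right ?D)"
      by (intro tendsto_intros)
    show "\<forall>\<^sub>F d in at_right ?D. measure lebesgue T \<le> 5 * ?V * 2 ^ ?n * d ^ ?k"
      unfolding eventually_at_right_field using le C(3) by (intro exI[of _ 1]) auto
  qed simp
qed

text \<open>A cover of \<open>A\<close> sweeps out tubes along \<open>\<nu>\<close> that cover a ball and hence have at least its volume.\<close>

lemma hausdorff_outer_pos:
  fixes A :: "'a::euclidean_space set"
  assumes \<nu>: "norm \<nu> = 1" and \<rho>: "0 < \<rho>"
    and proj: "\<And>y. y \<in> ball z \<rho> \<Longrightarrow> \<exists>c\<in>A. \<exists>t. \<bar>t\<bar> \<le> 1 \<and> y = c + t *\<^sub>R \<nu>"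
  shows "0 < hausdorff_outer (DIM('a) - 1) A"
proof (rule ccontr)
  let ?n = "DIM('a)" and ?k = "DIM('a) - 1"
  let ?V = "unit_ball_vol (real ?n)"
  define W where "W = unit_ball_vol (real ?k)"
  have W: "0 < W" unfolding W_def by (rule unit_ball_vol_pos) simp
  \<comment> \<open>The factor that converts the Hausdorff gauge of a covering set into the volume
    bound of its tube; \<open>2 ^ ?k\<close> undoes the halved diameter in the gauge.\<close>
  define K where "K = 5 * ?V * 2 ^ ?n * 2 ^ ?k / W"
  have K: "0 < K" using W by (simp add: K_def unit_ball_vol_pos)
  \<comment> \<open>A cover of gauge sum below \<open>e\<close> would yield tubes of total volume
    less than that of the ball they cover. Covers at scale \<open>1 / 2\<close> are used, as
    \<open>tube_measure_le\<close> requires.\<close>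
  define e where "e = measure lebesgue (ball z \<rho>) / K"
  have e: "0 < e" using K content_ball_pos[OF \<rho>, of z] by (simp add: e_def)
  assume "\<not> 0 < hausdorff_outer ?k A"
  then have "hausdorff_pre ?k (1 / 2) A = 0"
    using hausdorff_pre_le_outer[of "1 / 2" ?k A] by simp
  then have "(INF C\<in>hausdorff_covers (1 / 2) A. \<Sum>i. hausdorff_gauge ?k (C i)) < ennreal e"
    using e by (simp add: hausdorff_pre_def)
  then obtain C where C: "C \<in> hausdorff_covers (1 / 2) A" "(\<Sum>i. hausdorff_gauge ?k (C i)) < ennreal e"
    unfolding INF_less_iff by blast
  have bd: "bounded (C i)" "diameter (C i) \<le> 1 / 2" and cov: "A \<subseteq> (\<Union>i. C i)" for i
    using C(1) by (auto simp: hausdorff_covers_def)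
  define T where "T i = (\<lambda>(c, t). c + t *\<^sub>R \<nu>) ` (closure (C i) \<times> {-1..1::real})" for i
  have cT: "compact (T i)" for i
    unfolding T_def using tube_measure_le(1)[OF bd(1) _ bd(2) \<nu>, of i] by (cases "C i = {}") auto
  have eT: "emeasure lebesgue (T i) \<le> ennreal K * hausdorff_gauge ?k (C i)" for i
  proof (cases "C i = {}")
    case True
    then show ?thesis by (simp add: T_def)
  next
    case False
    have "emeasure lebesgue (T i) = ennreal (measure lebesgue (T i))"
      by (rule emeasure_eq_measure2) (rule lmeasurable_compact[OF cT])
    also have "\<dots> \<le> ennreal (5 * ?V * 2 ^ ?n * diameter (C i) ^ ?k)"
      unfolding T_def by (rule ennreal_leI[OF tube_measure_le(2)[OF bd(1) False bd(2) \<nu>]])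
    also have "\<dots> = ennreal (K * (W * (diameter (C i) / 2) ^ ?k))"
      using W by (simp add: K_def power_divide mult.assoc)
    also have "\<dots> = ennreal K * ennreal (W * (diameter (C i) / 2) ^ ?k)"
      using K by (intro ennreal_mult') simp
    also have "ennreal (W * (diameter (C i) / 2) ^ ?k) = hausdorff_gauge ?k (C i)"
      unfolding hausdorff_gauge_def W_def using False by (simp only: if_False)
    finally show ?thesis .
  qed
  have "ball z \<rho> \<subseteq> (\<Union>i. T i)"
  proof
    fix y assume "y \<in> ball z \<rho>"
    then obtain c t where ct: "c \<in> A" "\<bar>t\<bar> \<le> 1" "y = c + t *\<^sub>R \<nu>" using proj by blast
    then obtain i where "c \<in> closure (C i)" using cov closure_subset by blast
    then have "y \<in> T i" using ct unfolding T_def by (intro image_eqI[of _ _ "(c, t)"]) auto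
    then show "y \<in> (\<Union>i. T i)" by blast
  qed
  then have "emeasure lebesgue (ball z \<rho>) \<le> emeasure lebesgue (\<Union>i. T i)"
    using cT by (intro emeasure_mono sets.countable_UN) (auto simp: lmeasurable_compact fmeasurableD)
  also have "\<dots> \<le> (\<Sum>i. emeasure lebesgue (T i))"
    using cT by (intro emeasure_subadditive_countably) (auto simp: lmeasurable_compact fmeasurableD)
  also have "\<dots> \<le> (\<Sum>i. ennreal K * hausdorff_gauge ?k (C i))"
    by (intro suminf_le eT) auto
  also have "\<dots> = ennreal K * (\<Sum>i. hausdorff_gauge ?k (C i))"
    by (rule ennreal_suminf_cmult)
  also have "\<dots> < ennreal K * ennreal e"
    using C(2) K by (intro ennreal_mult_strict_left_mono) auto
  also have "\<dots> = ennreal (measure lebesgue (ball z \<rho>))"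
    using K by (simp add: e_def ennreal_mult'[symmetric])
  also have "\<dots> = emeasure lebesgue (ball z \<rho>)"
    by (rule emeasure_eq_measure2[symmetric]) simp
  finally show False by simp
qed

text \<open>In the chart the frontier is the zero set of the height \<open>h\<close>, which is
  Lipschitz and grows at unit rate along \<open>\<nu>\<close>. These two properties are what the
  finiteness and the positivity of the Hausdorff measure rest on.\<close>

lemma surface_measure_frontier_ball:
  fixes \<Omega> :: "'a::euclidean_space set"
  assumes \<Omega>: "open \<Omega>" and bd: "C1_holder_boundary \<epsilon> \<Omega>" "0 \<le> \<epsilon>" and z: "z \<in> frontier \<Omega>"
    and \<rho>: "0 < \<rho>"
  obtains A where "closed A" "A \<subseteq> frontier \<Omega> \<inter> cball z \<rho>"
    "0 < emeasure (surface_measure \<Omega>) A" "emeasure (surface_measure \<Omega>) A < top"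
proof -
  obtain r L \<nu> h where r: "0 < r" and L: "0 \<le> L" and \<nu>: "norm \<nu> = 1"
    and h: "\<And>x. x \<in> ball z r \<Longrightarrow> x \<in> \<Omega> \<longleftrightarrow> 0 < h x"
    and hlip: "\<And>x y. x \<in> ball z r \<Longrightarrow> y \<in> ball z r \<Longrightarrow>
      \<bar>h x - h y - (x - y) \<bullet> \<nu>\<bar> \<le> L * norm ((x - y) - ((x - y) \<bullet> \<nu>) *\<^sub>R \<nu>)"
    using C1_holder_boundary_chart[OF bd z] by metis
  have \<nu>\<nu>: "\<nu> \<bullet> \<nu> = 1" using \<nu> by (simp add: norm_eq_1)
  have lip: "\<bar>h x - h y\<bar> \<le> (1 + L) * norm (x - y)" if "x \<in> ball z r" "y \<in> ball z r" for x y
  proof -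
    have "\<bar>h x - h y - (x - y) \<bullet> \<nu>\<bar> \<le> L * norm (x - y)"
      using order_trans[OF hlip[OF that] mult_left_mono[OF norm_orthogonal_projection_le[OF \<nu>] L]] .
    moreover have "\<bar>(x - y) \<bullet> \<nu>\<bar> \<le> norm (x - y)"
      using Cauchy_Schwarz_ineq2[of "x - y" \<nu>] \<nu> by simp
    ultimately show ?thesis by (simp add: distrib_right) 
  qed
  have tr: "h (x + t *\<^sub>R \<nu>) = h x + t" if "x \<in> ball z r" "x + t *\<^sub>R \<nu> \<in> ball z r" for x t
    using hlip[OF that(2,1)] by (simp add: \<nu>\<nu>)
  have frontier_iff: "x \<in> frontier \<Omega> \<longleftrightarrow> h x = 0" if x: "x \<in> ball z r" for x
  proof
    assume fr: "x \<in> frontier \<Omega>"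
    then have "x \<notin> \<Omega>" and cl: "x \<in> closure \<Omega>"
      using \<Omega> by (auto simp: frontier_def interior_open)
    then have "h x \<le> 0" using h[OF x] by simp
    moreover have "\<not> h x < 0"
    proof
      assume neg: "h x < 0"
      \<comment> \<open>Within this radius the chart is valid and the Lipschitz bound keeps
        \<open>h\<close> negative, so no point of \<open>\<Omega>\<close> is that close to
        \<open>x\<close>.\<close>
      define e where "e = min (r - dist z x) (- h x / (1 + L))"
      have e: "0 < e" using neg L x by (auto simp: e_def divide_neg_pos)
      then obtain y where y: "y \<in> \<Omega>" "dist y x < e"
        using cl by (auto simp: closure_approachable)
      have yb: "y \<in> ball z r"
        using y dist_triangle[of z y x] by (simp add: e_def dist_commute)
      have "\<bar>h y - h x\<bar> \<le> (1 + L) * norm (y - x)" by (rule lip[OF yb x])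
      also have "\<dots> < (1 + L) * (- h x / (1 + L))"
        using y L by (intro mult_strict_left_mono) (auto simp: e_def dist_norm)
      also have "\<dots> = - h x" using L by simp
      finally have "h y < 0" by linarith
      then show False using h[OF yb] y by simp
    qed
    ultimately show "h x = 0" by simp
  next
    assume hx: "h x = 0"
    then have "x \<notin> \<Omega>" using h[OF x] by simp
    moreover have "x \<in> closure \<Omega>"
      unfolding closure_approachable
    proof (intro allI impI)
      fix e :: real assume e: "0 < e"
      define t where "t = min e (r - dist z x) / 2"
      have t: "0 < t" "t < e" "t < r - dist z x" using e x by (auto simp: t_def)
      have "dist z (x + t *\<^sub>R \<nu>) \<le> dist z x + t"
        using dist_triangle[of z "x + t *\<^sub>R \<nu>" x] t \<nu> by (simp add: dist_norm)
      then have b: "x + t *\<^sub>R \<nu> \<in> ball z r" using t by simp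
      then have "x + t *\<^sub>R \<nu> \<in> \<Omega>" using h tr[OF x b] hx t by simp
      moreover have "dist (x + t *\<^sub>R \<nu>) x < e" using t \<nu> by (simp add: dist_norm)
      ultimately show "\<exists>y\<in>\<Omega>. dist y x < e" by blast
    qed
    ultimately show "x \<in> frontier \<Omega>" using \<Omega> by (simp add: frontier_def interior_open)
  qed
  \<comment> \<open>The bound \<open>r / 4\<close> serves the finiteness lemma; the bound 1 limits
    the length of the shift along \<open>\<nu>\<close> in the positivity lemma.\<close>
  define \<rho>' where "\<rho>' = Min {\<rho>, r / 4, 1}"
  have \<rho>': "0 < \<rho>'" "\<rho>' \<le> \<rho>" "\<rho>' \<le> r / 4" "\<rho>' \<le> 1" using \<rho> r by (auto simp: \<rho>'_def)
  define A where "A = frontier \<Omega> \<inter> cball z \<rho>'"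
  have clA: "closed A" by (simp add: A_def closed_Int)
  have sub: "cball z \<rho>' \<subseteq> ball z r" "cball z \<rho>' \<subseteq> cball z (r / 4)"
    using \<rho>' r by auto
  have "hausdorff_outer (DIM('a) - 1) A < top"
  proof (rule hausdorff_outer_frontier_finite[OF r L \<nu> _ _ lip tr])
    show "h x = 0" if "x \<in> A" for x
      using that frontier_iff sub by (auto simp: A_def)
    show "A \<subseteq> cball z (r / 4)" using sub by (auto simp: A_def)
  qed
  moreover have "0 < hausdorff_outer (DIM('a) - 1) A"
  proof (rule hausdorff_outer_pos[OF \<nu>])
    \<comment> \<open>For \<open>y\<close> in this ball, \<open>h z = 0\<close> gives
      \<open>\<bar>h y\<bar> \<le> (1 + L) * dist z y\<close>. Sliding \<open>y\<close> along
      \<open>\<nu>\<close> to height zero therefore ends within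
      \<open>(2 + L) * dist z y < \<rho>'\<close> of \<open>z\<close>, that is, in
      \<open>A\<close>.\<close>
    show "0 < \<rho>' / (2 + L)" using \<rho>' L by simp
    fix y assume y: "y \<in> ball z (\<rho>' / (2 + L))"
    have "\<rho>' / (2 + L) \<le> \<rho>'" using \<rho>' L by (simp add: field_simps)
    then have yb: "y \<in> ball z r" and zb: "z \<in> ball z r" using y \<rho>' r by auto
    have "h z = 0" using frontier_iff[OF zb] z by simp
    then have hy: "\<bar>h y\<bar> \<le> (1 + L) * dist z y"
      using lip[OF yb zb] by (simp add: dist_norm norm_minus_commute)
    have "(2 + L) * dist z y < (2 + L) * (\<rho>' / (2 + L))"
      using y L by (intro mult_strict_left_mono) auto
    also have "\<dots> = \<rho>'" using L by simp
    finally have "dist z y + \<bar>h y\<bar> \<le> \<rho>'" using hy by (simp add: algebra_simps)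
    define c where "c = y + (- h y) *\<^sub>R \<nu>"
    have "dist z c \<le> dist z y + \<bar>h y\<bar>"
      using dist_triangle[of z c y] \<nu> by (simp add: c_def dist_norm)
    then have cb: "c \<in> cball z \<rho>'" using \<open>dist z y + \<bar>h y\<bar> \<le> \<rho>'\<close> by simp
    then have "h c = 0" using tr[OF yb, of "- h y"] sub by (auto simp: c_def)
    then have "c \<in> A" using frontier_iff cb sub by (auto simp: A_def)
    moreover have "\<bar>h y\<bar> \<le> 1" using \<open>dist z y + \<bar>h y\<bar> \<le> \<rho>'\<close> \<rho>'(4) zero_le_dist[of z y] by linarith
    ultimately show "\<exists>c\<in>A. \<exists>t. \<bar>t\<bar> \<le> 1 \<and> y = c + t *\<^sub>R \<nu>"
      by (intro bexI[of _ c] exI[of _ "h y"]) (auto simp: c_def)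
  qed
  moreover have "emeasure (surface_measure \<Omega>) A = hausdorff_outer (DIM('a) - 1) A"
    unfolding surface_measure_def
    using clA by (subst emeasure_restrict_space)
      (auto simp: A_def emeasure_hausdorff_measure borel_closed)
  moreover have "A \<subseteq> frontier \<Omega> \<inter> cball z \<rho>"
    using subset_cball[OF \<rho>'(2), of z] by (auto simp: A_def)
  ultimately show thesis
    using that[OF clA] by simp
qed

section \<open>Optimality of a Dirac mass\<close>

lemma integral_dirac_mass:
  fixes f :: "'a::euclidean_space \<Rightarrow> real"
  assumes m: "0 \<le> m" and x: "x \<in> frontier \<Omega>" and f: "continuous_on (frontier \<Omega>) f" "\<And>y. 0 \<le> f y"
  shows "(LINT y|dirac_mass m \<Omega> x. f y) = m * f x"
proof -
  have meas: "f \<in> borel_measurable (restrict_space borel (frontier \<Omega>))"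
    using f(1) by (rule borel_measurable_continuous_on_restrict)
  have "(LINT y|dirac_mass m \<Omega> x. f y) = enn2real (\<integral>\<^sup>+y. ennreal (f y) \<partial>dirac_mass m \<Omega> x)"
    using f(2) meas
    by (intro integral_eq_nn_integral)
       (auto simp: dirac_mass_def cong: measurable_cong_sets[OF sets_scale_measure refl])
  also have "\<dots> = enn2real (ennreal m * ennreal (f x))"
    unfolding dirac_mass_def using meas x
    by (subst nn_integral_scale_measure)
       (auto simp: nn_integral_return space_restrict_space cong: measurable_cong_sets[OF sets_return refl])
  also have "\<dots> = m * f x"
    using m f(2)[of x] by (simp add: ennreal_mult'[symmetric])
  finally show ?thesis .
qed

lemma emeasure_dirac_mass_space:
  assumes "x \<in> frontier \<Omega>"
  shows "emeasure (dirac_mass m \<Omega> x) (space (dirac_mass m \<Omega> x)) = ennreal m"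
  using assms sets.top[of "restrict_space borel (frontier \<Omega>)"]
  by (simp add: dirac_mass_def space_scale_measure space_restrict_space)

text \<open>The Rayleigh quotient for mass \<open>m\<close> at \<open>x\<close>, written with the
  point instead of the measure so that its dependence on \<open>x\<close> can be studied
  directly.\<close>

definition dirac_quotient ::
  "real \<Rightarrow> real \<Rightarrow> 'a::euclidean_space set \<Rightarrow> ('a \<Rightarrow> real) \<Rightarrow> 'a \<Rightarrow> real" where
  "dirac_quotient p m \<Omega> u x =
     ((LINT y|lebesgue_on \<Omega>. norm (weak_gradient p \<Omega> u y) powr p) +
       m * \<bar>continuous_rep \<Omega> u x\<bar> powr p) / (LINT y|lebesgue_on \<Omega>. \<bar>u y\<bar> powr p)"

lemma dirac_quotient_nonneg: "0 \<le> m \<Longrightarrow> 0 \<le> dirac_quotient p m \<Omega> u x"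
  unfolding dirac_quotient_def
  by (intro divide_nonneg_nonneg add_nonneg_nonneg mult_nonneg_nonneg
      Bochner_Integration.integral_nonneg) auto

lemma bdd_below_dirac_quotient: "0 \<le> m \<Longrightarrow> bdd_below ((\<lambda>u. dirac_quotient p m \<Omega> u x) ` S)"
  by (rule bdd_belowI2[of _ 0]) (rule dirac_quotient_nonneg)

section \<open>The eigenvalue of a Dirac mass as a function of its position\<close>

locale C1_holder_domain =
  fixes \<Omega> :: "'a::euclidean_space set" and p \<epsilon> :: real
  assumes open_\<Omega>: "open \<Omega>" and bounded_\<Omega>: "bounded \<Omega>" and nonempty_\<Omega>: "\<Omega> \<noteq> {}"
    and p: "1 < p" "real DIM('a) < p"
    and bd: "C1_holder_boundary \<epsilon> \<Omega>" "0 \<le> \<epsilon>"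
begin

lemma compact_frontier: "compact (frontier \<Omega>)"
  using bounded_\<Omega> by (rule compact_frontier_bounded)

lemma frontier_nonempty: "frontier \<Omega> \<noteq> {}"
  using bounded_\<Omega> nonempty_\<Omega> not_bounded_UNIV by (auto simp: frontier_eq_empty)

lemma frontier_subset_closure: "frontier \<Omega> \<subseteq> closure \<Omega>"
  by (auto simp: frontier_def)

lemma continuous_on_rep_powr:
  assumes "u \<in> sobolev p \<Omega>"
  shows "continuous_on (frontier \<Omega>) (\<lambda>x. \<bar>continuous_rep \<Omega> u x\<bar> powr p)"
proof -
  have "continuous_on (frontier \<Omega>) (continuous_rep \<Omega> u)"
    using sobolev_continuous_rep(1)[OF open_\<Omega> bounded_\<Omega> p bd assms] frontier_subset_closure
    by (rule continuous_on_subset)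
  then show ?thesis
    using p by (intro continuous_on_powr' continuous_on_const continuous_on_rabs) auto
qed

lemma dirac_mass_in_dirac_measures:
  assumes "0 \<le> m" "x \<in> frontier \<Omega>"
  shows "dirac_mass m \<Omega> x \<in> dirac_measures p m \<Omega>"
proof -
  have "(LINT y|dirac_mass m \<Omega> x. \<bar>continuous_rep \<Omega> u y\<bar> powr p) = m * \<bar>continuous_rep \<Omega> u x\<bar> powr p"
    if "u \<in> sobolev p \<Omega>" for u
    using assms continuous_on_rep_powr[OF that] by (intro integral_dirac_mass) auto
  moreover have "dirac_mass m \<Omega> x \<in> boundary_measures m \<Omega>"
    using assms emeasure_dirac_mass_space[of x \<Omega> m]
    by (auto simp: boundary_measures_def dirac_mass_def)
  ultimately show ?thesis
    using assms by (auto simp: dirac_measures_def)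
qed

text \<open>The measure enters through its integrals of \<open>\<bar>u\<bar> powr p\<close> alone.
  So this covers every member of \<open>dirac_measures\<close>, and none of them has to be
  identified with a \<open>dirac_mass\<close>.\<close>

lemma ell1_measure_eq:
  assumes "\<And>u. u \<in> sobolev p \<Omega> \<Longrightarrow>
    (LINT y|\<mu>. \<bar>continuous_rep \<Omega> u y\<bar> powr p) = m * \<bar>continuous_rep \<Omega> u x\<bar> powr p"
  shows "ell1_measure p \<mu> \<Omega> = (INF u\<in>sobolev_nonzero p \<Omega>. dirac_quotient p m \<Omega> u x)"
  unfolding ell1_measure_def
  by (rule INF_cong[OF refl]) (simp add: dirac_quotient_def assms sobolev_nonzero_def)

lemma ell1_dirac_mass:
  assumes "0 \<le> m" "x \<in> frontier \<Omega>"
  shows "ell1_measure p (dirac_mass m \<Omega> x) \<Omega> = (INF u\<in>sobolev_nonzero p \<Omega>. dirac_quotient p m \<Omega> u x)"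
  using assms by (intro ell1_measure_eq integral_dirac_mass continuous_on_rep_powr) auto

text \<open>Moving the point changes each quotient by at most a factor \<open>1 + m * \<eta>\<close>
  and a summand \<open>m * \<eta>\<close>. Such an estimate passes to the infimum, and an upper
  bound for the infimum turns it into an additive error uniform on the boundary.\<close>

lemma continuous_on_ell1_dirac_mass:
  assumes m: "0 < m" and ne: "sobolev_nonzero p \<Omega> \<noteq> {}"
  shows "continuous_on (frontier \<Omega>) (\<lambda>x. INF u\<in>sobolev_nonzero p \<Omega>. dirac_quotient p m \<Omega> u x)"
    (is "continuous_on _ ?e")
proof -
  let ?S = "sobolev_nonzero p \<Omega>"
  have e0: "0 \<le> ?e x" for x
    using m ne by (intro cINF_greatest dirac_quotient_nonneg) auto
  have e_le: "?e x \<le> dirac_quotient p m \<Omega> u x" if "u \<in> ?S" for u x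
    using m that by (intro cINF_lower bdd_below_dirac_quotient) auto
  \<comment> \<open>A single nonzero \<open>u\<close> bounds the infimum on the whole compact
    boundary.\<close>
  obtain E where E: "\<And>x. x \<in> frontier \<Omega> \<Longrightarrow> ?e x \<le> E"
  proof -
    obtain u where u: "u \<in> ?S" using ne by blast
    have "continuous_on (frontier \<Omega>) (dirac_quotient p m \<Omega> u)"
      unfolding dirac_quotient_def[abs_def] divide_inverse
      using u by (intro continuous_intros continuous_on_rep_powr) (simp add: sobolev_nonzero_def)
    from continuous_attains_sup[OF compact_frontier frontier_nonempty this]
    obtain y where "\<forall>x\<in>frontier \<Omega>. dirac_quotient p m \<Omega> u x \<le> dirac_quotient p m \<Omega> u y" by blast
    then show thesis
      using that e_le[OF u] order_trans by blast
  qed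
  have E0: "0 \<le> E" using E e0 frontier_nonempty order_trans by blast
  show ?thesis
    unfolding continuous_on_iff
  proof (intro ballI allI impI)
    fix x e :: real and z assume z: "z \<in> frontier \<Omega>" and e: "0 < (e::real)"
    \<comment> \<open>The final error is \<open>m * \<eta> * (?e y + 1)\<close>, which this choice
      keeps below \<open>e / 2\<close>.\<close>
    define \<eta> where "\<eta> = e / 2 / (E + 1) / m"
    have \<eta>: "0 < \<eta>" using e m E0 by (simp add: \<eta>_def)
    have "E + 1 \<noteq> 0" using E0 by simp
    then have m\<eta>: "m * \<eta> * (E + 1) = e / 2"
      using m unfolding \<eta>_def by (simp del: divide_divide_eq_left)
    obtain \<delta> where \<delta>: "0 < \<delta>" "\<And>u x y. u \<in> ?S \<Longrightarrow> x \<in> closure \<Omega> \<Longrightarrow> y \<in> closure \<Omega> \<Longrightarrow> dist x y < \<delta> \<Longrightarrow>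
        \<bar>\<bar>continuous_rep \<Omega> u x\<bar> powr p - \<bar>continuous_rep \<Omega> u y\<bar> powr p\<bar> \<le> \<eta> * sobolev_energy p \<Omega> u"
      using sobolev_powr_modulus[OF open_\<Omega> bounded_\<Omega> p bd \<eta>] by blast
    have key: "?e x \<le> ?e y + e / 2"
      if x: "x \<in> frontier \<Omega>" and y: "y \<in> frontier \<Omega>" and xy: "dist x y < \<delta>" for x y
    proof -
      have c: "0 < 1 + m * \<eta>" using m \<eta> by (simp add: add_pos_pos)
      have "(?e x - m * \<eta>) / (1 + m * \<eta>) \<le> dirac_quotient p m \<Omega> u y" if u: "u \<in> ?S" for u
      proof -
        let ?G = "LINT y|lebesgue_on \<Omega>. norm (weak_gradient p \<Omega> u y) powr p"
        let ?D = "LINT y|lebesgue_on \<Omega>. \<bar>u y\<bar> powr p"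
        let ?w = "\<lambda>x. \<bar>continuous_rep \<Omega> u x\<bar> powr p"
        have D: "0 < ?D" using sobolev_nonzero_integral_pos[OF u] p by simp
        have "?w x \<le> ?w y + \<eta> * (?G + ?D)"
          using \<delta>(2)[OF u _ _ xy] x y frontier_subset_closure
          by (fastforce simp: sobolev_energy_def abs_le_iff)
        then have "m * ?w x \<le> m * (?w y + \<eta> * (?G + ?D))"
          using m by (intro mult_left_mono) auto
        \<comment> \<open>Adding the nonnegative boundary term completes the gradient part of the
          energy to the numerator of the quotient at \<open>y\<close>.\<close>
        also have "\<dots> \<le> m * ?w y + m * \<eta> * (?G + m * ?w y + ?D)"
          using m \<eta> by (simp add: algebra_simps)
        finally have "?G + m * ?w x \<le> (1 + m * \<eta>) * (?G + m * ?w y) + m * \<eta> * ?D"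
          by (simp add: algebra_simps)
        then have "(?G + m * ?w x) / ?D \<le> ((1 + m * \<eta>) * (?G + m * ?w y) + m * \<eta> * ?D) / ?D"
          using D by (intro divide_right_mono) auto
        also have "\<dots> = (1 + m * \<eta>) * ((?G + m * ?w y) / ?D) + m * \<eta>"
          using D by (simp add: add_divide_distrib[of "(1 + m * \<eta>) * (?G + m * ?w y)"])
        finally have "dirac_quotient p m \<Omega> u x \<le> (1 + m * \<eta>) * dirac_quotient p m \<Omega> u y + m * \<eta>"
          by (simp only: dirac_quotient_def)
        then have "?e x - m * \<eta> \<le> dirac_quotient p m \<Omega> u y * (1 + m * \<eta>)"
          using e_le[OF u, of x] by (simp add: mult.commute)
        then show ?thesis using c by (simp add: pos_divide_le_eq)
      qed
      then have "(?e x - m * \<eta>) / (1 + m * \<eta>) \<le> ?e y"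
        by (intro cINF_greatest ne)
      then have "?e x \<le> ?e y + m * \<eta> * (?e y + 1)"
        using c by (simp add: pos_divide_le_eq algebra_simps)
      also have "\<dots> \<le> ?e y + m * \<eta> * (E + 1)"
        using E[OF y] m \<eta> by (intro add_left_mono mult_left_mono) auto
      finally show ?thesis by (simp only: m\<eta>)
    qed
    have "dist (?e y) (?e z) < e" if "y \<in> frontier \<Omega>" "dist y z < \<delta>" for y
      using key[OF that(1) z that(2)] key[OF z that(1)] that(2) e
      by (simp add: dist_real_def dist_commute abs_less_iff)
    then show "\<exists>d>0. \<forall>y\<in>frontier \<Omega>. dist y z < d \<longrightarrow> dist (?e y) (?e z) < e"
      using \<delta>(1) by blast
  qed
qed

section \<open>Boundary densities compared with point masses\<close>

lemma sets_surface_measure: "sets (surface_measure \<Omega>) = sets (restrict_space borel (frontier \<Omega>))"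
  unfolding surface_measure_def by (intro sets_restrict_space_cong) simp

lemma space_surface_measure [simp]: "space (surface_measure \<Omega>) = frontier \<Omega>"
  by (simp add: surface_measure_def space_restrict_space)

lemma rep_powr_measurable:
  assumes "u \<in> sobolev p \<Omega>"
  shows "(\<lambda>x. \<bar>continuous_rep \<Omega> u x\<bar> powr p) \<in> borel_measurable (surface_measure \<Omega>)"
  using borel_measurable_continuous_on_restrict[OF continuous_on_rep_powr[OF assms]]
  by (simp cong: measurable_cong_sets[OF sets_surface_measure refl])

lemma integrable_density_rep:
  assumes \<sigma>: "\<sigma> \<in> boundary_densities m \<Omega>" and u: "u \<in> sobolev p \<Omega>"
  shows "integrable (surface_measure \<Omega>) (\<lambda>x. \<sigma> x * \<bar>continuous_rep \<Omega> u x\<bar> powr p)"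
proof -
  let ?w = "\<lambda>x. \<bar>continuous_rep \<Omega> u x\<bar> powr p"
  obtain y where y: "\<forall>x\<in>frontier \<Omega>. ?w x \<le> ?w y"
    using continuous_attains_sup[OF compact_frontier frontier_nonempty continuous_on_rep_powr[OF u]] by blast
  have i: "integrable (surface_measure \<Omega>) \<sigma>" using \<sigma> by (simp add: boundary_densities_def)
  show ?thesis
  proof (rule Bochner_Integration.integrable_bound)
    show "integrable (surface_measure \<Omega>) (\<lambda>x. ?w y * \<sigma> x)" using i by simp
    show "(\<lambda>x. \<sigma> x * ?w x) \<in> borel_measurable (surface_measure \<Omega>)"
      using borel_measurable_integrable[OF i] rep_powr_measurable[OF u] by measurable
    have "norm (\<sigma> x * ?w x) \<le> norm (?w y * \<sigma> x)" if "x \<in> frontier \<Omega>" for x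
      using mult_left_mono[OF bspec[OF y that], of "\<bar>\<sigma> x\<bar>"] by (simp add: abs_mult mult.commute)
    then show "AE x in surface_measure \<Omega>. norm (\<sigma> x * ?w x) \<le> norm (?w y * \<sigma> x)"
      by (intro AE_I2) simp
  qed
qed

text \<open>A constant density on a boundary piece so small that \<open>\<bar>u\<bar> powr p\<close>
  exceeds its value at \<open>z\<close> by at most \<open>e\<close> there. Positive measure of the
  piece allows normalising to mass \<open>m\<close>; finite measure makes the density
  integrable.\<close>

lemma concentrated_density:
  assumes m: "0 < m" and z: "z \<in> frontier \<Omega>" and u: "u \<in> sobolev p \<Omega>" and e: "0 < e"
  obtains \<sigma> where "\<sigma> \<in> boundary_densities m \<Omega>"
    "(LINT x|surface_measure \<Omega>. \<sigma> x * \<bar>continuous_rep \<Omega> u x\<bar> powr p)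
      \<le> m * (\<bar>continuous_rep \<Omega> u z\<bar> powr p + e)"
proof -
  let ?w = "\<lambda>x. \<bar>continuous_rep \<Omega> u x\<bar> powr p" and ?\<mu> = "surface_measure \<Omega>"
  obtain d where d: "0 < d" "\<And>x. x \<in> frontier \<Omega> \<Longrightarrow> dist x z < d \<Longrightarrow> dist (?w x) (?w z) < e"
    using continuous_on_rep_powr[OF u] z e unfolding continuous_on_iff by meson
  obtain A where A: "closed A" "A \<subseteq> frontier \<Omega> \<inter> cball z (d / 2)"
    "0 < emeasure ?\<mu> A" "emeasure ?\<mu> A < top"
    using surface_measure_frontier_ball[OF open_\<Omega> bd z, of "d / 2"] d by auto
  have Am: "A \<in> sets ?\<mu>"
    using A by (auto simp: sets_surface_measure sets_restrict_space_iff borel_closed)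
  have mA: "0 < measure ?\<mu> A"
    using A by (simp add: measure_def enn2real_positive_iff)
  define \<sigma> where "\<sigma> x = m / measure ?\<mu> A * indicator A x" for x
  have iA: "integrable ?\<mu> (indicator A :: 'a \<Rightarrow> real)"
    using Am A(4) by (simp add: less_top)
  have \<sigma>i: "integrable ?\<mu> \<sigma>"
    unfolding \<sigma>_def[abs_def] using iA by (intro integrable_mult_right)
  have \<sigma>m: "(LINT x|?\<mu>. \<sigma> x) = m"
    unfolding \<sigma>_def using Am mA A(2) by (simp add: Int_absorb2)
  have \<sigma>0: "0 \<le> \<sigma> x" for x using m mA by (simp add: \<sigma>_def)
  have \<sigma>: "\<sigma> \<in> boundary_densities m \<Omega>"
    using \<sigma>i \<sigma>m \<sigma>0 by (simp add: boundary_densities_def)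
  moreover have "(LINT x|?\<mu>. \<sigma> x * ?w x) \<le> (LINT x|?\<mu>. (?w z + e) * \<sigma> x)"
  proof (rule integral_mono[OF integrable_density_rep[OF \<sigma> u]])
    show "integrable ?\<mu> (\<lambda>x. (?w z + e) * \<sigma> x)" using \<sigma>i by simp
    fix x assume "x \<in> space ?\<mu>"
    show "\<sigma> x * ?w x \<le> (?w z + e) * \<sigma> x"
    proof (cases "x \<in> A")
      case True
      then have "x \<in> frontier \<Omega>" "dist x z < d" using A(2) d(1) by (auto simp: dist_commute)
      then have "?w x \<le> ?w z + e" using d(2)[of x] by (simp add: dist_real_def abs_less_iff)
      then show ?thesis using \<sigma>0[of x] mult_left_mono by (metis mult.commute)
    qed (simp add: \<sigma>_def)
  qed
  then have "(LINT x|?\<mu>. \<sigma> x * ?w x) \<le> m * (?w z + e)"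
    using \<sigma>i \<sigma>m by (simp add: mult.commute)
  ultimately show thesis by (rule that)
qed

lemma density_integral_ge:
  assumes \<sigma>: "\<sigma> \<in> boundary_densities m \<Omega>" and u: "u \<in> sobolev p \<Omega>"
    and c: "\<And>x. x \<in> frontier \<Omega> \<Longrightarrow> c \<le> \<bar>continuous_rep \<Omega> u x\<bar> powr p"
  shows "m * c \<le> (LINT x|surface_measure \<Omega>. \<sigma> x * \<bar>continuous_rep \<Omega> u x\<bar> powr p)"
proof -
  let ?\<mu> = "surface_measure \<Omega>"
  have i: "integrable ?\<mu> \<sigma>" and pos: "AE x in ?\<mu>. 0 \<le> \<sigma> x" and mass: "(LINT x|?\<mu>. \<sigma> x) = m"
    using \<sigma> by (auto simp: boundary_densities_def)
  have "m * c = (LINT x|?\<mu>. \<sigma> x * c)" using i mass by simp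
  also have "\<dots> \<le> (LINT x|?\<mu>. \<sigma> x * \<bar>continuous_rep \<Omega> u x\<bar> powr p)"
  proof (rule integral_mono_AE[OF _ integrable_density_rep[OF \<sigma> u]])
    show "integrable ?\<mu> (\<lambda>x. \<sigma> x * c)" using i by simp
    show "AE x in ?\<mu>. \<sigma> x * c \<le> \<sigma> x * \<bar>continuous_rep \<Omega> u x\<bar> powr p"
      using pos AE_space by eventually_elim (auto intro!: mult_left_mono c)
  qed
  finally show ?thesis .
qed

text \<open>The lower bound replaces a density by the point mass at a boundary minimum of
  \<open>\<bar>u\<bar> powr p\<close>, a point that varies with \<open>u\<close>; \<open>min\<close>
  then moves it to \<open>z\<close>. The upper bound is shown for one \<open>u\<close> at a time, so
  the concentrating density may be adapted to that \<open>u\<close>.\<close>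

lemma optimal_lambda_eq_minimum:
  assumes m: "0 < m" and ne: "sobolev_nonzero p \<Omega> \<noteq> {}" and z: "z \<in> frontier \<Omega>"
    and min: "\<And>x. x \<in> frontier \<Omega> \<Longrightarrow>
      (INF u\<in>sobolev_nonzero p \<Omega>. dirac_quotient p m \<Omega> u z)
        \<le> (INF u\<in>sobolev_nonzero p \<Omega>. dirac_quotient p m \<Omega> u x)"
  shows "optimal_lambda p m \<Omega> = (INF u\<in>sobolev_nonzero p \<Omega>. dirac_quotient p m \<Omega> u z)"
proof -
  let ?S = "sobolev_nonzero p \<Omega>" and ?\<Sigma> = "boundary_densities m \<Omega>"
  let ?e = "\<lambda>x. INF u\<in>?S. dirac_quotient p m \<Omega> u x"
  let ?R = "\<lambda>\<sigma> u. ((LINT x|lebesgue_on \<Omega>. norm (weak_gradient p \<Omega> u x) powr p) +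
         (LINT x|surface_measure \<Omega>. \<sigma> x * \<bar>continuous_rep \<Omega> u x\<bar> powr p)) /
        (LINT x|lebesgue_on \<Omega>. \<bar>u x\<bar> powr p)"
  have S: "u \<in> sobolev p \<Omega>" if "u \<in> ?S" for u using that by (simp add: sobolev_nonzero_def)
  have D: "0 < (LINT x|lebesgue_on \<Omega>. \<bar>u x\<bar> powr p)" if "u \<in> ?S" for u
    using sobolev_nonzero_integral_pos[OF that] p by simp
  have R_ge: "?e z \<le> ?R \<sigma> u" if \<sigma>: "\<sigma> \<in> ?\<Sigma>" and u: "u \<in> ?S" for \<sigma> u
  proof -
    obtain x where x: "x \<in> frontier \<Omega>"
      "\<forall>y\<in>frontier \<Omega>. \<bar>continuous_rep \<Omega> u x\<bar> powr p \<le> \<bar>continuous_rep \<Omega> u y\<bar> powr p"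
      using continuous_attains_inf[OF compact_frontier frontier_nonempty continuous_on_rep_powr[OF S[OF u]]]
      by blast
    have "?e z \<le> ?e x" by (rule min[OF x(1)])
    also have "\<dots> \<le> dirac_quotient p m \<Omega> u x"
      using m u by (intro cINF_lower bdd_below_dirac_quotient) auto
    also have "\<dots> \<le> ?R \<sigma> u"
      unfolding dirac_quotient_def using D[OF u] x(2)
      by (intro divide_right_mono add_left_mono density_integral_ge[OF \<sigma> S[OF u]]) auto
    finally show ?thesis .
  qed
  \<comment> \<open>This also supplies the boundedness below that a real infimum over
    \<open>?\<Sigma>\<close> requires.\<close>
  have ell_ge: "?e z \<le> ell1_density p \<sigma> \<Omega>" if "\<sigma> \<in> ?\<Sigma>" for \<sigma>
    unfolding ell1_density_def using ne R_ge[OF that] by (intro cINF_greatest)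
  have \<Sigma>ne: "?\<Sigma> \<noteq> {}"
  proof -
    obtain u where "u \<in> ?S" using ne by blast
    then show ?thesis using concentrated_density[OF m z S, of u 1] by auto
  qed
  have "optimal_lambda p m \<Omega> \<le> dirac_quotient p m \<Omega> u z" if u: "u \<in> ?S" for u
  proof (rule field_le_epsilon)
    fix e :: real assume e: "0 < e"
    let ?D = "LINT x|lebesgue_on \<Omega>. \<bar>u x\<bar> powr p"
    let ?w = "\<bar>continuous_rep \<Omega> u z\<bar> powr p"
    \<comment> \<open>The tolerance \<open>e * ?D / m\<close> becomes exactly \<open>e\<close> after
      multiplication by \<open>m\<close> and division by \<open>?D\<close>.\<close>
    obtain \<sigma> where \<sigma>: "\<sigma> \<in> ?\<Sigma>"
      "(LINT x|surface_measure \<Omega>. \<sigma> x * \<bar>continuous_rep \<Omega> u x\<bar> powr p) \<le> m * (?w + e * ?D / m)"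
      by (rule concentrated_density[OF m z S[OF u], of "e * ?D / m"]) (use e m D[OF u] in auto)
    have "optimal_lambda p m \<Omega> \<le> ell1_density p \<sigma> \<Omega>"
      unfolding optimal_lambda_def using ell_ge \<sigma>(1) by (intro cINF_lower bdd_belowI2)
    also have "\<dots> \<le> ?R \<sigma> u"
      unfolding ell1_density_def using R_ge[OF \<sigma>(1)] u by (intro cINF_lower bdd_belowI2)
    also have "\<dots> \<le> ((LINT x|lebesgue_on \<Omega>. norm (weak_gradient p \<Omega> u x) powr p) + m * (?w + e * ?D / m)) / ?D"
      using D[OF u] \<sigma>(2) by (intro divide_right_mono add_left_mono) auto
    also have "m * (?w + e * ?D / m) = m * ?w + e * ?D"
      using m by (simp add: distrib_left)
    also have "((LINT x|lebesgue_on \<Omega>. norm (weak_gradient p \<Omega> u x) powr p) + (m * ?w + e * ?D)) / ?D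
        = dirac_quotient p m \<Omega> u z + e"
      using D[OF u] by (simp add: dirac_quotient_def add_divide_distrib)
    finally show "optimal_lambda p m \<Omega> \<le> dirac_quotient p m \<Omega> u z + e" .
  qed
  then have "optimal_lambda p m \<Omega> \<le> ?e z" by (intro cINF_greatest ne)
  moreover have "?e z \<le> optimal_lambda p m \<Omega>"
    unfolding optimal_lambda_def using \<Sigma>ne ell_ge by (intro cINF_greatest)
  ultimately show ?thesis by simp
qed

theorem optimal_dirac_mass_exists:
  assumes m: "0 < m"
  shows "\<exists>x\<in>frontier \<Omega>. dirac_mass m \<Omega> x \<in> dirac_measures p m \<Omega> \<and>
     optimal_lambda p m \<Omega> = ell1_measure p (dirac_mass m \<Omega> x) \<Omega> \<and>
     ell1_measure p (dirac_mass m \<Omega> x) \<Omega> = (INF \<mu>\<in>dirac_measures p m \<Omega>. ell1_measure p \<mu> \<Omega>)"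
proof -
  let ?S = "sobolev_nonzero p \<Omega>"
  let ?e = "\<lambda>x. INF u\<in>?S. dirac_quotient p m \<Omega> u x"
  have m0: "0 \<le> m" using m by simp
  obtain z where z: "z \<in> frontier \<Omega>" and min: "\<And>x. x \<in> frontier \<Omega> \<Longrightarrow> ?e z \<le> ?e x"
  proof (cases "?S = {}")
    \<comment> \<open>This case cannot occur for nonempty \<open>\<Omega>\<close>, but it is harmless: all infima are then the junk value \<open>Inf {}\<close>.\<close>
    case True
    then show thesis using that frontier_nonempty by auto
  next
    case False
    show thesis
      using continuous_attains_inf[OF compact_frontier frontier_nonempty
          continuous_on_ell1_dirac_mass[OF m False]] that by blast
  qed
  have opt: "optimal_lambda p m \<Omega> = ?e z"
  proof (cases "?S = {}")
    case True
    \<comment> \<open>The zero function is inserted into \<open>concentrated_density\<close> to see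
      that densities exist, so that the infimum of a constant over them is that constant.\<close>
    have "(\<lambda>_. 0) \<in> sobolev p \<Omega>"
      by (auto simp: sobolev_def Lp_def has_weak_gradient_def L1_loc_def intro!: exI[of _ "\<lambda>_. 0"])
    then obtain \<sigma> where "\<sigma> \<in> boundary_densities m \<Omega>"
      using concentrated_density[OF m z, of "\<lambda>_. 0" 1] by auto
    then show ?thesis
      using True by (simp add: optimal_lambda_def ell1_density_def image_constant[of \<sigma>])
  next
    case False
    show ?thesis by (rule optimal_lambda_eq_minimum[OF m False z min])
  qed
  have ez: "ell1_measure p (dirac_mass m \<Omega> z) \<Omega> = ?e z"
    by (rule ell1_dirac_mass[OF m0 z])
  \<comment> \<open>Each member of \<open>dirac_measures\<close> has the eigenvalue
    \<open>?e x\<close> of its own point \<open>x\<close>, so the infimum is a minimum, attained by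
    the Dirac mass at \<open>z\<close>.\<close>
  have "(INF \<mu>\<in>dirac_measures p m \<Omega>. ell1_measure p \<mu> \<Omega>) = ?e z"
  proof (rule cInf_eq_minimum)
    show "?e z \<in> (\<lambda>\<mu>. ell1_measure p \<mu> \<Omega>) ` dirac_measures p m \<Omega>"
      using ez dirac_mass_in_dirac_measures[OF m0 z] by (metis image_eqI)
    fix l assume "l \<in> (\<lambda>\<mu>. ell1_measure p \<mu> \<Omega>) ` dirac_measures p m \<Omega>"
    then obtain \<mu> x where "x \<in> frontier \<Omega>" and l: "l = ell1_measure p \<mu> \<Omega>"
      and \<mu>: "\<forall>u\<in>sobolev p \<Omega>.
        (LINT y|\<mu>. \<bar>continuous_rep \<Omega> u y\<bar> powr p) = m * \<bar>continuous_rep \<Omega> u x\<bar> powr p"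
      by (auto simp: dirac_measures_def)
    then show "?e z \<le> l"
      using min ell1_measure_eq[of \<mu> m x] by simp
  qed
  then show ?thesis
    using z ez opt dirac_mass_in_dirac_measures[OF m0 z] by (intro bexI[of _ z]) auto
qed

end

theorem theorem4p2:
  fixes \<Omega> :: "(real ^ 'n) set" and p \<epsilon> :: real
  assumes "open \<Omega>" "connected \<Omega>" "\<Omega> \<noteq> {}" "bounded \<Omega>"
    and "0 < \<epsilon>" "\<epsilon> \<le> 1" "C1_holder_boundary \<epsilon> \<Omega>"
    and "1 < p" "real CARD('n) < p"
  shows "\<forall>m>0. \<exists>x\<in>frontier \<Omega>.
           dirac_mass m \<Omega> x \<in> dirac_measures p m \<Omega> \<and>
           optimal_lambda p m \<Omega> = ell1_measure p (dirac_mass m \<Omega> x) \<Omega> \<and>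
           ell1_measure p (dirac_mass m \<Omega> x) \<Omega> =
             (INF \<mu>\<in>dirac_measures p m \<Omega>. ell1_measure p \<mu> \<Omega>)"
proof -
  interpret C1_holder_domain \<Omega> p \<epsilon>
    by unfold_locales (use assms in auto)
  show ?thesis using optimal_dirac_mass_exists by blast
qed

end
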